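(* Let $M$ be a smooth manifold of dimension $n$, let $1\le q\le n$, and let $V_q\in\wedge^q\mathfrak{X}(M)$ be a $q$-vector field on $M$ with constant coefficients. Then the Schouten–Nijenhuis bracket of $V_q$ with itself vanishes, i.e. $[V_q,V_q]=0$. Moreover, the Pfaffian system $P=\{w\in T_x^\ast M : i_w(V_q)_x=0,\ x\in M\}$ has locally constant rank, and for every $x\in M$ there exists an open neighbourhood $U_x$ of $x$ such that the module of sections $\Gamma(U_x,P)$ admits a basis consisting of closed $1$-forms; hence $P$ is integrable.
   Context: A $q$-vector field $V_q$ on $M$ has constant coefficients on a neighbourhood of $x\in M$ if there is a coordinate system $(u^1,\dots,u^n)$ centred at $x$ such that all the functions $V_q(du^{i_1},\dots,du^{i_q})$, $1\le i_1<\dots<i_q\le n$, are constant on the coordinate domain. $V_q$ has constant coefficients (on $M$) if this holds at every $x\in M$. $i_w$ denotes contraction of a multivector with the covector $w$. The Schouten–Nijenhuis bracket is the local $\mathbb{R}$-bilinear operation on multivector fields which on decomposable ones $A=X_1\wedge\cdots\wedge X_q$, $B=Y_1\wedge\cdots\wedge Y_r$ ($X_i,Y_j$ vector fields) is given by $$[A,B]=\sum_{i,j}(-1)^{i+j}[X_i,Y_j]\wedge X_1\wedge\cdots\wedge\widehat{X_i}\wedge\cdots\wedge X_q\wedge Y_1\wedge\cdots\wedge\widehat{Y_j}\wedge\cdots\wedge Y_r .$$ A Pfaffian system $P\subset T^\ast M$ of locally constant rank is integrable if, for every local section $\omega$ of $P$, $d\omega$ belongs to the ideal of differential forms generated by the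 local sections of $P$. *)

theory Defs
  imports
    "HOL-Analysis.Analysis"
    "HOL-Combinatorics.Permutations"
    "HOL-Library.Function_Algebras"
begin

text \<open>
  Conventions.  A manifold is a Hausdorff second countable space (the type \<open>'a\<close>) with a maximal
  smooth atlas of charts into \<open>real ^ 'n\<close>, so its dimension is \<open>CARD('n)\<close>.
  Tangent vectors at \<open>x\<close> are derivations of germs of smooth functions at \<open>x\<close>, covectors are linear
  functionals on the tangent space, and \<open>q\<close>-vectors at \<open>x\<close> are alternating \<open>q\<close>-linear forms on the
  cotangent space.  All these are total HOL functions, made unique by the value \<open>0\<close> outside their
  proper domain.  Fields are defined on all of \<open>'a\<close>; for a field on an open set only its values on that
  set matter.
\<close>

section \<open>Smooth manifolds\<close>

primrec Ck_on :: "nat \<Rightarrow> 'e::real_normed_vector set \<Rightarrow> ('e \<Rightarrow> 'f::real_normed_vector) \<Rightarrow> bool" where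
  "Ck_on 0 S f \<longleftrightarrow> continuous_on S f"
| "Ck_on (Suc k) S f \<longleftrightarrow>
     f differentiable_on S \<and> (\<forall>v. Ck_on k S (\<lambda>x. frechet_derivative f (at x) v))"

text \<open>Only used for open subsets of Euclidean spaces.\<close>
definition smooth_on :: "'e::real_normed_vector set \<Rightarrow> ('e \<Rightarrow> 'f::real_normed_vector) \<Rightarrow> bool" where
  "smooth_on S f \<longleftrightarrow> (\<forall>k. Ck_on k S f)"

type_synonym ('a, 'n) chart = "'a set \<times> ('a \<Rightarrow> real ^ 'n)"
type_synonym ('a, 'n) atlas = "('a, 'n) chart set"

definition is_chart :: "('a::topological_space, 'n::finite) chart \<Rightarrow> bool" where
  "is_chart c \<longleftrightarrow> (case c of (U, u) \<Rightarrow>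
     open U \<and> open (u ` U) \<and> homeomorphism U (u ` U) u (inv_into U u))"

definition compatible :: "('a::topological_space, 'n::finite) chart \<Rightarrow> ('a, 'n) chart \<Rightarrow> bool" where
  "compatible c d \<longleftrightarrow> (case c of (U, u) \<Rightarrow> case d of (W, w) \<Rightarrow>
     smooth_on (u ` (U \<inter> W)) (w \<circ> inv_into U u) \<and> smooth_on (w ` (U \<inter> W)) (u \<circ> inv_into W w))"

definition smooth_manifold ::
    "('a::{t2_space,second_countable_topology}, 'n::finite) atlas \<Rightarrow> bool" where
  "smooth_manifold M \<longleftrightarrow>
     (\<forall>c\<in>M. is_chart c) \<and> (\<Union>c\<in>M. fst c) = UNIV \<and> (\<forall>c\<in>M. \<forall>d\<in>M. compatible c d) \<and>
     (\<forall>c. is_chart c \<and> (\<forall>d\<in>M. compatible c d) \<longrightarrow> c \<in> M)"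

definition smooth_fun ::
    "('a::topological_space, 'n::finite) atlas \<Rightarrow> 'a set \<Rightarrow> ('a \<Rightarrow> real) \<Rightarrow> bool" where
  "smooth_fun M W f \<longleftrightarrow> (\<forall>(U, u)\<in>M. smooth_on (u ` (U \<inter> W)) (f \<circ> inv_into U u))"

definition smooth_near ::
    "('a::topological_space, 'n::finite) atlas \<Rightarrow> 'a \<Rightarrow> ('a \<Rightarrow> real) \<Rightarrow> bool" where
  "smooth_near M x f \<longleftrightarrow> (\<exists>W. open W \<and> x \<in> W \<and> smooth_fun M W f)"


section \<open>Tangent vectors, covectors and vector fields\<close>

type_synonym 'a tangent = "('a \<Rightarrow> real) \<Rightarrow> real"
type_synonym 'a covector = "'a tangent \<Rightarrow> real"

definition tangent_space ::
    "('a::topological_space, 'n::finite) atlas \<Rightarrow> 'a \<Rightarrow> 'a tangent set" where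
  "tangent_space M x = {D.
     (\<forall>f g. smooth_near M x f \<longrightarrow> smooth_near M x g \<longrightarrow>
        D (\<lambda>y. f y + g y) = D f + D g \<and> D (\<lambda>y. f y * g y) = f x * D g + g x * D f) \<and>
     (\<forall>c f. smooth_near M x f \<longrightarrow> D (\<lambda>y. c * f y) = c * D f) \<and>
     (\<forall>f g. (\<forall>\<^sub>F y in nhds x. f y = g y) \<longrightarrow> D f = D g) \<and>
     (\<forall>f. \<not> smooth_near M x f \<longrightarrow> D f = 0)}"

definition cotangent_space ::
    "('a::topological_space, 'n::finite) atlas \<Rightarrow> 'a \<Rightarrow> 'a covector set" where
  "cotangent_space M x = {w.
     (\<forall>v\<in>tangent_space M x. \<forall>v'\<in>tangent_space M x. w (\<lambda>f. v f + v' f) = w v + w v') \<and>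
     (\<forall>c. \<forall>v\<in>tangent_space M x. w (\<lambda>f. c * v f) = c * w v) \<and>
     (\<forall>v. v \<notin> tangent_space M x \<longrightarrow> w v = 0)}"

definition differential ::
    "('a::topological_space, 'n::finite) atlas \<Rightarrow> 'a \<Rightarrow> ('a \<Rightarrow> real) \<Rightarrow> 'a covector" where
  "differential M x f = (\<lambda>v. if v \<in> tangent_space M x then v f else 0)"

definition vector_field ::
    "('a::topological_space, 'n::finite) atlas \<Rightarrow> 'a set \<Rightarrow> ('a \<Rightarrow> 'a tangent) \<Rightarrow> bool" where
  "vector_field M U X \<longleftrightarrow>
     (\<forall>y\<in>U. X y \<in> tangent_space M y) \<and>
     (\<forall>W f. open W \<and> W \<subseteq> U \<and> smooth_fun M W f \<longrightarrow> smooth_fun M W (\<lambda>y. X y f))"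

definition lie_bracket ::
    "('a::topological_space, 'n::finite) atlas \<Rightarrow> ('a \<Rightarrow> 'a tangent) \<Rightarrow> ('a \<Rightarrow> 'a tangent) \<Rightarrow> 'a \<Rightarrow> 'a tangent"
  where
  "lie_bracket M X Y x = (\<lambda>f. if smooth_near M x f
      then X x (\<lambda>y. Y y f) - Y x (\<lambda>y. X y f) else 0)"


section \<open>Multivector fields\<close>

definition alternating_multilinear ::
    "('b \<Rightarrow> real) set \<Rightarrow> nat \<Rightarrow> (('b \<Rightarrow> real) list \<Rightarrow> real) \<Rightarrow> bool" where
  "alternating_multilinear S k F \<longleftrightarrow>
     (\<forall>ws. length ws = k \<and> set ws \<subseteq> S \<longrightarrow>
       (\<forall>i<k. \<forall>u\<in>S. \<forall>v\<in>S. F (ws[i := (\<lambda>t. u t + v t)]) = F (ws[i := u]) + F (ws[i := v])) \<and>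
       (\<forall>i<k. \<forall>c. \<forall>u\<in>S. F (ws[i := (\<lambda>t. c * u t)]) = c * F (ws[i := u])) \<and>
       (\<forall>i<k. \<forall>j<k. i \<noteq> j \<and> ws ! i = ws ! j \<longrightarrow> F ws = 0))"

type_synonym 'a multivector = "'a covector list \<Rightarrow> real"

definition multivector_space ::
    "('a::topological_space, 'n::finite) atlas \<Rightarrow> nat \<Rightarrow> 'a \<Rightarrow> 'a multivector set" where
  "multivector_space M q x = {F. alternating_multilinear (cotangent_space M x) q F \<and>
     (\<forall>ws. \<not> (length ws = q \<and> set ws \<subseteq> cotangent_space M x) \<longrightarrow> F ws = 0)}"

definition multivector_field ::
    "('a::topological_space, 'n::finite) atlas \<Rightarrow> nat \<Rightarrow> ('a \<Rightarrow> 'a multivector) \<Rightarrow> bool" where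
  "multivector_field M q V \<longleftrightarrow>
     (\<forall>x. V x \<in> multivector_space M q x) \<and>
     (\<forall>W fs. open W \<and> length fs = q \<and> (\<forall>f\<in>set fs. smooth_fun M W f) \<longrightarrow>
        smooth_fun M W (\<lambda>y. V y (map (differential M y) fs)))"

definition constant_coefficients_near ::
    "('a::topological_space, 'n::{finite,linorder}) atlas \<Rightarrow> nat \<Rightarrow> ('a \<Rightarrow> 'a multivector) \<Rightarrow> 'a \<Rightarrow> bool"
  where
  "constant_coefficients_near M q V x \<longleftrightarrow>
     (\<exists>U u. (U, u) \<in> M \<and> x \<in> U \<and> u x = 0 \<and>
       (\<forall>is :: 'n list. length is = q \<and> sorted_wrt (<) is \<longrightarrow>
          (\<exists>c. \<forall>y\<in>U. V y (map (\<lambda>i. differential M y (\<lambda>z. u z $ i)) is) = c)))"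

definition constant_coefficients ::
    "('a::topological_space, 'n::{finite,linorder}) atlas \<Rightarrow> nat \<Rightarrow> ('a \<Rightarrow> 'a multivector) \<Rightarrow> bool" where
  "constant_coefficients M q V \<longleftrightarrow> (\<forall>x. constant_coefficients_near M q V x)"

definition contraction :: "'a covector \<Rightarrow> 'a multivector \<Rightarrow> 'a multivector" where
  "contraction w F = (\<lambda>ws. F (w # ws))"

text \<open>\<open>v\<^sub>1 \<and> \<dots> \<and> v\<^sub>k\<close> as a form on covectors: \<open>(w\<^sub>1, \<dots>, w\<^sub>k) \<mapsto> det (w\<^sub>i v\<^sub>j)\<close>.\<close>
definition wedge ::
    "('a::topological_space, 'n::finite) atlas \<Rightarrow> 'a \<Rightarrow> 'a tangent list \<Rightarrow> 'a multivector" where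
  "wedge M x vs = (\<lambda>ws. if length ws = length vs \<and> set ws \<subseteq> cotangent_space M x
     then (\<Sum>p | p permutes {..<length vs}. of_int (sign p) * (\<Prod>i<length vs. (ws ! i) (vs ! p i)))
     else 0)"


section \<open>The Schouten--Nijenhuis bracket\<close>

definition remove_nth :: "nat \<Rightarrow> 'b list \<Rightarrow> 'b list" where
  "remove_nth i xs = take i xs @ drop (Suc i) xs"

text \<open>The bracket of \<open>X\<^sub>1 \<and> \<dots> \<and> X\<^sub>q\<close> and \<open>Y\<^sub>1 \<and> \<dots> \<and> Y\<^sub>r\<close> at \<open>x\<close>.  Indices start at \<open>0\<close>, which does not
  affect the parity of \<open>i + j\<close>.\<close>
definition schouten_decomposable ::
    "('a::topological_space, 'n::finite) atlas \<Rightarrow> ('a \<Rightarrow> 'a tangent) list \<Rightarrow> ('a \<Rightarrow> 'a tangent) list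
      \<Rightarrow> 'a \<Rightarrow> 'a multivector" where
  "schouten_decomposable M Xs Ys x = (\<lambda>ws.
     \<Sum>i<length Xs. \<Sum>j<length Ys. (- 1) ^ (i + j) *
       wedge M x (lie_bracket M (Xs ! i) (Ys ! j) x #
         map (\<lambda>Z. Z x) (remove_nth i Xs @ remove_nth j Ys)) ws)"

text \<open>On the open set \<open>U\<close>, \<open>V\<close> is the finite sum of the decomposable fields \<open>X\<^sub>1 \<and> \<dots> \<and> X\<^sub>q\<close>,
  \<open>[X\<^sub>1, \<dots>, X\<^sub>q]\<close> running through the list \<open>XX\<close>.\<close>
definition decomposition ::
    "('a::topological_space, 'n::finite) atlas \<Rightarrow> 'a set \<Rightarrow> nat \<Rightarrow> ('a \<Rightarrow> 'a multivector)
      \<Rightarrow> ('a \<Rightarrow> 'a tangent) list list \<Rightarrow> bool" where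
  "decomposition M U q V XX \<longleftrightarrow>
     (\<forall>Xs\<in>set XX. length Xs = q \<and> (\<forall>X\<in>set Xs. vector_field M U X)) \<and>
     (\<forall>y\<in>U. V y = (\<lambda>ws. \<Sum>Xs\<leftarrow>XX. wedge M y (map (\<lambda>X. X y) Xs) ws))"

text \<open>Every multivector field is locally a finite sum of decomposable ones (real factors are absorbed
  into the vector fields), so the bracket, being local and \<open>\<real>\<close>-bilinear, is determined by its values on
  decomposable fields.  Its value at \<open>x\<close> is the common value of the bilinearly extended formula
  over all decompositions near \<open>x\<close>.\<close>
definition schouten_bracket ::
    "('a::topological_space, 'n::finite) atlas \<Rightarrow> nat \<Rightarrow> nat \<Rightarrow> ('a \<Rightarrow> 'a multivector)
      \<Rightarrow> ('a \<Rightarrow> 'a multivector) \<Rightarrow> 'a \<Rightarrow> 'a multivector" where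
  "schouten_bracket M q r A B x = (THE F. \<exists>U XX YY. open U \<and> x \<in> U \<and>
     decomposition M U q A XX \<and> decomposition M U r B YY \<and>
     F = (\<lambda>ws. \<Sum>Xs\<leftarrow>XX. \<Sum>Ys\<leftarrow>YY. schouten_decomposable M Xs Ys x ws))"


section \<open>Differential forms\<close>

text \<open>A form is evaluated on lists of tangent vectors of any length, so that inhomogeneous forms are
  covered: the degree \<open>k\<close> component is the restriction to lists of length \<open>k\<close>.\<close>
type_synonym 'a form = "'a \<Rightarrow> 'a tangent list \<Rightarrow> real"

definition differential_forms ::
    "('a::topological_space, 'n::finite) atlas \<Rightarrow> 'a set \<Rightarrow> 'a form set" where
  "differential_forms M U = {\<alpha>.
     (\<forall>y\<in>U. (\<forall>k. alternating_multilinear (tangent_space M y) k (\<alpha> y)) \<and>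
             (\<forall>vs. \<not> set vs \<subseteq> tangent_space M y \<longrightarrow> \<alpha> y vs = 0)) \<and>
     (\<forall>W Xs. open W \<and> W \<subseteq> U \<and> (\<forall>X\<in>set Xs. vector_field M W X) \<longrightarrow>
        smooth_fun M W (\<lambda>y. \<alpha> y (map (\<lambda>X. X y) Xs)))}"

text \<open>Exterior product by the shuffle formula; the sign of the shuffle that moves the positions in
  \<open>I\<close> to the front is the parity of the number of inversions.\<close>
definition form_wedge :: "'a form \<Rightarrow> 'a form \<Rightarrow> 'a form" where
  "form_wedge \<alpha> \<beta> = (\<lambda>y vs. \<Sum>I\<in>Pow {..<length vs}.
     (- 1) ^ card {(i, j). i < j \<and> j < length vs \<and> i \<notin> I \<and> j \<in> I} *
       \<alpha> y (nths vs I) * \<beta> y (nths vs (- I)))"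

inductive_set form_ideal ::
    "('a::topological_space, 'n::finite) atlas \<Rightarrow> 'a set \<Rightarrow> 'a form set \<Rightarrow> 'a form set"
  for M U G where
  zero: "(\<lambda>y vs. 0) \<in> form_ideal M U G"
| generator: "\<gamma> \<in> G \<Longrightarrow> \<gamma> \<in> form_ideal M U G"
| add: "\<beta> \<in> form_ideal M U G \<Longrightarrow> \<gamma> \<in> form_ideal M U G \<Longrightarrow> (\<lambda>y vs. \<beta> y vs + \<gamma> y vs) \<in> form_ideal M U G"
| mult_left: "\<alpha> \<in> differential_forms M U \<Longrightarrow> \<beta> \<in> form_ideal M U G \<Longrightarrow> form_wedge \<alpha> \<beta> \<in> form_ideal M U G"
| mult_right: "\<alpha> \<in> differential_forms M U \<Longrightarrow> \<beta> \<in> form_ideal M U G \<Longrightarrow> form_wedge \<beta> \<alpha> \<in> form_ideal M U G"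

definition one_form ::
    "('a::topological_space, 'n::finite) atlas \<Rightarrow> 'a set \<Rightarrow> ('a \<Rightarrow> 'a covector) \<Rightarrow> bool" where
  "one_form M U \<omega> \<longleftrightarrow>
     (\<forall>y\<in>U. \<omega> y \<in> cotangent_space M y) \<and>
     (\<forall>W X. open W \<and> W \<subseteq> U \<and> vector_field M W X \<longrightarrow> smooth_fun M W (\<lambda>y. \<omega> y (X y)))"

definition form_of_one_form :: "('a \<Rightarrow> 'a covector) \<Rightarrow> 'a form" where
  "form_of_one_form \<omega> = (\<lambda>y vs. case vs of [v] \<Rightarrow> \<omega> y v | _ \<Rightarrow> 0)"

text \<open>\<open>d\<omega>(X, Y) = X(\<omega>(Y)) - Y(\<omega>(X)) - \<omega>([X, Y])\<close> for arbitrary local extensions \<open>X\<close>, \<open>Y\<close> of the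
  two tangent vectors.\<close>
definition exterior_derivative ::
    "('a::topological_space, 'n::finite) atlas \<Rightarrow> ('a \<Rightarrow> 'a covector) \<Rightarrow> 'a form" where
  "exterior_derivative M \<omega> = (\<lambda>x vs. case vs of
     [v, w] \<Rightarrow> if v \<in> tangent_space M x \<and> w \<in> tangent_space M x
       then (THE c. \<forall>U X Y. open U \<and> x \<in> U \<and> vector_field M U X \<and> vector_field M U Y \<and>
               X x = v \<and> Y x = w \<longrightarrow>
               c = X x (\<lambda>y. \<omega> y (Y y)) - Y x (\<lambda>y. \<omega> y (X y)) - \<omega> x (lie_bracket M X Y x))
       else 0
   | _ \<Rightarrow> 0)"

definition closed_one_form ::
    "('a::topological_space, 'n::finite) atlas \<Rightarrow> 'a set \<Rightarrow> ('a \<Rightarrow> 'a covector) \<Rightarrow> bool" where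
  "closed_one_form M U \<omega> \<longleftrightarrow>
     one_form M U \<omega> \<and> (\<forall>y\<in>U. exterior_derivative M \<omega> y = (\<lambda>vs. 0))"


section \<open>Pfaffian systems\<close>

interpretation real_fun: vector_space "\<lambda>c (f :: 'b \<Rightarrow> real) t. c * f t"
  by unfold_locales (auto simp: fun_eq_iff algebra_simps)

text \<open>A Pfaffian system is given by its fibres, subspaces of the cotangent spaces.\<close>
type_synonym 'a pfaffian = "'a \<Rightarrow> 'a covector set"

definition pfaffian_of ::
    "('a::topological_space, 'n::finite) atlas \<Rightarrow> ('a \<Rightarrow> 'a multivector) \<Rightarrow> 'a pfaffian" where
  "pfaffian_of M V x = {w \<in> cotangent_space M x. contraction w (V x) = (\<lambda>ws. 0)}"

definition locally_constant_rank :: "'a::topological_space pfaffian \<Rightarrow> bool" where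
  "locally_constant_rank P \<longleftrightarrow>
     (\<forall>x. \<exists>U. open U \<and> x \<in> U \<and> (\<forall>y\<in>U. real_fun.dim (P y) = real_fun.dim (P x)))"

definition pfaffian_sections ::
    "('a::topological_space, 'n::finite) atlas \<Rightarrow> 'a set \<Rightarrow> 'a pfaffian \<Rightarrow> ('a \<Rightarrow> 'a covector) set" where
  "pfaffian_sections M U P = {\<omega>. one_form M U \<omega> \<and> (\<forall>y\<in>U. \<omega> y \<in> P y)}"

text \<open>\<open>\<theta>s\<close> is a basis of the module of sections of \<open>P\<close> over \<open>U\<close>, the scalars being the smooth
  functions on \<open>U\<close>.\<close>
definition section_basis ::
    "('a::topological_space, 'n::finite) atlas \<Rightarrow> 'a set \<Rightarrow> 'a pfaffian \<Rightarrow> ('a \<Rightarrow> 'a covector) list \<Rightarrow> bool"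
  where
  "section_basis M U P \<theta>s \<longleftrightarrow>
     set \<theta>s \<subseteq> pfaffian_sections M U P \<and>
     (\<forall>\<omega>\<in>pfaffian_sections M U P. \<exists>f. (\<forall>i<length \<theta>s. smooth_fun M U (f i)) \<and>
        (\<forall>y\<in>U. \<omega> y = (\<lambda>v. \<Sum>i<length \<theta>s. f i y * (\<theta>s ! i) y v))) \<and>
     (\<forall>f. (\<forall>i<length \<theta>s. smooth_fun M U (f i)) \<and>
        (\<forall>y\<in>U. (\<lambda>v. \<Sum>i<length \<theta>s. f i y * (\<theta>s ! i) y v) = (\<lambda>v. 0)) \<longrightarrow>
        (\<forall>i<length \<theta>s. \<forall>y\<in>U. f i y = 0))"

text \<open>Membership of \<open>d\<omega>\<close> in the ideal generated by the local sections is a local condition, i.e.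
  membership in the corresponding sheaf of ideals.\<close>
definition integrable_pfaffian ::
    "('a::topological_space, 'n::finite) atlas \<Rightarrow> 'a pfaffian \<Rightarrow> bool" where
  "integrable_pfaffian M P \<longleftrightarrow>
     (\<forall>U \<omega>. open U \<and> \<omega> \<in> pfaffian_sections M U P \<longrightarrow>
       (\<forall>x\<in>U. \<exists>W. open W \<and> x \<in> W \<and> W \<subseteq> U \<and>
          (\<exists>\<beta>\<in>form_ideal M W (form_of_one_form ` pfaffian_sections M W P).
             \<forall>y\<in>W. exterior_derivative M \<omega> y = \<beta> y)))"

end

theory Submission
  imports Defs "Jordan_Normal_Form.Determinant"
begin

text \<open>
  In a chart \<open>u\<close> in which \<open>V\<close> has constant coefficients, take functions \<open>f\<^sub>1, f\<^sub>2, \<dots>\<close> that are linear in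
  the coordinates; then \<open>V(df\<^sub>1, \<dots>, df\<^sub>q)\<close> is constant.  Since \<open>[X, Y] f = X (Y f) - Y (X f)\<close>, evaluating
  the bracket of two decompositions of \<open>V\<close> on \<open>df\<^sub>1, df\<^sub>2, \<dots>\<close> gives two kinds of determinants.  By the
  Leibniz rule each sums up to derivatives \<open>X\<^sub>i (V(df, \<dots>, df))\<close> of constants times cofactors, hence
  vanishes.  As the differentials of such functions exhaust every cotangent space, this covers all
  covectors and all decompositions at once, so the well-definedness of the bracket need not be shown
  separately.

  In the same chart a covector \<open>\<Sum>\<^sub>i a\<^sub>i du\<^sup>i\<close> belongs to the Pfaffian system iff \<open>a\<close> lies in a fixed
  subspace of \<open>\<real>\<^sup>n\<close> determined by the coefficients of \<open>V\<close>.  A basis of this subspace consists of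
  coefficient vectors of functions \<open>g\<^sub>l\<close> linear in the coordinates, and the closed forms \<open>dg\<^sub>l\<close> are the required basis of
  sections.  A section is \<open>\<omega> = \<Sum>\<^sub>l f\<^sub>l dg\<^sub>l\<close>, and \<open>d\<omega> = \<Sum>\<^sub>l df\<^sub>l \<and> dg\<^sub>l\<close>.
\<close>

text \<open>Derivations of germs come without coordinates; Hadamard's lemma provides them. It needs
  a smooth remainder, hence ray integrals that can be differentiated any number of times. Once the
  coordinate derivations span the tangent space, every tangent vector extends to a field on the
  chart, which keeps the definite description in \<open>exterior_derivative\<close> from being
  vacuous. The hypothesis fixes only the coefficients with increasing indices. Skew symmetry carries
  constancy to all index lists, and multilinearity to all tuples of functions linear in the
  coordinates. All these tuples matter: columns that the derivative does not touch are removed by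
  cofactor expansion, which passes to sublists of the functions. The columns
  \<open>f \<mapsto> X (Y f)\<close> that occur are not tangent vectors, so determinants are built
  from arbitrary functions on the rows, by recursion on the list of columns. The description in
  \<open>schouten_bracket\<close> also calls for some decomposition to exist; it is assembled from
  coordinate fields, each coefficient being absorbed into the first factor.\<close>

no_notation vec_index (infixl "$" 100)
no_notation scalar_prod (infix "\<bullet>" 70)

section \<open>Smooth functions on Euclidean spaces\<close>

lemma linear_Basis_sum:
  fixes f :: "'e::euclidean_space \<Rightarrow> real"
  assumes "linear f"
  shows "f w = (\<Sum>b\<in>Basis. (w \<bullet> b) * f b)"
proof -
  have "f w = f (\<Sum>b\<in>Basis. (w \<bullet> b) *\<^sub>R b)" by (simp add: euclidean_representation)
  also have "\<dots> = (\<Sum>b\<in>Basis. (w \<bullet> b) * f b)"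
    using assms by (simp add: linear_sum linear_cmul)
  finally show ?thesis .
qed

text \<open>\<open>frechet_derivative\<close> is a choice among all derivatives, so it suffices that
  both functions have the same derivatives at \<open>x\<close>; this covers the case that there are
  none.\<close>

lemma frechet_derivative_cong_open:
  assumes "open S" "x \<in> S" "\<And>y. y \<in> S \<Longrightarrow> f y = g y"
  shows "frechet_derivative f (at x) = frechet_derivative g (at x)"
proof -
  have "(f has_derivative D) (at x) = (g has_derivative D) (at x)" for D
    using assms has_derivative_transform_within_open[of f D x UNIV S g]
      has_derivative_transform_within_open[of g D x UNIV S f] by auto
  then show ?thesis by (simp add: frechet_derivative_def)
qed

lemma Ck_on_cong:
  assumes "open S" "\<And>x. x \<in> S \<Longrightarrow> f x = g x" "Ck_on k S f"
  shows "Ck_on k S g"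
  using assms(2,3)
proof (induction k arbitrary: f g)
  case 0
  then show ?case by (auto cong: continuous_on_cong)
next
  case (Suc k)
  have "f differentiable_on S \<longleftrightarrow> g differentiable_on S"
    using Suc.prems(1) by (auto simp: differentiable_on_def
        intro: differentiable_transform_within[where d=1])
  moreover have "frechet_derivative f (at x) v = frechet_derivative g (at x) v" if "x \<in> S" for x v
    using frechet_derivative_cong_open[OF assms(1) that] Suc.prems(1) by metis
  ultimately show ?case using Suc.prems(2) Suc.IH[of "\<lambda>x. frechet_derivative f (at x) v"
      "\<lambda>x. frechet_derivative g (at x) v" for v] by auto
qed

lemma Ck_on_subset: "Ck_on k S f \<Longrightarrow> T \<subseteq> S \<Longrightarrow> Ck_on k T f"
proof (induction k arbitrary: f)
  case 0
  then show ?case using continuous_on_subset by auto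
next
  case (Suc k)
  then show ?case using differentiable_on_subset by (metis Ck_on.simps(2))
qed

lemma Ck_on_Suc_D:  "Ck_on (Suc k) S f \<Longrightarrow> Ck_on k S f"
proof (induction k arbitrary: f)
  case 0
  then show ?case by (simp add: differentiable_imp_continuous_on)
next
  case (Suc k)
  have "Ck_on k S (\<lambda>x. frechet_derivative f (at x) v)" for v
    by (rule Suc.IH) (use Suc.prems in auto)
  then show ?case using Suc.prems by auto
qed

lemma Ck_on_has_derivative:
  assumes "open S" "Ck_on (Suc k) S f" "x \<in> S"
  shows "(f has_derivative frechet_derivative f (at x)) (at x)"
proof -
  have "f differentiable (at x)"
    using assms by (simp add: differentiable_on_eq_differentiable_at)
  then show ?thesis by (simp add: frechet_derivative_works)
qed

text \<open>Allows any explicit derivative \<open>D\<close>: derivatives at a point are unique, so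
  \<open>D x\<close> is the one chosen by \<open>frechet_derivative\<close>.\<close>

lemma Ck_on_SucI:
  assumes "open S" "\<And>x. x \<in> S \<Longrightarrow> (f has_derivative D x) (at x)" "\<And>v. Ck_on k S (\<lambda>x. D x v)"
  shows "Ck_on (Suc k) S f"
proof -
  have "frechet_derivative f (at x) = D x" if "x \<in> S" for x
    using frechet_derivative_at[OF assms(2)[OF that]] by simp
  then have "Ck_on k S (\<lambda>x. frechet_derivative f (at x) v)" for v
    by (intro Ck_on_cong[OF assms(1) _ assms(3)[of v]]) auto
  moreover have "f differentiable_on S"
    using assms(2) by (auto simp: differentiable_on_def intro: has_derivative_at_withinI differentiableI)
  ultimately show ?thesis by simp
qed

lemma Ck_on_const: "open S \<Longrightarrow> Ck_on k S (\<lambda>x. c)"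
proof (induction k arbitrary: c)
  case (Suc k)
  then show ?case by (intro Ck_on_SucI[where D="\<lambda>x v. 0"]) auto
qed simp

lemma Ck_on_add:
  assumes "open S" "Ck_on k S f" "Ck_on k S g"
  shows "Ck_on k S (\<lambda>x. f x + g x)"
  using assms(2,3)
proof (induction k arbitrary: f g)
  case 0
  then show ?case by (auto intro: continuous_on_add)
next
  case (Suc k)
  note d = Ck_on_has_derivative[OF assms(1) Suc.prems(1)] Ck_on_has_derivative[OF assms(1) Suc.prems(2)]
  show ?case
    by (rule Ck_on_SucI[OF assms(1) has_derivative_add[OF d]]) (use Suc in auto)
qed

lemma Ck_on_mult:
  fixes f g :: "_ \<Rightarrow> real"
  assumes "open S" "Ck_on k S f" "Ck_on k S g"
  shows "Ck_on k S (\<lambda>x. f x * g x)"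
  using assms(2,3)
proof (induction k arbitrary: f g)
  case 0
  then show ?case by (auto intro: continuous_on_mult)
next
  case (Suc k)
  note d = Ck_on_has_derivative[OF assms(1) Suc.prems(1)] Ck_on_has_derivative[OF assms(1) Suc.prems(2)]
  \<comment> \<open>The product rule pairs each function with the derivative of the other, so the
    functions themselves are needed in class \<open>k\<close>.\<close>
  have c: "Ck_on k S f" "Ck_on k S g" using Suc.prems by (auto dest: Ck_on_Suc_D simp del: Ck_on.simps)
  show ?case
    by (rule Ck_on_SucI[OF assms(1) has_derivative_mult[OF d]])
      (use Suc c in \<open>auto intro!: Ck_on_add[OF assms(1)]\<close>)
qed

lemma Ck_on_sum:
  assumes "open S" "\<And>i. i \<in> I \<Longrightarrow> Ck_on k S (f i)"
  shows "Ck_on k S (\<lambda>x. \<Sum>i\<in>I. f i x)"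
  using assms(2)
  by (induction I rule: infinite_finite_induct) (auto intro: Ck_on_const[OF assms(1)] Ck_on_add[OF assms(1)])

lemma Ck_on_bounded_linear:
  assumes "open S" "bounded_linear L" "Ck_on k S f"
  shows "Ck_on k S (\<lambda>x. L (f x))"
  using assms(3)
proof (induction k arbitrary: f)
  case 0
  then show ?case using assms(2) by (auto intro: bounded_linear.continuous_on)
next
  case (Suc k)
  note d = Ck_on_has_derivative[OF assms(1) Suc.prems(1)]
  show ?case
    by (rule Ck_on_SucI[OF assms(1) bounded_linear.has_derivative[OF assms(2) d]]) (use Suc in auto)
qed

lemma Ck_on_id: "open S \<Longrightarrow> Ck_on k S (\<lambda>x. x)"
proof (cases k)
  case (Suc m)
  assume S: "open S"
  show ?thesis unfolding Suc
    by (rule Ck_on_SucI[where D="\<lambda>x v. v"]) (simp_all add: Ck_on_const S)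
qed simp

lemma Ck_on_compose:
  fixes g :: "'e::euclidean_space \<Rightarrow> real" and h :: "'d::real_normed_vector \<Rightarrow> 'e"
  assumes "open S" "open T" "h ` T \<subseteq> S" "Ck_on k S g" "Ck_on k T h"
  shows "Ck_on k T (\<lambda>x. g (h x))"
  using assms(4,5)
proof (induction k arbitrary: g)
  case 0
  then show ?case using continuous_on_compose2[OF _ _ assms(3)] by simp
next
  case (Suc k)
  note dg = Ck_on_has_derivative[OF assms(1) Suc.prems(1)]
  note dh = Ck_on_has_derivative[OF assms(2) Suc.prems(2)]
  \<comment> \<open>\<open>Ck_on\<close> speaks of derivatives in fixed directions, but the chain
    rule differentiates \<open>g\<close> in a direction that moves with \<open>x\<close>. Expanding
    that direction in the basis separates the two dependences.\<close>
  let ?D = "\<lambda>x v. \<Sum>b\<in>Basis. (frechet_derivative h (at x) v \<bullet> b) * frechet_derivative g (at (h x)) b"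
  show ?case
  proof (rule Ck_on_SucI[OF assms(2), where D="?D"])
    fix x assume x: "x \<in> T"
    then have gx: "(g has_derivative frechet_derivative g (at (h x))) (at (h x))"
      using assms(3) by (intro dg) auto
    then have lin: "linear (frechet_derivative g (at (h x)))"
      by (simp add: has_derivative_linear)
    have "((\<lambda>x. g (h x)) has_derivative (\<lambda>v. frechet_derivative g (at (h x)) (frechet_derivative h (at x) v))) (at x)"
      using diff_chain_at[OF dh[OF x] gx] by (simp add: o_def)
    then show "((\<lambda>x. g (h x)) has_derivative ?D x) (at x)"
      by (simp only: linear_Basis_sum[OF lin, symmetric])
  next
    fix v
    have "Ck_on k T (\<lambda>x. frechet_derivative g (at (h x)) b)" for b
      using Suc.IH[of "\<lambda>y. frechet_derivative g (at y) b", OF _ Ck_on_Suc_D[OF Suc.prems(2)]] Suc.prems(1)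
      by simp
    moreover have "Ck_on k T (\<lambda>x. frechet_derivative h (at x) v \<bullet> b)" for b
      using Ck_on_bounded_linear[OF assms(2) bounded_linear_inner_left, of k "\<lambda>x. frechet_derivative h (at x) v" b]
        Suc.prems(2) by simp
    ultimately show "Ck_on k T (\<lambda>x. ?D x v)"
      by (simp add: Ck_on_sum[OF assms(2)] Ck_on_mult[OF assms(2)])
  qed
qed

section \<open>Smooth functions, ray integrals and Hadamard's lemma\<close>

lemma smooth_on_Ck: "smooth_on S f \<Longrightarrow> Ck_on k S f"
  by (simp add: smooth_on_def)

lemma smooth_on_subset: "smooth_on S f \<Longrightarrow> T \<subseteq> S \<Longrightarrow> smooth_on T f"
  by (simp add: smooth_on_def Ck_on_subset[of _ S f T])

lemma smooth_on_frechet_derivative: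
  "smooth_on S f \<Longrightarrow> smooth_on S (\<lambda>x. frechet_derivative f (at x) v)"
  unfolding smooth_on_def by (metis (no_types) Ck_on.simps(2))

lemma smooth_on_has_derivative:
  assumes "open S" "smooth_on S f" "x \<in> S"
  shows "(f has_derivative frechet_derivative f (at x)) (at x)"
  using Ck_on_has_derivative[OF assms(1) smooth_on_Ck[OF assms(2), of "Suc 0"] assms(3)] .

text \<open>Differentiation under the integral sign. The inner derivative of
  \<open>a + t *\<^sub>R (z - a)\<close> contributes a factor \<open>t\<close>, so the result is
  again a ray integral, with exponent \<open>Suc m\<close> and a derivative of \<open>f\<close>;
  arbitrary \<open>m\<close> is what makes the class closed.\<close>

lemma has_derivative_ray_integral:
  fixes f :: "'e::euclidean_space \<Rightarrow> real"
  assumes f: "smooth_on (ball a r) f" and z: "z \<in> ball a r"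
  shows "((\<lambda>z. integral {0..1} (\<lambda>t. t ^ m * f (a + t *\<^sub>R (z - a)))) has_derivative
    (\<lambda>v. integral {0..1} (\<lambda>t. t ^ Suc m * frechet_derivative f (at (a + t *\<^sub>R (z - a))) v))) (at z)"
proof -
  let ?B = "ball a r"
  have seg: "a + t *\<^sub>R (x - a) \<in> ?B" if "x \<in> ?B" "t \<in> {0..1}" for x t
  proof -
    have "norm (t *\<^sub>R (x - a)) \<le> norm (x - a)"
      using that(2) by (auto intro: mult_left_le_one_le)
    then show ?thesis using that(1) by (simp add: dist_norm norm_minus_commute)
  qed
  note D = smooth_on_has_derivative[OF open_ball f]
  have linD: "bounded_linear (frechet_derivative f (at x))" if "x \<in> ?B" for x
    using D[OF that] by (rule has_derivative_bounded_linear)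
  \<comment> \<open>\<open>leibniz_rule\<close> wants the derivative as a bounded linear operator
    that is jointly continuous in both variables; in finite dimension this continuity can be tested
    on each vector \<open>v\<close>.\<close>
  define fx where "fx x t = Blinfun (\<lambda>v. t ^ Suc m * frechet_derivative f (at (a + t *\<^sub>R (x - a))) v)" for x t
  have fx: "blinfun_apply (fx x t) = (\<lambda>v. t ^ Suc m * frechet_derivative f (at (a + t *\<^sub>R (x - a))) v)"
    if "x \<in> ?B" "t \<in> {0..1}" for x t
    unfolding fx_def using linD[OF seg[OF that]] bounded_linear_Blinfun_apply bounded_linear_const_mult by blast
  have contf: "continuous_on {0..1} (\<lambda>t. t ^ m * g (a + t *\<^sub>R (x - a)))"
    if "x \<in> ?B" "continuous_on ?B g" for x m and g :: "'e \<Rightarrow> real"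
    by (intro continuous_intros continuous_on_compose2[OF that(2)]) (use seg that in auto)
  have contD: "continuous_on ?B (\<lambda>x. frechet_derivative f (at x) v)" for v
    using smooth_on_Ck[OF smooth_on_frechet_derivative[OF f], of 0] by simp
  have cont_fx: "continuous_on (?B \<times> {0..1}) (\<lambda>(x, t). fx x t)"
  proof (rule continuous_on_blinfun_componentwise)
    fix v :: 'e
    have "continuous_on (?B \<times> {0..1}) (\<lambda>p. snd p ^ Suc m * frechet_derivative f (at (a + snd p *\<^sub>R (fst p - a))) v)"
      by (intro continuous_intros continuous_on_compose2[OF contD]) (use seg in auto)
    then show "continuous_on (?B \<times> {0..1}) (\<lambda>p. blinfun_apply (case p of (x, t) \<Rightarrow> fx x t) v)"
      by (rule continuous_on_eq) (auto simp: fx)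
  qed
  have deriv: "((\<lambda>z. integral (cbox 0 1) (\<lambda>t. t ^ m * f (a + t *\<^sub>R (z - a)))) has_derivative
      integral (cbox 0 1) (fx z)) (at z within ?B)"
  proof (rule leibniz_rule)
    fix x t assume xt: "x \<in> ?B" "t \<in> cbox 0 (1::real)"
    have "((\<lambda>x. t ^ m * f (a + t *\<^sub>R (x - a))) has_derivative
        (\<lambda>v. t ^ m * frechet_derivative f (at (a + t *\<^sub>R (x - a))) (t *\<^sub>R v))) (at x)"
      by (intro has_derivative_mult_right has_derivative_compose[where g=f and f="\<lambda>x. a + t *\<^sub>R (x - a)"] D seg)
        (use xt in \<open>auto intro!: derivative_eq_intros\<close>)
    moreover have "t ^ m * frechet_derivative f (at (a + t *\<^sub>R (x - a))) (t *\<^sub>R v)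
       = t ^ Suc m * frechet_derivative f (at (a + t *\<^sub>R (x - a))) v" for v
      using linear_cmul[OF bounded_linear.linear[OF linD[OF seg]], of x t t v] xt by simp
    ultimately show "((\<lambda>x. t ^ m * f (a + t *\<^sub>R (x - a))) has_derivative blinfun_apply (fx x t)) (at x within ?B)"
      using xt by (simp add: fx has_derivative_at_withinI)
  next
    fix x assume "x \<in> ?B"
    then show "(\<lambda>t. t ^ m * f (a + t *\<^sub>R (x - a))) integrable_on cbox 0 1"
      using contf[of x f m] smooth_on_Ck[OF f, of 0] by (simp add: integrable_continuous_interval)
  qed (use z cont_fx in auto)
  have *: "blinfun_apply (integral (cbox 0 1) (fx z)) v =
      integral {0..1} (\<lambda>t. t ^ Suc m * frechet_derivative f (at (a + t *\<^sub>R (z - a))) v)" for v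
  proof -
    have "continuous_on {0..1} (fx z)"
      using continuous_on_compose2[OF cont_fx continuous_on_Pair[of "{0..1}" "\<lambda>t. z" "\<lambda>t. t"]] z
      by (auto simp: image_subset_iff)
    then have "fx z integrable_on {0..1}" by (rule integrable_continuous_interval)
    from integral_linear[OF this blinfun.bounded_linear_left[of v]]
    have "blinfun_apply (integral (cbox 0 1) (fx z)) v = integral {0..1} (\<lambda>t. blinfun_apply (fx z t) v)"
      by (simp add: o_def)
    also have "\<dots> = integral {0..1} (\<lambda>t. t ^ Suc m * frechet_derivative f (at (a + t *\<^sub>R (z - a))) v)"
      by (rule integral_cong) (simp add: fx z del: mem_ball)
    finally show ?thesis .
  qed
  have "blinfun_apply (integral (cbox 0 1) (fx z)) =
      (\<lambda>v. integral {0..1} (\<lambda>t. t ^ Suc m * frechet_derivative f (at (a + t *\<^sub>R (z - a))) v))" by (rule ext) (rule *)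
  with deriv show ?thesis
    by (simp only: at_within_open[OF z open_ball] box_real)
qed

lemma smooth_on_ray_integral:
  fixes f :: "'e::euclidean_space \<Rightarrow> real"
  assumes "smooth_on (ball a r) f"
  shows "smooth_on (ball a r) (\<lambda>z. integral {0..1} (\<lambda>t. t ^ m * f (a + t *\<^sub>R (z - a))))"
proof -
  let ?I = "\<lambda>m f z. integral {0..1} (\<lambda>t. t ^ m * f (a + t *\<^sub>R (z - a)))"
  \<comment> \<open>The induction starts at class 1, since even continuity of a ray integral is read
    off from its differentiability. Both \<open>m\<close> and \<open>f\<close> change in the
    step.\<close>
  have "Ck_on (Suc k) (ball a r) (?I m f)" for k
    using assms
  proof (induction k arbitrary: f m)
    case 0
    have "continuous_on (ball a r) (?I (Suc m) (\<lambda>x. frechet_derivative f (at x) v))" for v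
      by (rule has_derivative_continuous_on,
          rule has_derivative_at_withinI[OF has_derivative_ray_integral[OF smooth_on_frechet_derivative[OF 0]]])
    then have *: "Ck_on 0 (ball a r) (?I (Suc m) (\<lambda>x. frechet_derivative f (at x) v))" for v
      unfolding Ck_on.simps .
    show ?case
      by (rule Ck_on_SucI[OF open_ball has_derivative_ray_integral[OF 0]], assumption, rule *)
  next
    case (Suc k)
    show ?case
      by (rule Ck_on_SucI[OF open_ball has_derivative_ray_integral[OF Suc.prems]],
          assumption, rule Suc.IH[OF smooth_on_frechet_derivative[OF Suc.prems]])
  qed
  from Ck_on_Suc_D[OF this] show ?thesis unfolding smooth_on_def by simp
qed

text \<open>\<open>g b z\<close> is the mean of the derivative in direction \<open>b\<close> over
  the segment from \<open>a\<close> to \<open>z\<close>, which stays in the ball; the expansion is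
  the fundamental theorem of calculus along that segment.\<close>

lemma Hadamard:
  fixes f :: "'e::euclidean_space \<Rightarrow> real"
  assumes f: "smooth_on (ball a r) f" and "r > 0"
  obtains g where "\<And>b. smooth_on (ball a r) (g b)" "\<And>b. g b a = frechet_derivative f (at a) b"
    "\<And>z. z \<in> ball a r \<Longrightarrow> f z = f a + (\<Sum>b\<in>Basis. ((z - a) \<bullet> b) * g b z)"
proof
  let ?g = "\<lambda>b z. integral {0..1} (\<lambda>t. t ^ 0 * frechet_derivative f (at (a + t *\<^sub>R (z - a))) b)"
  show "smooth_on (ball a r) (?g b)" for b
    by (rule smooth_on_ray_integral[OF smooth_on_frechet_derivative[OF f]])
  show "?g b a = frechet_derivative f (at a) b" for b
    by simp
  note D = smooth_on_has_derivative[OF open_ball f]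
  fix z assume z: "z \<in> ball a r"
  have seg: "a + t *\<^sub>R (z - a) \<in> ball a r" if "t \<in> {0..1}" for t
  proof -
    have "norm (t *\<^sub>R (z - a)) \<le> norm (z - a)"
      using that by (auto intro: mult_left_le_one_le)
    then show ?thesis using z by (simp add: dist_norm norm_minus_commute)
  qed
  have contD: "continuous_on {0..1} (\<lambda>t. frechet_derivative f (at (a + t *\<^sub>R (z - a))) v)" for v
  proof -
    have c: "continuous_on (ball a r) (\<lambda>x. frechet_derivative f (at x) v)"
      using smooth_on_Ck[OF smooth_on_frechet_derivative[OF f], of 0] by simp
    show ?thesis by (intro continuous_intros continuous_on_compose2[OF c]) (use seg in auto)
  qed
  have "((\<lambda>t. frechet_derivative f (at (a + t *\<^sub>R (z - a))) (z - a)) has_integral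
      f (a + 1 *\<^sub>R (z - a)) - f (a + 0 *\<^sub>R (z - a))) {0..1}"
  proof (rule fundamental_theorem_of_calculus)
    fix t :: real assume t: "t \<in> {0..1}"
    have "((\<lambda>t. f (a + t *\<^sub>R (z - a))) has_derivative
        (\<lambda>s. frechet_derivative f (at (a + t *\<^sub>R (z - a))) (s *\<^sub>R (z - a)))) (at t)"
      by (intro has_derivative_compose[where g=f and f="\<lambda>t. a + t *\<^sub>R (z - a)"] D seg t)
        (auto intro!: derivative_eq_intros)
    moreover have "linear (frechet_derivative f (at (a + t *\<^sub>R (z - a))))"
      using D[OF seg[OF t]] by (simp add: has_derivative_linear)
    ultimately show "((\<lambda>t. f (a + t *\<^sub>R (z - a))) has_vector_derivative
        frechet_derivative f (at (a + t *\<^sub>R (z - a))) (z - a)) (at t within {0..1})"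
      by (simp add: has_vector_derivative_def has_derivative_at_withinI linear_cmul)
  qed simp
  then have "f z - f a = integral {0..1} (\<lambda>t. frechet_derivative f (at (a + t *\<^sub>R (z - a))) (z - a))"
    by (simp add: integral_unique)
  also have "\<dots> = integral {0..1} (\<lambda>t. \<Sum>b\<in>Basis. ((z - a) \<bullet> b) * frechet_derivative f (at (a + t *\<^sub>R (z - a))) b)"
  proof (rule integral_cong)
    fix t :: real assume "t \<in> {0..1}"
    from linear_Basis_sum[OF has_derivative_linear[OF D[OF seg[OF this]]], of "z - a"]
    show "frechet_derivative f (at (a + t *\<^sub>R (z - a))) (z - a) =
      (\<Sum>b\<in>Basis. ((z - a) \<bullet> b) * frechet_derivative f (at (a + t *\<^sub>R (z - a))) b)" by simp
  qed
  also have "\<dots> = (\<Sum>b\<in>Basis. integral {0..1} (\<lambda>t. ((z - a) \<bullet> b) * frechet_derivative f (at (a + t *\<^sub>R (z - a))) b))"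
    by (rule integral_sum, simp, rule integrable_continuous_interval, rule continuous_on_mult_left, rule contD)
  also have "\<dots> = (\<Sum>b\<in>Basis. ((z - a) \<bullet> b) * ?g b z)"
    by simp
  finally show "f z = f a + (\<Sum>b\<in>Basis. ((z - a) \<bullet> b) * ?g b z)" by simp
qed

section \<open>Coordinates of tangent vectors and covectors\<close>

text \<open>The partial derivative in the direction of the \<open>i\<close>-th coordinate. The value
  0 on functions that are not smooth near \<open>y\<close> is the normalisation demanded by
  \<open>tangent_space\<close>.\<close>

definition coord_vector ::
    "('a::topological_space, 'n::finite) atlas \<Rightarrow> 'a set \<Rightarrow> ('a \<Rightarrow> real ^ 'n) \<Rightarrow> 'n \<Rightarrow> 'a \<Rightarrow> 'a tangent" where
  "coord_vector M U u i y f =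
     (if smooth_near M y f then frechet_derivative (f \<circ> inv_into U u) (at (u y)) (axis i 1) else 0)"

section \<open>Charts and smooth functions on a manifold\<close>

locale manifold =
  fixes M :: "('a::{t2_space,second_countable_topology}, 'n::finite) atlas"
  assumes smooth_manifold: "smooth_manifold M"
begin

lemma chart_at: obtains U u where "(U, u) \<in> M" "x \<in> U"
proof -
  have "x \<in> (\<Union>c\<in>M. fst c)" using smooth_manifold unfolding smooth_manifold_def by simp
  then show thesis using that by auto
qed

lemma chart: "(U, u) \<in> M \<Longrightarrow> is_chart (U, u)"
  using smooth_manifold unfolding smooth_manifold_def by blast

lemma chart_open: "(U, u) \<in> M \<Longrightarrow> open U"
  by (drule chart) (simp add: is_chart_def)

lemma chart_homeomorphism: "(U, u) \<in> M \<Longrightarrow> homeomorphism U (u ` U) u (inv_into U u)"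
  by (drule chart) (simp add: is_chart_def)

lemma chart_inv: "(U, u) \<in> M \<Longrightarrow> y \<in> U \<Longrightarrow> inv_into U u (u y) = y"
  using chart_homeomorphism unfolding homeomorphism_def by blast

lemma chart_image_open:
  assumes "(U, u) \<in> M" "open W" "W \<subseteq> U"
  shows "open (u ` W)"
proof -
  have "open (u ` U)"
    using chart[OF assms(1)] by (simp add: is_chart_def)
  moreover have "openin (top_of_set U) W"
    using assms chart_open by (simp add: openin_open_eq)
  ultimately show ?thesis
    using homeomorphism_imp_open_map[OF chart_homeomorphism[OF assms(1)]] openin_open_trans by blast
qed

lemma chart_compatible:
  assumes "(U, u) \<in> M" "(U', u') \<in> M"
  shows "smooth_on (u' ` (U' \<inter> U)) (u \<circ> inv_into U' u')"
proof -
  have "compatible (U', u') (U, u)"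
    using smooth_manifold assms unfolding smooth_manifold_def by blast
  then show ?thesis by (simp add: compatible_def)
qed

lemma smooth_funD: "smooth_fun M W f \<Longrightarrow> (U, u) \<in> M \<Longrightarrow> smooth_on (u ` (U \<inter> W)) (f \<circ> inv_into U u)"
  unfolding smooth_fun_def by auto

lemma smooth_fun_chartD:
  assumes "smooth_fun M W f" "(U, u) \<in> M" "W \<subseteq> U"
  shows "smooth_on (u ` W) (f \<circ> inv_into U u)"
  using smooth_funD[OF assms(1,2)] assms(3) by (simp add: Int_absorb1)

text \<open>A single chart around \<open>W\<close> suffices, because in any other chart the function
  is \<open>F\<close> composed with a smooth transition map.\<close>

lemma smooth_fun_chartI:
  fixes F :: "real ^ 'n \<Rightarrow> real"
  assumes c: "(U, u) \<in> M" and W: "open W" "W \<subseteq> U"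
    and F: "smooth_on (u ` W) F" "\<And>y. y \<in> W \<Longrightarrow> f y = F (u y)"
  shows "smooth_fun M W f"
  unfolding smooth_fun_def
proof (clarify)
  fix U' u' assume c': "(U', u') \<in> M"
  let ?T = "u' ` (U' \<inter> W)"
  have T: "open ?T" using chart_image_open[OF c', of "U' \<inter> W"] chart_open[OF c'] W(1) by (simp add: open_Int)
  have inv: "inv_into U' u' (u' y) = y" if "y \<in> U'" for y using chart_inv[OF c' that] .
  show "smooth_on ?T (f \<circ> inv_into U' u')"
    unfolding smooth_on_def
  proof
    fix k
    have "Ck_on k (u' ` (U' \<inter> U)) (u \<circ> inv_into U' u')"
      by (rule smooth_on_Ck[OF chart_compatible[OF c c']])
    then have "Ck_on k ?T (u \<circ> inv_into U' u')"
      by (rule Ck_on_subset) (use W in auto)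
    then have "Ck_on k ?T (\<lambda>z. F ((u \<circ> inv_into U' u') z))"
      by (rule Ck_on_compose[OF chart_image_open[OF c W] T _ smooth_on_Ck[OF F(1)], rotated]) (auto simp: inv)
    then show "Ck_on k ?T (f \<circ> inv_into U' u')"
      by (rule Ck_on_cong[OF T, rotated]) (auto simp: inv F(2))
  qed
qed

lemma smooth_fun_subset: "smooth_fun M W f \<Longrightarrow> W' \<subseteq> W \<Longrightarrow> smooth_fun M W' f"
  unfolding smooth_fun_def smooth_on_def by (fast elim: Ck_on_subset)

lemma smooth_funI:
  assumes "\<And>U u k. (U, u) \<in> M \<Longrightarrow> open (u ` (U \<inter> W)) \<Longrightarrow> Ck_on k (u ` (U \<inter> W)) (\<lambda>z. f (inv_into U u z))"
    and "open W"
  shows "smooth_fun M W f"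
proof -
  have "open (u ` (U \<inter> W))" if "(U, u) \<in> M" for U u
    using chart_image_open[OF that, of "U \<inter> W"] chart_open[OF that] assms(2) by (simp add: open_Int)
  then show ?thesis using assms(1) unfolding smooth_fun_def smooth_on_def o_def by auto
qed

lemma smooth_fun_Ck: "smooth_fun M W f \<Longrightarrow> (U, u) \<in> M \<Longrightarrow> Ck_on k (u ` (U \<inter> W)) (\<lambda>z. f (inv_into U u z))"
  using smooth_funD unfolding smooth_on_def o_def by blast

lemma smooth_fun_const: "open W \<Longrightarrow> smooth_fun M W (\<lambda>y. c)"
  by (rule smooth_funI) (rule Ck_on_const)

lemma smooth_fun_add:
  "open W \<Longrightarrow> smooth_fun M W f \<Longrightarrow> smooth_fun M W g \<Longrightarrow> smooth_fun M W (\<lambda>y. f y + g y)"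
  by (rule smooth_funI) (simp_all add: Ck_on_add smooth_fun_Ck)

lemma smooth_fun_mult:
  "open W \<Longrightarrow> smooth_fun M W f \<Longrightarrow> smooth_fun M W g \<Longrightarrow> smooth_fun M W (\<lambda>y. f y * g y)"
  by (rule smooth_funI) (simp_all add: Ck_on_mult smooth_fun_Ck)

lemma smooth_fun_sum:
  assumes "open W" "\<And>i. i \<in> I \<Longrightarrow> smooth_fun M W (f i)"
  shows "smooth_fun M W (\<lambda>y. \<Sum>i\<in>I. f i y)"
  using assms(2)
  by (induction I rule: infinite_finite_induct) (simp_all add: smooth_fun_const smooth_fun_add assms(1))

lemma smooth_fun_cong:
  assumes "open W" "smooth_fun M W f" "\<And>y. y \<in> W \<Longrightarrow> f y = g y"
  shows "smooth_fun M W g"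
proof (rule smooth_funI)
  fix U u k assume *: "(U, u) \<in> M" "open (u ` (U \<inter> W))"
  show "Ck_on k (u ` (U \<inter> W)) (\<lambda>z. g (inv_into U u z))"
    by (rule Ck_on_cong[OF *(2) _ smooth_fun_Ck[OF assms(2) *(1)]]) (auto simp: chart_inv[OF *(1)] assms(3))
qed (rule assms(1))

lemma smooth_fun_coord:
  assumes "(U, u) \<in> M"
  shows "smooth_fun M U (\<lambda>z. u z $ i)"
proof (rule smooth_fun_chartI[OF assms chart_open[OF assms] order_refl])
  have o: "open (u ` U)" using chart_image_open[OF assms chart_open[OF assms]] by simp
  show "smooth_on (u ` U) (\<lambda>z. z $ i)"
    using Ck_on_bounded_linear[OF o bounded_linear_vec_nth Ck_on_id[OF o]] unfolding smooth_on_def by simp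
qed simp

lemma smooth_nearI: "open W \<Longrightarrow> x \<in> W \<Longrightarrow> smooth_fun M W f \<Longrightarrow> smooth_near M x f"
  unfolding smooth_near_def by blast

lemma smooth_nearE:
  assumes "smooth_near M x f" "open U" "x \<in> U"
  obtains W where "open W" "x \<in> W" "W \<subseteq> U" "smooth_fun M W f"
proof -
  obtain W where "open W" "x \<in> W" "smooth_fun M W f" using assms(1) unfolding smooth_near_def by blast
  then show thesis using that[of "W \<inter> U"] assms smooth_fun_subset[of W f "W \<inter> U"] by auto
qed

lemma smooth_nearE2:
  assumes "smooth_near M x f" "smooth_near M x g" "open U" "x \<in> U"
  obtains W where "open W" "x \<in> W" "W \<subseteq> U" "smooth_fun M W f" "smooth_fun M W g"
proof -
  obtain W where W: "open W" "x \<in> W" "W \<subseteq> U" "smooth_fun M W f" by (rule smooth_nearE[OF assms(1,3,4)])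
  obtain W' where "open W'" "x \<in> W'" "W' \<subseteq> W" "smooth_fun M W' g" by (rule smooth_nearE[OF assms(2) W(1,2)])
  then show thesis using that[of W'] W smooth_fun_subset[of W f W'] by auto
qed

lemma smooth_near_const: "smooth_near M x (\<lambda>y. c)"
  by (rule smooth_nearI[OF open_UNIV UNIV_I smooth_fun_const[OF open_UNIV]])

lemma smooth_near_add:
  assumes "smooth_near M x f" "smooth_near M x g" shows "smooth_near M x (\<lambda>y. f y + g y)"
proof -
  obtain W where W: "open W" "x \<in> W" "smooth_fun M W f" "smooth_fun M W g"
    by (rule smooth_nearE2[OF assms open_UNIV UNIV_I])
  show ?thesis by (rule smooth_nearI[OF W(1,2) smooth_fun_add[OF W(1,3,4)]])
qed

lemma smooth_near_mult:
  assumes "smooth_near M x f" "smooth_near M x g" shows "smooth_near M x (\<lambda>y. f y * g y)"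
proof -
  obtain W where W: "open W" "x \<in> W" "smooth_fun M W f" "smooth_fun M W g"
    by (rule smooth_nearE2[OF assms open_UNIV UNIV_I])
  show ?thesis by (rule smooth_nearI[OF W(1,2) smooth_fun_mult[OF W(1,3,4)]])
qed

lemma smooth_near_sum:
  assumes "\<And>i. i \<in> I \<Longrightarrow> smooth_near M x (f i)" shows "smooth_near M x (\<lambda>y. \<Sum>i\<in>I. f i y)"
  using assms
  by (induction I rule: infinite_finite_induct) (simp_all add: smooth_near_const smooth_near_add)

lemma smooth_near_cong:
  assumes "smooth_near M x f" "\<forall>\<^sub>F y in nhds x. f y = g y"
  shows "smooth_near M x g"
proof -
  obtain S where S: "open S" "x \<in> S" "\<And>y. y \<in> S \<Longrightarrow> f y = g y"
    using assms(2) unfolding eventually_nhds by blast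
  obtain W where W: "open W" "x \<in> W" "W \<subseteq> S" "smooth_fun M W f" by (rule smooth_nearE[OF assms(1) S(1,2)])
  have "smooth_fun M W g" by (rule smooth_fun_cong[OF W(1,4)]) (use W S in auto)
  then show ?thesis using W smooth_nearI by blast
qed

lemma smooth_near_coord: "(U, u) \<in> M \<Longrightarrow> x \<in> U \<Longrightarrow> smooth_near M x (\<lambda>z. u z $ i)"
  using smooth_fun_coord chart_open smooth_nearI by blast

lemma smooth_fun_coord_sum: "(U, u) \<in> M \<Longrightarrow> smooth_fun M U (\<lambda>z. \<Sum>i\<in>UNIV. c i * u z $ i)"
  by (simp add: smooth_fun_sum smooth_fun_mult[OF _ smooth_fun_const smooth_fun_coord] chart_open)

section \<open>Derivations of germs\<close>

lemma tangent_add: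
  "D \<in> tangent_space M x \<Longrightarrow> smooth_near M x f \<Longrightarrow> smooth_near M x g \<Longrightarrow> D (\<lambda>y. f y + g y) = D f + D g"
  unfolding tangent_space_def by blast

lemma tangent_mult:
  "D \<in> tangent_space M x \<Longrightarrow> smooth_near M x f \<Longrightarrow> smooth_near M x g \<Longrightarrow>
    D (\<lambda>y. f y * g y) = f x * D g + g x * D f"
  unfolding tangent_space_def by blast

lemma tangent_cmult:
  "D \<in> tangent_space M x \<Longrightarrow> smooth_near M x f \<Longrightarrow> D (\<lambda>y. c * f y) = c * D f"
  unfolding tangent_space_def by blast

lemma tangent_eventually:
  "D \<in> tangent_space M x \<Longrightarrow> \<forall>\<^sub>F y in nhds x. f y = g y \<Longrightarrow> D f = D g"
  unfolding tangent_space_def by blast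

lemma tangent_local:
  assumes "D \<in> tangent_space M x" "open W" "x \<in> W" "\<And>y. y \<in> W \<Longrightarrow> f y = g y"
  shows "D f = D g"
proof (rule tangent_eventually[OF assms(1)])
  show "\<forall>\<^sub>F y in nhds x. f y = g y"
    unfolding eventually_nhds using assms(2-4) by blast
qed

lemma tangent_not_smooth: "D \<in> tangent_space M x \<Longrightarrow> \<not> smooth_near M x f \<Longrightarrow> D f = 0"
  unfolding tangent_space_def by blast

lemma tangent_const: assumes "D \<in> tangent_space M x" shows "D (\<lambda>y. c) = 0"
proof -
  have "D (\<lambda>y. 1) = 0"
    using tangent_mult[OF assms smooth_near_const[of x 1] smooth_near_const[of x 1]] by simp
  then show ?thesis using tangent_cmult[OF assms smooth_near_const[of x 1], of c] by simp
qed

lemma tangent_sum: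
  assumes "D \<in> tangent_space M x" "\<And>i. i \<in> I \<Longrightarrow> smooth_near M x (f i)"
  shows "D (\<lambda>y. \<Sum>i\<in>I. f i y) = (\<Sum>i\<in>I. D (f i))"
  using assms(2)
  by (induction I rule: infinite_finite_induct)
    (simp_all add: tangent_const[OF assms(1)] tangent_add[OF assms(1)] smooth_near_sum)

lemma tangent_coord_sum:
  assumes "D \<in> tangent_space M x" "(U, u) \<in> M" "x \<in> U"
  shows "D (\<lambda>z. \<Sum>i\<in>UNIV. c i * u z $ i) = (\<Sum>i\<in>UNIV. c i * D (\<lambda>z. u z $ i))"
  using tangent_sum[OF assms(1), of UNIV "\<lambda>i z. c i * u z $ i"]
  by (simp add: tangent_cmult[OF assms(1)] smooth_near_mult smooth_near_const smooth_near_coord[OF assms(2,3)])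

text \<open>Dependence on the germ has to be checked for smooth functions only: smoothness near
  \<open>x\<close> is itself a property of the germ, and all other functions are sent to 0.\<close>

lemma tangent_spaceI:
  assumes "\<And>f g. smooth_near M x f \<Longrightarrow> smooth_near M x g \<Longrightarrow> D (\<lambda>y. f y + g y) = D f + D g"
    "\<And>f g. smooth_near M x f \<Longrightarrow> smooth_near M x g \<Longrightarrow> D (\<lambda>y. f y * g y) = f x * D g + g x * D f"
    "\<And>c f. smooth_near M x f \<Longrightarrow> D (\<lambda>y. c * f y) = c * D f"
    "\<And>f g. smooth_near M x f \<Longrightarrow> smooth_near M x g \<Longrightarrow> \<forall>\<^sub>F y in nhds x. f y = g y \<Longrightarrow> D f = D g"
    "\<And>f. \<not> smooth_near M x f \<Longrightarrow> D f = 0"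
  shows "D \<in> tangent_space M x"
proof -
  have "D f = D g" if "\<forall>\<^sub>F y in nhds x. f y = g y" for f g
  proof (cases "smooth_near M x f")
    case True
    then show ?thesis using smooth_near_cong[OF _ that] that assms(4) by blast
  next
    case False
    have "\<forall>\<^sub>F y in nhds x. g y = f y" using that by (simp add: eq_commute)
    then have "\<not> smooth_near M x g" using smooth_near_cong False by blast
    then show ?thesis using False assms(5) by simp
  qed
  then show ?thesis unfolding tangent_space_def using assms(1,2,3,5) by simp
qed

lemma tangent_space_add:
  assumes "v \<in> tangent_space M x" "v' \<in> tangent_space M x"
  shows "(\<lambda>f. v f + v' f) \<in> tangent_space M x"
proof (rule tangent_spaceI)
  fix f g :: "'a \<Rightarrow> real" assume "\<forall>\<^sub>F y in nhds x. f y = g y"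
  then show "v f + v' f = v g + v' g"
    using tangent_eventually[OF assms(1), of f g] tangent_eventually[OF assms(2), of f g] by simp
qed (simp_all add: tangent_add[OF assms(1)] tangent_add[OF assms(2)] tangent_mult[OF assms(1)]
      tangent_mult[OF assms(2)] tangent_cmult[OF assms(1)] tangent_cmult[OF assms(2)]
      tangent_not_smooth[OF assms(1)] tangent_not_smooth[OF assms(2)] distrib_left)

lemma tangent_space_scale:
  assumes "v \<in> tangent_space M x"
  shows "(\<lambda>f. c * v f) \<in> tangent_space M x"
proof (rule tangent_spaceI)
  fix f g :: "'a \<Rightarrow> real" assume "\<forall>\<^sub>F y in nhds x. f y = g y"
  then show "c * v f = c * v g"
    using tangent_eventually[OF assms, of f g] by simp
qed (simp_all add: tangent_add[OF assms] tangent_mult[OF assms] tangent_cmult[OF assms]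
      tangent_not_smooth[OF assms] distrib_left)

lemma tangent_space_zero: "(\<lambda>f. 0) \<in> tangent_space M x"
  by (rule tangent_spaceI) simp_all

lemma tangent_space_sum:
  assumes "\<And>i. i \<in> I \<Longrightarrow> v i \<in> tangent_space M x"
  shows "(\<lambda>f. \<Sum>i\<in>I. v i f) \<in> tangent_space M x"
  using assms
  by (induction I rule: infinite_finite_induct) (simp_all add: tangent_space_zero tangent_space_add)

section \<open>Coordinate vector fields\<close>

lemma chart_has_derivative:
  assumes c: "(U, u) \<in> M" and y: "y \<in> U" and f: "smooth_near M y f"
  shows "(f \<circ> inv_into U u has_derivative frechet_derivative (f \<circ> inv_into U u) (at (u y))) (at (u y))"
proof -
  obtain W where W: "open W" "y \<in> W" "W \<subseteq> U" "smooth_fun M W f"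
    by (rule smooth_nearE[OF f chart_open[OF c] y])
  show ?thesis
    by (rule smooth_on_has_derivative[OF chart_image_open[OF c W(1,3)] smooth_fun_chartD[OF W(4) c W(3)]])
      (use W in auto)
qed

lemma coord_vector_eq:
  assumes "(U, u) \<in> M" "y \<in> U" "smooth_near M y f" "(f \<circ> inv_into U u has_derivative D) (at (u y))"
  shows "coord_vector M U u i y f = D (axis i 1)"
  using frechet_derivative_at[OF assms(4)] assms(3) by (simp add: coord_vector_def)

lemma coord_vector_tangent:
  assumes c: "(U, u) \<in> M" and y: "y \<in> U"
  shows "coord_vector M U u i y \<in> tangent_space M y"
proof (rule tangent_spaceI)
  note d = chart_has_derivative[OF c y]
  note inv = chart_inv[OF c y]
  fix f g assume f: "smooth_near M y f" and g: "smooth_near M y g"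
  show "coord_vector M U u i y (\<lambda>z. f z + g z) = coord_vector M U u i y f + coord_vector M U u i y g"
    using coord_vector_eq[OF c y smooth_near_add[OF f g], unfolded o_def, OF has_derivative_add[OF d[OF f, unfolded o_def] d[OF g, unfolded o_def]]]
    by (simp add: coord_vector_def f g o_def)
  show "coord_vector M U u i y (\<lambda>z. f z * g z) = f y * coord_vector M U u i y g + g y * coord_vector M U u i y f"
    using coord_vector_eq[OF c y smooth_near_mult[OF f g], unfolded o_def, OF has_derivative_mult[OF d[OF f, unfolded o_def] d[OF g, unfolded o_def]]]
    by (simp add: coord_vector_def f g o_def inv)
next
  note d = chart_has_derivative[OF c y]
  fix a f assume f: "smooth_near M y f"
  show "coord_vector M U u i y (\<lambda>z. a * f z) = a * coord_vector M U u i y f"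
    using coord_vector_eq[OF c y smooth_near_mult[OF smooth_near_const f], unfolded o_def, OF has_derivative_mult_right[OF d[OF f, unfolded o_def]]]
    by (simp add: coord_vector_def f o_def)
next
  fix f g assume f: "smooth_near M y f" and g: "smooth_near M y g" and e: "\<forall>\<^sub>F z in nhds y. f z = g z"
  obtain S where S: "open S" "y \<in> S" "\<And>z. z \<in> S \<Longrightarrow> f z = g z"
    using e unfolding eventually_nhds by blast
  have "frechet_derivative (f \<circ> inv_into U u) (at (u y)) = frechet_derivative (g \<circ> inv_into U u) (at (u y))"
    by (rule frechet_derivative_cong_open[of "u ` (S \<inter> U)"])
      (use chart_image_open[OF c, of "S \<inter> U"] chart_open[OF c] S y chart_inv[OF c] in auto)
  then show "coord_vector M U u i y f = coord_vector M U u i y g"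
    by (simp add: coord_vector_def f g)
qed (simp add: coord_vector_def)

lemma vector_field_tangent: "vector_field M U X \<Longrightarrow> y \<in> U \<Longrightarrow> X y \<in> tangent_space M y"
  unfolding vector_field_def by blast

lemma vector_field_smooth:
  "vector_field M U X \<Longrightarrow> open W \<Longrightarrow> W \<subseteq> U \<Longrightarrow> smooth_fun M W f \<Longrightarrow> smooth_fun M W (\<lambda>y. X y f)"
  unfolding vector_field_def by blast

lemma vector_field_smooth_near:
  assumes "vector_field M U X" "open U" "x \<in> U" "smooth_near M x f"
  shows "smooth_near M x (\<lambda>y. X y f)"
proof -
  obtain W where W: "open W" "x \<in> W" "W \<subseteq> U" "smooth_fun M W f"
    by (rule smooth_nearE[OF assms(4,2,3)])
  show ?thesis by (rule smooth_nearI[OF W(1,2) vector_field_smooth[OF assms(1) W(1,3,4)]])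
qed

lemma vector_fieldI:
  assumes "\<And>y. y \<in> U \<Longrightarrow> X y \<in> tangent_space M y"
    "\<And>W f. open W \<Longrightarrow> W \<subseteq> U \<Longrightarrow> smooth_fun M W f \<Longrightarrow> smooth_fun M W (\<lambda>y. X y f)"
  shows "vector_field M U X"
  unfolding vector_field_def using assms by blast

lemma vector_field_subset:
  assumes "vector_field M U X" "U' \<subseteq> U"
  shows "vector_field M U' X"
  by (rule vector_fieldI)
    (simp_all add: vector_field_tangent[OF assms(1)] vector_field_smooth[OF assms(1)] subsetD[OF assms(2)]
      order_trans[OF _ assms(2)])

lemma coord_vector_field:
  assumes c: "(U, u) \<in> M"
  shows "vector_field M U (coord_vector M U u i)"
proof (rule vector_fieldI)
  fix W f assume W: "open W" "W \<subseteq> U" and f: "smooth_fun M W f"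
  show "smooth_fun M W (\<lambda>y. coord_vector M U u i y f)"
    by (rule smooth_fun_chartI[OF c W smooth_on_frechet_derivative[OF smooth_fun_chartD[OF f c W(2)]]])
      (simp add: coord_vector_def smooth_nearI[OF W(1) _ f])
qed (rule coord_vector_tangent[OF c])

lemma vector_field_scale:
  assumes "vector_field M U X"
  shows "vector_field M U (\<lambda>y f. a * X y f)"
proof (rule vector_fieldI)
  show "(\<lambda>f. a * X y f) \<in> tangent_space M y" if "y \<in> U" for y
    by (rule tangent_space_scale[OF vector_field_tangent[OF assms that]])
  show "smooth_fun M W (\<lambda>y. a * X y f)" if "open W" "W \<subseteq> U" "smooth_fun M W f" for W f
    by (rule smooth_fun_mult[OF that(1) smooth_fun_const[OF that(1)] vector_field_smooth[OF assms that]])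
qed

lemma vector_field_sum:
  assumes "\<And>i. i \<in> I \<Longrightarrow> vector_field M U (X i)"
  shows "vector_field M U (\<lambda>y f. \<Sum>i\<in>I. X i y f)"
proof (rule vector_fieldI)
  show "(\<lambda>f. \<Sum>i\<in>I. X i y f) \<in> tangent_space M y" if "y \<in> U" for y
    by (rule tangent_space_sum[OF vector_field_tangent[OF assms that]])
  show "smooth_fun M W (\<lambda>y. \<Sum>i\<in>I. X i y f)" if "open W" "W \<subseteq> U" "smooth_fun M W f" for W f
    by (rule smooth_fun_sum[OF that(1) vector_field_smooth[OF assms that]])
qed

lemma coord_vector_coord:
  assumes c: "(U, u) \<in> M" and y: "y \<in> U"
  shows "coord_vector M U u i y (\<lambda>z. u z $ j) = (if i = j then 1 else 0)"
proof -
  have o: "open (u ` U)" using chart_image_open[OF c chart_open[OF c]] by simp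
  have "((\<lambda>z. z $ j) has_derivative (\<lambda>v. v $ j)) (at (u y))"
    by (rule bounded_linear_imp_has_derivative[OF bounded_linear_vec_nth])
  then have "((\<lambda>z. u z $ j) \<circ> inv_into U u has_derivative (\<lambda>v. v $ j)) (at (u y))"
    by (rule has_derivative_transform_within_open[OF _ o]) (auto simp: y chart_inv[OF c])
  from coord_vector_eq[OF c y smooth_near_coord[OF c y] this] show ?thesis
    by (simp add: axis_def)
qed

text \<open>Hadamard's lemma writes a germ at \<open>y\<close> as \<open>f y + \<Sum>\<^sub>i (u\<^sup>i - u\<^sup>i y) g\<^sub>i\<close>; a derivation kills the
  constant and evaluates \<open>g\<^sub>i\<close> at \<open>y\<close>.\<close>
lemma tangent_expansion:
  assumes c: "(U, u) \<in> M" and y: "y \<in> U" and D: "D \<in> tangent_space M y"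
  shows "D f = (\<Sum>i\<in>UNIV. D (\<lambda>z. u z $ i) * coord_vector M U u i y f)"
proof (cases "smooth_near M y f")
  case False
  then show ?thesis using tangent_not_smooth[OF D False] by (simp add: coord_vector_def)
next
  case True
  obtain W where W: "open W" "y \<in> W" "W \<subseteq> U" "smooth_fun M W f"
    by (rule smooth_nearE[OF True chart_open[OF c] y])
  have "open (u ` W)" by (rule chart_image_open[OF c W(1,3)])
  then obtain r where r: "r > 0" "ball (u y) r \<subseteq> u ` W"
    using W(2) open_contains_ball by (metis imageI)
  let ?B = "ball (u y) r" and ?F = "f \<circ> inv_into U u"
  \<comment> \<open>Hadamard's lemma lives on a ball in coordinates, so the neighbourhood is shrunk
    to the preimage of one.\<close>
  define W' where "W' = U \<inter> u -` ?B"
  have "continuous_on U u" using chart_homeomorphism[OF c] unfolding homeomorphism_def by blast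
  then have oW': "open W'" unfolding W'_def by (intro continuous_open_preimage chart_open[OF c] open_ball)
  have W'_sub: "W' \<subseteq> W"
  proof
    fix z assume "z \<in> W'"
    then have "z \<in> U" "u z \<in> u ` W" using r(2) unfolding W'_def by auto
    then show "z \<in> W" using chart_inv[OF c] W(3) by (metis imageE subsetD)
  qed
  have yW': "y \<in> W'" using y r(1) unfolding W'_def by simp
  have uW': "u ` W' \<subseteq> ?B" unfolding W'_def by auto
  have W'_U: "W' \<subseteq> U" unfolding W'_def by auto
  have smF: "smooth_on ?B ?F"
    by (rule smooth_on_subset[OF smooth_fun_chartD[OF W(4) c W(3)] r(2)])
  obtain g where g: "\<And>b. smooth_on ?B (g b)" "\<And>b. g b (u y) = frechet_derivative ?F (at (u y)) b"
    "\<And>z. z \<in> ?B \<Longrightarrow> ?F z = ?F (u y) + (\<Sum>b\<in>Basis. ((z - u y) \<bullet> b) * g b z)"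
    by (rule Hadamard[OF smF r(1)]) (rule that)
  define G where "G i z = g (axis i 1) (u z)" for i z
  have G: "smooth_near M y (G i)" for i
  proof (rule smooth_nearI[OF oW' yW'], rule smooth_fun_chartI[OF c oW' W'_U])
    show "smooth_on (u ` W') (g (axis i 1))"
      by (rule smooth_on_subset[OF g(1) uW'])
  qed (simp add: G_def)
  have Gy: "G i y = coord_vector M U u i y f" for i
    by (simp add: G_def g(2) coord_vector_def True)
  \<comment> \<open>The difference of coordinates is written as a sum with a constant, the shape to
    which \<open>tangent_add\<close> applies.\<close>
  have f: "f z = f y + (\<Sum>i\<in>UNIV. (u z $ i + - (u y $ i)) * G i z)" if "z \<in> W'" for z
  proof -
    have "f z = f y + (\<Sum>b\<in>Basis. ((u z - u y) \<bullet> b) * g b (u z))"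
      using g(3)[of "u z"] that uW' by (auto simp: chart_inv[OF c y] chart_inv[OF c subsetD[OF W'_U]])
    also have "(Basis :: (real ^ 'n) set) = (\<lambda>i. axis i 1) ` UNIV"
      by (auto simp: Basis_vec_def)
    also have "(\<Sum>b\<in>(\<lambda>i. axis i 1) ` UNIV. ((u z - u y) \<bullet> b) * g b (u z)) =
        (\<Sum>i\<in>UNIV. ((u z - u y) \<bullet> axis i 1) * g (axis i 1) (u z))"
      by (subst sum.reindex) (auto simp: inj_on_def axis_eq_axis)
    finally show ?thesis by (simp add: inner_axis G_def)
  qed
  have sm: "smooth_near M y (\<lambda>z. u z $ i + - (u y $ i))" for i
    by (intro smooth_near_add smooth_near_coord[OF c y] smooth_near_const)
  have "D f = D (\<lambda>z. f y + (\<Sum>i\<in>UNIV. (u z $ i + - (u y $ i)) * G i z))"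
    by (rule tangent_local[OF D oW' yW' f])
  also have "\<dots> = (\<Sum>i\<in>UNIV. D (\<lambda>z. (u z $ i + - (u y $ i)) * G i z))"
    by (subst tangent_add[OF D smooth_near_const smooth_near_sum[OF smooth_near_mult[OF sm G]]],
        subst tangent_sum[OF D smooth_near_mult[OF sm G]]) (simp add: tangent_const[OF D])
  also have "\<dots> = (\<Sum>i\<in>UNIV. D (\<lambda>z. u z $ i) * coord_vector M U u i y f)"
    by (rule sum.cong[OF refl], subst tangent_mult[OF D sm G],
        subst tangent_add[OF D smooth_near_coord[OF c y] smooth_near_const])
      (simp add: tangent_const[OF D] Gy)
  finally show ?thesis .
qed

section \<open>Covectors, differentials and Lie brackets\<close>

lemma differential_apply: "v \<in> tangent_space M x \<Longrightarrow> differential M x f v = v f"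
  by (simp add: differential_def)

lemma differential_cotangent: "differential M x f \<in> cotangent_space M x"
  unfolding cotangent_space_def differential_def
  by (auto simp: tangent_space_add tangent_space_scale)

lemma cotangent_add:
  "w \<in> cotangent_space M x \<Longrightarrow> v \<in> tangent_space M x \<Longrightarrow> v' \<in> tangent_space M x \<Longrightarrow>
    w (\<lambda>f. v f + v' f) = w v + w v'"
  unfolding cotangent_space_def by blast

lemma cotangent_scale:
  "w \<in> cotangent_space M x \<Longrightarrow> v \<in> tangent_space M x \<Longrightarrow> w (\<lambda>f. c * v f) = c * w v"
  unfolding cotangent_space_def by blast

lemma cotangent_outside: "w \<in> cotangent_space M x \<Longrightarrow> v \<notin> tangent_space M x \<Longrightarrow> w v = 0"
  unfolding cotangent_space_def by blast

lemma cotangent_sum: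
  assumes "w \<in> cotangent_space M x" "\<And>i. i \<in> I \<Longrightarrow> v i \<in> tangent_space M x"
  shows "w (\<lambda>f. \<Sum>i\<in>I. v i f) = (\<Sum>i\<in>I. w (v i))"
proof -
  have "w (\<lambda>f. 0) = 0" using cotangent_scale[OF assms(1) tangent_space_zero, of 0] by simp
  then show ?thesis using assms(2)
    by (induction I rule: infinite_finite_induct)
      (simp_all add: cotangent_add[OF assms(1)] tangent_space_sum)
qed

text \<open>With the components of \<open>w\<close> frozen at \<open>y\<close>, the covector becomes
  the differential of one function that is defined on the whole chart. This is how covectors at a
  point are traded for functions linear in the coordinates.\<close>

lemma cotangent_expansion:
  assumes c: "(U, u) \<in> M" and y: "y \<in> U" and w: "w \<in> cotangent_space M y"
  shows "w = differential M y (\<lambda>z. \<Sum>i\<in>UNIV. w (coord_vector M U u i y) * u z $ i)"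
proof
  fix v
  note cv = coord_vector_tangent[OF c y]
  show "w v = differential M y (\<lambda>z. \<Sum>i\<in>UNIV. w (coord_vector M U u i y) * u z $ i) v"
  proof (cases "v \<in> tangent_space M y")
    case True
    have "v = (\<lambda>f. \<Sum>i\<in>UNIV. v (\<lambda>z. u z $ i) * coord_vector M U u i y f)"
      by (rule ext) (rule tangent_expansion[OF c y True])
    then have "w v = w (\<lambda>f. \<Sum>i\<in>UNIV. v (\<lambda>z. u z $ i) * coord_vector M U u i y f)"
      by (rule arg_cong)
    also have "\<dots> = (\<Sum>i\<in>UNIV. v (\<lambda>z. u z $ i) * w (coord_vector M U u i y))"
      by (simp add: cotangent_sum[OF w] tangent_space_scale cv cotangent_scale[OF w])
    also have "\<dots> = differential M y (\<lambda>z. \<Sum>i\<in>UNIV. w (coord_vector M U u i y) * u z $ i) v"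
      unfolding differential_apply[OF True] tangent_coord_sum[OF True c y] by (simp add: mult.commute)
    finally show ?thesis .
  qed (simp add: differential_def cotangent_outside[OF w])
qed

lemma cotangent_space_add:
  assumes "w \<in> cotangent_space M x" "w' \<in> cotangent_space M x"
  shows "(\<lambda>v. w v + w' v) \<in> cotangent_space M x"
  unfolding cotangent_space_def
  by (simp add: cotangent_add[OF assms(1)] cotangent_add[OF assms(2)] cotangent_scale[OF assms(1)]
      cotangent_scale[OF assms(2)] cotangent_outside[OF assms(1)] cotangent_outside[OF assms(2)] distrib_left)

lemma cotangent_space_scale:
  assumes "w \<in> cotangent_space M x"
  shows "(\<lambda>v. c * w v) \<in> cotangent_space M x"
  unfolding cotangent_space_def
  by (simp add: cotangent_add[OF assms] cotangent_scale[OF assms] cotangent_outside[OF assms] distrib_left)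

text \<open>The components of \<open>v\<close> in the coordinate basis are kept constant over the
  chart.\<close>

lemma tangent_extension:
  assumes c: "(U, u) \<in> M" and y: "y \<in> U" and v: "v \<in> tangent_space M y"
  obtains X where "vector_field M U X" "X y = v"
proof
  let ?X = "\<lambda>z f. \<Sum>i\<in>UNIV. v (\<lambda>z. u z $ i) * coord_vector M U u i z f"
  show "vector_field M U ?X"
    by (rule vector_field_sum[OF vector_field_scale[OF coord_vector_field[OF c]]])
  show "?X y = v"
    by (rule ext) (rule tangent_expansion[OF c y v, symmetric])
qed

text \<open>In \<open>X (Y (f * g))\<close> the mixed products of first derivatives are symmetric in
  \<open>X\<close> and \<open>Y\<close>, so they cancel in the commutator and the Leibniz rule
  remains.\<close>

lemma lie_bracket_tangent:
  assumes U: "open U" "x \<in> U" and X: "vector_field M U X" and Y: "vector_field M U Y"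
  shows "lie_bracket M X Y x \<in> tangent_space M x"
proof (rule tangent_spaceI)
  note TX = vector_field_tangent[OF X U(2)] and TY = vector_field_tangent[OF Y U(2)]
  note near = vector_field_smooth_near[OF X U] vector_field_smooth_near[OF Y U]
  fix f g assume f: "smooth_near M x f" and g: "smooth_near M x g"
  obtain W where W: "open W" "x \<in> W" "W \<subseteq> U" "smooth_fun M W f" "smooth_fun M W g"
    by (rule smooth_nearE2[OF f g U])
  have Wn: "smooth_near M y f" "smooth_near M y g" if "y \<in> W" for y
    using W that smooth_nearI by blast+
  have T: "X y \<in> tangent_space M y" "Y y \<in> tangent_space M y" if "y \<in> W" for y
    using vector_field_tangent[OF X] vector_field_tangent[OF Y] that W(3) by auto
  \<comment> \<open>Additivity of \<open>Y y\<close> is available only where \<open>f\<close> and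
    \<open>g\<close> are smooth, i.e. for \<open>y\<close> in \<open>W\<close>; the derivation
    \<open>X x\<close> sees no more than that.\<close>
  have "X x (\<lambda>y. Y y (\<lambda>z. f z + g z)) = X x (\<lambda>y. Y y f + Y y g)"
    by (rule tangent_local[OF TX W(1,2)]) (rule tangent_add[OF T(2) Wn])
  moreover have "Y x (\<lambda>y. X y (\<lambda>z. f z + g z)) = Y x (\<lambda>y. X y f + X y g)"
    by (rule tangent_local[OF TY W(1,2)]) (rule tangent_add[OF T(1) Wn])
  ultimately show "lie_bracket M X Y x (\<lambda>y. f y + g y) = lie_bracket M X Y x f + lie_bracket M X Y x g"
    by (simp add: lie_bracket_def f g smooth_near_add tangent_add[OF TX] tangent_add[OF TY] near)
  have "X x (\<lambda>y. Y y (\<lambda>z. f z * g z)) = X x (\<lambda>y. f y * Y y g + g y * Y y f)"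
    by (rule tangent_local[OF TX W(1,2)]) (rule tangent_mult[OF T(2) Wn])
  moreover have "Y x (\<lambda>y. X y (\<lambda>z. f z * g z)) = Y x (\<lambda>y. f y * X y g + g y * X y f)"
    by (rule tangent_local[OF TY W(1,2)]) (rule tangent_mult[OF T(1) Wn])
  ultimately show "lie_bracket M X Y x (\<lambda>y. f y * g y) = f x * lie_bracket M X Y x g + g x * lie_bracket M X Y x f"
    by (simp add: lie_bracket_def f g smooth_near_mult tangent_add[OF TX] tangent_add[OF TY]
        tangent_mult[OF TX] tangent_mult[OF TY] near right_diff_distrib)
next
  note TX = vector_field_tangent[OF X U(2)] and TY = vector_field_tangent[OF Y U(2)]
  note near = vector_field_smooth_near[OF X U] vector_field_smooth_near[OF Y U]
  fix a f assume f: "smooth_near M x f"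
  obtain W where W: "open W" "x \<in> W" "W \<subseteq> U" "smooth_fun M W f"
    by (rule smooth_nearE[OF f U])
  have Wn: "smooth_near M y f" if "y \<in> W" for y
    using W that smooth_nearI by blast+
  have T: "X y \<in> tangent_space M y" "Y y \<in> tangent_space M y" if "y \<in> W" for y
    using vector_field_tangent[OF X] vector_field_tangent[OF Y] that W(3) by auto
  have "X x (\<lambda>y. Y y (\<lambda>z. a * f z)) = X x (\<lambda>y. a * Y y f)"
    by (rule tangent_local[OF TX W(1,2)]) (rule tangent_cmult[OF T(2) Wn])
  moreover have "Y x (\<lambda>y. X y (\<lambda>z. a * f z)) = Y x (\<lambda>y. a * X y f)"
    by (rule tangent_local[OF TY W(1,2)]) (rule tangent_cmult[OF T(1) Wn])
  ultimately show "lie_bracket M X Y x (\<lambda>y. a * f y) = a * lie_bracket M X Y x f"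
    by (simp add: lie_bracket_def f smooth_near_mult smooth_near_const tangent_cmult[OF TX] tangent_cmult[OF TY]
        near right_diff_distrib)
next
  note TX = vector_field_tangent[OF X U(2)] and TY = vector_field_tangent[OF Y U(2)]
  fix f g assume f: "smooth_near M x f" and g: "smooth_near M x g" and e: "\<forall>\<^sub>F y in nhds x. f y = g y"
  obtain S where S: "open S" "x \<in> S" "\<And>y. y \<in> S \<Longrightarrow> f y = g y"
    using e unfolding eventually_nhds by blast
  have SU: "open (S \<inter> U)" "x \<in> S \<inter> U" using S U by auto
  have "X x (\<lambda>y. Y y f) = X x (\<lambda>y. Y y g)"
    by (rule tangent_local[OF TX SU], rule tangent_local[OF vector_field_tangent[OF Y] S(1)]) (use S in auto)
  moreover have "Y x (\<lambda>y. X y f) = Y x (\<lambda>y. X y g)"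
    by (rule tangent_local[OF TY SU], rule tangent_local[OF vector_field_tangent[OF X] S(1)]) (use S in auto)
  ultimately show "lie_bracket M X Y x f = lie_bracket M X Y x g"
    by (simp add: lie_bracket_def f g)
qed (simp add: lie_bracket_def)

end

section \<open>Determinants by cofactor expansion and skew forms\<close>

lemma length_remove_nth: "i < length xs \<Longrightarrow> length (remove_nth i xs) = length xs - 1"
  by (simp add: remove_nth_def)

lemma nth_remove_nth:
  "i < length xs \<Longrightarrow> j < length xs - 1 \<Longrightarrow> remove_nth i xs ! j = xs ! (if j < i then j else Suc j)"
  by (auto simp: remove_nth_def nth_append min_def)

lemma set_remove_nth: "set (remove_nth i xs) \<subseteq> set xs"
  unfolding remove_nth_def using set_take_subset[of i xs] set_drop_subset[of "Suc i" xs] by auto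

lemma map_remove_nth: "map f (remove_nth i xs) = remove_nth i (map f xs)"
  by (simp add: remove_nth_def take_map drop_map)

lemma remove_nth_0: "remove_nth 0 (x # xs) = xs"
  by (simp add: remove_nth_def)

lemma remove_nth_Suc: "remove_nth (Suc i) (x # xs) = x # remove_nth i xs"
  by (simp add: remove_nth_def)

text \<open>After position \<open>l\<close> is gone, position \<open>m\<close> refers to the
  original position \<open>Suc m\<close>. This matches the terms of two successive cofactor
  expansions.\<close>

lemma remove_nth_remove_nth:
  assumes "l \<le> m" "Suc m < length xs"
  shows "remove_nth m (remove_nth l xs) = remove_nth l (remove_nth (Suc m) xs)"
proof (rule nth_equalityI)
  show "length (remove_nth m (remove_nth l xs)) = length (remove_nth l (remove_nth (Suc m) xs))"
    using assms by (simp add: length_remove_nth)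
  fix i assume "i < length (remove_nth m (remove_nth l xs))"
  then have i: "i < length xs - 2" using assms by (simp add: length_remove_nth)
  show "remove_nth m (remove_nth l xs) ! i = remove_nth l (remove_nth (Suc m) xs) ! i"
    using assms i by (simp add: nth_remove_nth length_remove_nth)
qed

text \<open>Cofactor expansion along the first column. The elements of \<open>ks\<close> label the
  rows and a column is any function of the label, so covectors and functions on the manifold can
  both serve as rows. The base case makes determinants with unequal numbers of rows and columns
  vanish.\<close>

fun det_list :: "'k list \<Rightarrow> ('k \<Rightarrow> real) list \<Rightarrow> real" where
  "det_list ks [] = (if ks = [] then 1 else 0)"
| "det_list ks (c # cs) = (\<Sum>l<length ks. (- 1) ^ l * c (ks ! l) * det_list (remove_nth l ks) cs)"

lemma det_list_length: "length ks \<noteq> length cs \<Longrightarrow> det_list ks cs = 0"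
proof (induction cs arbitrary: ks)
  case (Cons c cs)
  have "det_list (remove_nth l ks) cs = 0" if "l < length ks" for l
    by (rule Cons.IH) (use Cons.prems that in \<open>simp add: length_remove_nth\<close>)
  then show ?case by simp
qed simp

lemma det_list_cong:
  "list_all2 (\<lambda>c c'. \<forall>k\<in>set ks. c k = c' k) cs cs' \<Longrightarrow> det_list ks cs = det_list ks cs'"
proof (induction cs arbitrary: cs' ks)
  case (Cons c cs)
  then obtain c' ds where cs': "cs' = c' # ds" "\<forall>k\<in>set ks. c k = c' k"
    "list_all2 (\<lambda>c c'. \<forall>k\<in>set ks. c k = c' k) cs ds"
    by (auto simp: list_all2_Cons1)
  have "det_list (remove_nth l ks) cs = det_list (remove_nth l ks) ds" for l
    by (rule Cons.IH, rule list_all2_mono[OF cs'(3)]) (use set_remove_nth[of l ks] in blast)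
  then show ?case by (simp add: cs')
qed simp

lemma det_list_map: "det_list (map h ks) cs = det_list ks (map (\<lambda>c k. c (h k)) cs)"
  by (induction cs arbitrary: ks) (simp_all add: map_remove_nth[symmetric])

lemma det_list_scale: "det_list ks ((\<lambda>k. a * c k) # cs) = a * det_list ks (c # cs)"
  by (simp add: sum_distrib_left mult_ac)

lemma det_list_diff: "det_list ks ((\<lambda>k. c k - c' k) # cs) = det_list ks (c # cs) - det_list ks (c' # cs)"
  by (simp add: sum_subtractf algebra_simps)

text \<open>Laplace expansion along column 0 is the recursion that defines
  \<open>det_list\<close>.\<close>

lemma det_list_eq_det:
  "length ks = n \<Longrightarrow> length cs = n \<Longrightarrow> det_list ks cs = det (mat n n (\<lambda>(i, j). (cs ! j) (ks ! i)))"
proof (induction n arbitrary: ks cs)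
  case 0
  then show ?case by (simp add: det_def)
next
  case (Suc n)
  then obtain c ds where cs: "cs = c # ds" "length ds = n" by (auto simp: length_Suc_conv)
  let ?A = "mat (Suc n) (Suc n) (\<lambda>(i, j). (cs ! j) (ks ! i))"
  have "det_list ks cs = (\<Sum>l<Suc n. (- 1) ^ l * c (ks ! l) * det_list (remove_nth l ks) ds)"
    using Suc.prems cs by simp
  also have "\<dots> = (\<Sum>l<Suc n. ?A $$ (l, 0) * cofactor ?A l 0)"
  proof (rule sum.cong[OF refl])
    fix l assume "l \<in> {..<Suc n}"
    then have l: "l < Suc n" by simp
    have "mat_delete ?A l 0 = mat n n (\<lambda>(i, j). (ds ! j) (remove_nth l ks ! i))"
      by (rule eq_matI) (use Suc.prems cs l in \<open>auto simp: mat_delete_def nth_remove_nth\<close>)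
    moreover have "det_list (remove_nth l ks) ds = det (mat n n (\<lambda>(i, j). (ds ! j) (remove_nth l ks ! i)))"
      by (rule Suc.IH) (use Suc.prems cs l in \<open>simp_all add: length_remove_nth\<close>)
    ultimately show "(- 1) ^ l * c (ks ! l) * det_list (remove_nth l ks) ds = ?A $$ (l, 0) * cofactor ?A l 0"
      using l cs by (simp add: cofactor_def)
  qed
  also have "\<dots> = det ?A"
    by (rule laplace_expansion_column[symmetric]) auto
  finally show ?case .
qed

text \<open>The permutation sum in \<open>wedge\<close> is the Leibniz formula of the determinant
  with rows \<open>ws\<close> and columns \<open>vs\<close>; for unequal lengths both sides are
  0.\<close>

lemma wedge_eq_det_list:
  assumes "set ws \<subseteq> cotangent_space M x"
  shows "wedge M x vs ws = det_list ws (map (\<lambda>v w. w v) vs)"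
proof (cases "length ws = length vs")
  case True
  let ?n = "length vs"
  have "wedge M x vs ws = (\<Sum>p | p permutes {..<?n}. of_int (sign p) * (\<Prod>i<?n. (ws ! i) (vs ! p i)))"
    using True assms by (simp add: wedge_def)
  also have "\<dots> = (\<Sum>p | p permutes {0..<?n}. signof p *
      (\<Prod>i = 0..<?n. mat ?n ?n (\<lambda>(i, j). (map (\<lambda>v w. w v) vs ! j) (ws ! i)) $$ (i, p i)))"
    unfolding lessThan_atLeast0
  proof (rule sum.cong[OF refl])
    fix p assume "p \<in> {p. p permutes {0..<?n}}"
    then have p: "p i < ?n" if "i < ?n" for i using permutes_in_image[of p "{0..<?n}" i] that by auto
    have "(\<Prod>i = 0..<?n. (ws ! i) (vs ! p i)) =
      (\<Prod>i = 0..<?n. mat ?n ?n (\<lambda>(i, j). (map (\<lambda>v w. w v) vs ! j) (ws ! i)) $$ (i, p i))"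
      by (rule prod.cong[OF refl]) (simp add: p)
    then show "of_int (sign p) * (\<Prod>i = 0..<?n. (ws ! i) (vs ! p i)) = signof p *
      (\<Prod>i = 0..<?n. mat ?n ?n (\<lambda>(i, j). (map (\<lambda>v w. w v) vs ! j) (ws ! i)) $$ (i, p i))"
      by simp
  qed
  also have "\<dots> = det (mat ?n ?n (\<lambda>(i, j). (map (\<lambda>v w. w v) vs ! j) (ws ! i)))"
    by (rule det_def'[symmetric]) simp
  also have "\<dots> = det_list ws (map (\<lambda>v w. w v) vs)"
    by (rule det_list_eq_det[symmetric]) (simp_all add: True)
  finally show ?thesis .
next
  case False
  then show ?thesis by (simp add: wedge_def det_list_length)
qed

text \<open>Only adjacent transpositions, no linearity and no fixed length: the notion applies alike
  to multivectors, to their restrictions to index lists and to \<open>det_list\<close> as a function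
  of its columns.\<close>

definition skew :: "('k list \<Rightarrow> real) \<Rightarrow> bool" where
  "skew F \<longleftrightarrow> (\<forall>us a b vs. F (us @ a # b # vs) = - F (us @ b # a # vs))"

lemma skew_swap: "skew F \<Longrightarrow> F (us @ a # b # vs) = - F (us @ b # a # vs)"
  unfolding skew_def by (elim allE)

lemma skew_Cons: "skew F \<Longrightarrow> skew (\<lambda>xs. F (x # xs))"
  unfolding skew_def
proof (intro allI)
  fix us a b vs
  assume "\<forall>us a b vs. F (us @ a # b # vs) = - F (us @ b # a # vs)"
  then have "F ((x # us) @ a # b # vs) = - F ((x # us) @ b # a # vs)" by (elim allE)
  then show "F (x # us @ a # b # vs) = - F (x # us @ b # a # vs)" by simp
qed

lemma skew_move:
  assumes "skew F"
  shows "F (us @ a # xs @ vs) = (- 1) ^ length xs * F (us @ xs @ a # vs)"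
proof (induction xs arbitrary: us)
  case (Cons x xs)
  show ?case
    using skew_swap[OF assms, of us a x "xs @ vs"] Cons.IH[of "us @ [x]"] by simp
qed simp

lemma skew_move_nth:
  assumes "skew F" "l < length ks"
  shows "F (ks ! l # remove_nth l ks) = (- 1) ^ l * F ks"
proof -
  have "F ([] @ ks ! l # take l ks @ drop (Suc l) ks) =
      (- 1) ^ length (take l ks) * F ([] @ take l ks @ ks ! l # drop (Suc l) ks)"
    by (rule skew_move[OF assms(1)])
  then show ?thesis using assms(2) by (simp add: remove_nth_def id_take_nth_drop[symmetric])
qed

lemma skew_move_block:
  assumes "skew F"
  shows "F (us @ xs @ ys) = (- 1) ^ (length xs * length ys) * F (us @ ys @ xs)"
proof (induction xs arbitrary: us)
  case (Cons x xs)
  show ?case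
    using Cons.IH[of "us @ [x]"] skew_move[OF assms, of us x ys xs] by (simp add: power_add)
qed simp

text \<open>The sign \<open>e\<close> is chosen before \<open>F\<close>. Hence the same sign serves
  the values of a multivector field at all points.\<close>

lemma skew_permutation:
  assumes "mset xs = mset ys"
  obtains e :: real where "\<And>F. skew F \<Longrightarrow> F xs = e * F ys"
proof -
  have "\<exists>e::real. \<forall>F. skew F \<longrightarrow> F xs = e * F ys"
    using assms
  proof (induction xs arbitrary: ys)
    case Nil
    then show ?case by (intro exI[of _ 1]) simp
  next
    case (Cons x xs)
    have "x \<in> set ys" using mset_eq_setD[OF Cons.prems] by auto
    then obtain us vs where ys: "ys = us @ x # vs" by (meson split_list)
    with Cons.prems have "mset xs = mset (us @ vs)" by simp
    then obtain e :: real where e: "\<And>F. skew F \<Longrightarrow> F xs = e * F (us @ vs)" using Cons.IH by blast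
    have "F (x # xs) = e * (- 1) ^ length us * F ys" if "skew F" for F
      using e[OF skew_Cons[OF that, of x]] skew_move[OF that, of "[]" x us vs] ys by simp
    then show ?case by blast
  qed
  then show thesis using that by blast
qed

text \<open>Equal entries are brought next to each other; exchanging them there shows that the value
  is its own negative.\<close>

lemma skew_not_distinct:
  assumes "skew F" "\<not> distinct xs"
  shows "F xs = 0"
proof -
  obtain as bs cs y where "xs = as @ [y] @ bs @ [y] @ cs"
    using not_distinct_decomp[OF assms(2)] by blast
  then have "mset xs = mset ([] @ y # y # as @ bs @ cs)" by simp
  then obtain e :: real where "F xs = e * F ([] @ y # y # as @ bs @ cs)"
    using skew_permutation assms(1) by metis
  moreover have "F ([] @ y # y # as @ bs @ cs) = 0"
    using skew_swap[OF assms(1), of "[]" y y "as @ bs @ cs"] by simp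
  ultimately show ?thesis by simp
qed

text \<open>Expansion along two columns is a sum over ordered pairs of distinct rows. Exchanging the
  columns exchanges the members of each pair.\<close>

lemma det_list_swap: "det_list ks (a # b # cs) = - det_list ks (b # a # cs)"
proof -
  let ?n = "length ks"
  let ?T = "{..<?n} \<times> {..<?n - 1}"
  let ?P = "\<lambda>a b (l, m). (- 1) ^ l * a (ks ! l) *
      ((- 1) ^ m * b (remove_nth l ks ! m) * det_list (remove_nth m (remove_nth l ks)) cs)"
  \<comment> \<open>A pair \<open>(l, m)\<close> means: delete row \<open>l\<close>, then row
    \<open>m\<close> of the rest. The involution deletes the same two rows in the other order; it
    changes \<open>l + m\<close> by one, whence the sign.\<close>
  let ?\<phi> = "\<lambda>(l, m). if l \<le> m then (Suc m, l) else (m, l - 1)"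
  have exp: "det_list ks (a # b # cs) = sum (?P a b) ?T" for a b
    by (simp add: length_remove_nth sum_distrib_left sum.cartesian_product)
  have "sum (?P a b) ?T = (\<Sum>p\<in>?T. - ?P b a p)"
  proof (rule sum.reindex_bij_witness[of _ ?\<phi> ?\<phi>])
    fix p assume "p \<in> ?T"
    then obtain l m where p: "p = (l, m)" "l < ?n" "m < ?n - 1" by auto
    show "?\<phi> (?\<phi> p) = p" "?\<phi> p \<in> ?T" using p by auto
    then show "?\<phi> (?\<phi> p) = p" "?\<phi> p \<in> ?T" .
    show "- ?P b a (?\<phi> p) = ?P a b p"
    proof (cases "l \<le> m")
      case True
      then show ?thesis using p
        by (simp add: nth_remove_nth remove_nth_remove_nth)
    next
      case False
      then obtain l' where l': "l = Suc l'" "m \<le> l'" by (cases l) auto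
      then show ?thesis using p
        by (simp add: nth_remove_nth remove_nth_remove_nth)
    qed
  qed
  then show ?thesis by (simp only: exp sum_negf)
qed

lemma skew_det_list: "skew (det_list ks)"
  unfolding skew_def
proof (intro allI)
  fix us a b vs
  show "det_list ks (us @ a # b # vs) = - det_list ks (us @ b # a # vs)"
  proof (induction us arbitrary: ks)
    case Nil
    show ?case unfolding append_Nil by (rule det_list_swap)
  next
    case (Cons c us)
    show ?case unfolding append_Cons det_list.simps(2) Cons.IH by (simp add: sum_negf)
  qed
qed

text \<open>Expansion along the common columns \<open>xs\<close> leaves the sums for
  \<open>cs\<close> on fewer rows with coefficients independent of \<open>t\<close>. Since rows get
  deleted, the hypothesis must cover all lists of rows taken from \<open>ks\<close>.\<close>

lemma det_list_prefix_sum_zero: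
  assumes "\<And>ks'. set ks' \<subseteq> set ks \<Longrightarrow> (\<Sum>t\<in>T. a t * det_list ks' (cs t)) = 0"
  shows "(\<Sum>t\<in>T. a t * det_list ks (xs @ cs t)) = 0"
  using assms
proof (induction xs arbitrary: ks)
  case Nil
  show ?case using Nil[OF order_refl] by simp
next
  case (Cons x xs)
  have "(\<Sum>t\<in>T. a t * det_list ks ((x # xs) @ cs t)) =
      (\<Sum>l<length ks. (- 1) ^ l * x (ks ! l) * (\<Sum>t\<in>T. a t * det_list (remove_nth l ks) (xs @ cs t)))"
    by (simp add: sum_distrib_left mult_ac) (rule sum.swap)
  also have "\<dots> = 0"
  proof (rule sum.neutral, rule ballI)
    fix l
    have "(\<Sum>t\<in>T. a t * det_list (remove_nth l ks) (xs @ cs t)) = 0"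
    proof (rule Cons.IH)
      fix ks' :: "'a list" assume "set ks' \<subseteq> set (remove_nth l ks)"
      then show "(\<Sum>t\<in>T. a t * det_list ks' (cs t)) = 0"
        using Cons.prems set_remove_nth[of l ks] by (meson order_trans)
    qed
    then show "(- 1) ^ l * x (ks ! l) * (\<Sum>t\<in>T. a t * det_list (remove_nth l ks) (xs @ cs t)) = 0"
      by simp
  qed
  finally show ?case .
qed

lemma sum_lists_Suc:
  fixes f :: "'i::finite list \<Rightarrow> real"
  shows "(\<Sum>is | length is = Suc q. f is) = (\<Sum>i\<in>UNIV. \<Sum>is | length is = q. f (i # is))"
proof -
  have "(\<Sum>is | length is = Suc q. f is) = (\<Sum>(i, is)\<in>UNIV \<times> {is. length is = q}. f (i # is))"
    by (rule sum.reindex_bij_witness[of _ "\<lambda>(i, is). i # is" "\<lambda>is. (hd is, tl is)"])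
      (auto simp: length_Suc_conv)
  then show ?thesis by (simp add: sum.cartesian_product)
qed

text \<open>\<open>a k\<close> are the coordinates of \<open>k\<close> in the basis \<open>e\<close>.  The factor \<open>q!\<close> arises because the sum runs over
  all index lists, not only the increasing ones.\<close>
lemma skew_expansion:
  fixes e :: "'i::finite \<Rightarrow> 'k"
  assumes "skew G" "\<And>k ks. k \<in> K \<Longrightarrow> G (k # ks) = (\<Sum>i\<in>UNIV. a k i * G (e i # ks))"
    and "length ks = q" "set ks \<subseteq> K"
  shows "(\<Sum>is | length is = q. G (map e is) * det_list ks (map (\<lambda>i k. a k i) is)) = fact q * G ks"
  using assms
proof (induction q arbitrary: G ks)
  case 0
  then show ?case by simp
next
  case (Suc q)
  let ?D = "\<lambda>l is. det_list (remove_nth l ks) (map (\<lambda>i k. a k i) is)"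
  have "(\<Sum>is | length is = Suc q. G (map e is) * det_list ks (map (\<lambda>i k. a k i) is)) =
      (\<Sum>i\<in>UNIV. \<Sum>is | length is = q. \<Sum>l<length ks. (- 1) ^ l * (a (ks ! l) i * G (e i # map e is) * ?D l is))"
    by (simp add: sum_lists_Suc sum_distrib_left mult_ac)
  also have "\<dots> = (\<Sum>i\<in>UNIV. \<Sum>l<length ks. \<Sum>is | length is = q. (- 1) ^ l * (a (ks ! l) i * G (e i # map e is) * ?D l is))"
    by (rule sum.cong[OF refl], rule sum.swap)
  also have "\<dots> = (\<Sum>l<length ks. \<Sum>i\<in>UNIV. \<Sum>is | length is = q. (- 1) ^ l * (a (ks ! l) i * G (e i # map e is) * ?D l is))"
    by (rule sum.swap)
  also have "\<dots> = (\<Sum>l<length ks. \<Sum>is | length is = q. \<Sum>i\<in>UNIV. (- 1) ^ l * (a (ks ! l) i * G (e i # map e is) * ?D l is))"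
    by (rule sum.cong[OF refl], rule sum.swap)
  also have "\<dots> = (\<Sum>l<length ks. (- 1) ^ l * (\<Sum>is | length is = q. (\<Sum>i\<in>UNIV. a (ks ! l) i * G (e i # map e is)) * ?D l is))"
    by (simp add: sum_distrib_left sum_distrib_right)
  \<comment> \<open>The cofactor sign of row \<open>l\<close> cancels against the sign of moving
    \<open>ks ! l\<close> to the front of \<open>G\<close>, so all \<open>Suc q\<close> rows
    contribute equally. This turns \<open>fact q\<close> into \<open>fact (Suc q)\<close>.\<close>
  also have "\<dots> = (\<Sum>l<length ks. fact q * G ks)"
  proof (rule sum.cong[OF refl])
    fix l assume l: "l \<in> {..<length ks}"
    then have kl: "ks ! l \<in> K" using Suc.prems(4) by auto
    have "(\<Sum>is | length is = q. G (ks ! l # map e is) * ?D l is) = fact q * G (ks ! l # remove_nth l ks)"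
    proof (rule Suc.IH[OF skew_Cons[OF Suc.prems(1)]])
      fix k and ks' :: "'k list" assume k: "k \<in> K"
      have sw: "G (ks ! l # k # ks') = - G (k # ks ! l # ks')" for k
        using skew_swap[OF Suc.prems(1), of "[]" "ks ! l" k ks'] by simp
      show "G (ks ! l # k # ks') = (\<Sum>i\<in>UNIV. a k i * G (ks ! l # e i # ks'))"
        unfolding sw Suc.prems(2)[OF k] by (simp add: sum_negf)
    qed (use l Suc.prems set_remove_nth[of l ks] in \<open>auto simp: length_remove_nth\<close>)
    also have "G (ks ! l # remove_nth l ks) = (- 1) ^ l * G ks"
      by (rule skew_move_nth[OF Suc.prems(1)]) (use l in simp)
    finally show "(- 1) ^ l * (\<Sum>is | length is = q. (\<Sum>i\<in>UNIV. a (ks ! l) i * G (e i # map e is)) * ?D l is) = fact q * G ks"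
      unfolding Suc.prems(2)[OF kl, symmetric] by (simp add: power_mult_distrib[symmetric] mult_ac flip: power_add)
  qed
  also have "\<dots> = fact (Suc q) * G ks"
    using Suc.prems(3) by (simp add: algebra_simps)
  finally show ?case .
qed

section \<open>The Leibniz rule for determinants of vector fields\<close>

context manifold begin

text \<open>The product rule differentiates one column at a time; bringing column \<open>j\<close>
  to the front costs \<open>(- 1) ^ j\<close>. Smoothness is carried along in the induction because
  the product rule needs smooth cofactors.\<close>

lemma
  assumes X: "X \<in> tangent_space M x"
    and sm: "\<And>Y f. Y \<in> set Ys \<Longrightarrow> f \<in> set fs \<Longrightarrow> smooth_near M x (\<lambda>y. Y y f)"
  shows smooth_near_det_list: "smooth_near M x (\<lambda>y. det_list fs (map (\<lambda>Y. Y y) Ys))"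
    and tangent_det_list: "X (\<lambda>y. det_list fs (map (\<lambda>Y. Y y) Ys)) =
      (\<Sum>j<length Ys. (- 1) ^ j * det_list fs ((\<lambda>f. X (\<lambda>y. (Ys ! j) y f)) # map (\<lambda>Y. Y x) (remove_nth j Ys)))"
proof -
  have "smooth_near M x (\<lambda>y. det_list fs (map (\<lambda>Y. Y y) Ys)) \<and>
    X (\<lambda>y. det_list fs (map (\<lambda>Y. Y y) Ys)) =
      (\<Sum>j<length Ys. (- 1) ^ j * det_list fs ((\<lambda>f. X (\<lambda>y. (Ys ! j) y f)) # map (\<lambda>Y. Y x) (remove_nth j Ys)))"
    using sm
  proof (induction Ys arbitrary: fs)
    case Nil
    then show ?case by (simp add: smooth_near_const tangent_const[OF X])
  next
    case (Cons Y Ys)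
    let ?D = "\<lambda>l y. det_list (remove_nth l fs) (map (\<lambda>Y. Y y) Ys)"
    let ?Z = "\<lambda>Y f. X (\<lambda>y. Y y f)"
    have IH: "smooth_near M x (?D l)"
        "X (?D l) = (\<Sum>j<length Ys. (- 1) ^ j * det_list (remove_nth l fs) (?Z (Ys ! j) # map (\<lambda>Y. Y x) (remove_nth j Ys)))" for l
      using Cons.IH[of "remove_nth l fs"] Cons.prems set_remove_nth[of l fs] by auto
    have sY: "smooth_near M x (\<lambda>y. (- 1) ^ l * Y y (fs ! l))" if "l < length fs" for l
      by (rule smooth_near_mult[OF smooth_near_const Cons.prems]) (use that in auto)
    have smt: "smooth_near M x (\<lambda>y. (- 1) ^ l * Y y (fs ! l) * ?D l y)" if "l < length fs" for l
      by (rule smooth_near_mult[OF sY[OF that] IH(1)])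
    \<comment> \<open>When the derivative falls on a cofactor, the differentiated column stands
      behind \<open>Y x\<close>. Swapping the two raises the exponent from \<open>j\<close> to
      \<open>Suc j\<close>, the position in \<open>Y # Ys\<close>.\<close>
    have tail: "(\<Sum>l<length fs. (- 1) ^ l * Y x (fs ! l) * X (?D l)) =
        (\<Sum>j<length Ys. (- 1) ^ Suc j * det_list fs (?Z (Ys ! j) # Y x # map (\<lambda>Y. Y x) (remove_nth j Ys)))"
    proof -
      have "(\<Sum>l<length fs. (- 1) ^ l * Y x (fs ! l) * X (?D l)) =
        (\<Sum>j<length Ys. (- 1) ^ j * det_list fs (Y x # ?Z (Ys ! j) # map (\<lambda>Y. Y x) (remove_nth j Ys)))"
        unfolding IH(2) det_list.simps(2)[of fs "Y x"] sum_distrib_left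
        by (subst sum.swap) (simp only: mult_ac)
      then show ?thesis by (simp only: det_list_swap[of fs "Y x"] power_Suc mult_minus_left mult_minus_right mult_1)
    qed
    have "X (\<lambda>y. det_list fs (map (\<lambda>Y. Y y) (Y # Ys))) = (\<Sum>l<length fs. X (\<lambda>y. (- 1) ^ l * Y y (fs ! l) * ?D l y))"
      unfolding list.map det_list.simps by (rule tangent_sum[OF X smt]) simp
    also have "\<dots> = (\<Sum>l<length fs. (- 1) ^ l * Y x (fs ! l) * X (?D l) + (- 1) ^ l * ?Z Y (fs ! l) * ?D l x)"
    proof (rule sum.cong[OF refl])
      fix l assume "l \<in> {..<length fs}"
      then have l: "l < length fs" by simp
      show "X (\<lambda>y. (- 1) ^ l * Y y (fs ! l) * ?D l y) =
        (- 1) ^ l * Y x (fs ! l) * X (?D l) + (- 1) ^ l * ?Z Y (fs ! l) * ?D l x"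
        unfolding tangent_mult[OF X sY[OF l] IH(1)]
        by (subst tangent_cmult[OF X Cons.prems]) (use l in simp_all)
    qed
    also have "\<dots> = (\<Sum>j<length (Y # Ys). (- 1) ^ j * det_list fs (?Z ((Y # Ys) ! j) # map (\<lambda>Y. Y x) (remove_nth j (Y # Ys))))"
      unfolding sum.distrib tail
      by (simp only: length_Cons sum.lessThan_Suc_shift nth_Cons_0 nth_Cons_Suc remove_nth_0 remove_nth_Suc
          list.map power_0 mult_1_left det_list.simps(2)[of fs "?Z Y"] add.commute)
    finally show ?case
      using smooth_near_sum[of "{..<length fs}", OF smt] by simp
  qed
  then show "smooth_near M x (\<lambda>y. det_list fs (map (\<lambda>Y. Y y) Ys))"
    "X (\<lambda>y. det_list fs (map (\<lambda>Y. Y y) Ys)) =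
      (\<Sum>j<length Ys. (- 1) ^ j * det_list fs ((\<lambda>f. X (\<lambda>y. (Ys ! j) y f)) # map (\<lambda>Y. Y x) (remove_nth j Ys)))"
    by blast+
qed

end

section \<open>The Schouten--Nijenhuis bracket in constant coordinates\<close>

text \<open>Polarisation: with \<open>a + b\<close> in two neighbouring places the form vanishes,
  and expanding it leaves the two swapped values. Lists outside the domain remain outside after a
  swap, where both values are 0.\<close>

lemma alternating_multilinear_skew:
  assumes F: "alternating_multilinear S q F" and S: "\<And>u v. u \<in> S \<Longrightarrow> v \<in> S \<Longrightarrow> (\<lambda>t. u t + v t) \<in> S"
    and zero: "\<And>ws. \<not> (length ws = q \<and> set ws \<subseteq> S) \<Longrightarrow> F ws = 0"
  shows "skew F"
  unfolding skew_def
proof (intro allI)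
  fix us a b vs
  show "F (us @ a # b # vs) = - F (us @ b # a # vs)"
  proof (cases "length (us @ a # b # vs) = q \<and> set (us @ a # b # vs) \<subseteq> S")
    case False
    then have "F (us @ a # b # vs) = 0" "F (us @ b # a # vs) = 0"
      by (auto intro!: zero)
    then show ?thesis by simp
  next
    case True
    then have S': "set us \<subseteq> S" "set vs \<subseteq> S" "a \<in> S" "b \<in> S" and q: "q = Suc (Suc (length us + length vs))" by auto
    let ?c = "\<lambda>t. a t + b t"
    have c: "?c \<in> S" by (rule S[OF S'(3,4)])
    have A: "\<forall>i<q. \<forall>u\<in>S. \<forall>v\<in>S. F (ws[i := (\<lambda>t. u t + v t)]) = F (ws[i := u]) + F (ws[i := v])"
      and E: "\<forall>i<q. \<forall>j<q. i \<noteq> j \<and> ws ! i = ws ! j \<longrightarrow> F ws = 0"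
      if "length ws = q \<and> set ws \<subseteq> S" for ws
      using F that unfolding alternating_multilinear_def by blast+
    have eq: "F (us @ x # x # vs) = 0" if "x \<in> S" for x
    proof -
      have "length (us @ x # x # vs) = q \<and> set (us @ x # x # vs) \<subseteq> S"
        using S' q that by auto
      from E[OF this, rule_format, of "length us" "Suc (length us)"]
      show ?thesis using q by (simp add: nth_append)
    qed
    have lin1: "F (us @ ?c # x # vs) = F (us @ a # x # vs) + F (us @ b # x # vs)" if "x \<in> S" for x
    proof -
      have "length (us @ a # x # vs) = q \<and> set (us @ a # x # vs) \<subseteq> S"
        using S' q that by auto
      from A[OF this, rule_format, of "length us" a b]
      show ?thesis using q S' by simp
    qed
    have lin2: "F (us @ x # ?c # vs) = F (us @ x # a # vs) + F (us @ x # b # vs)" if "x \<in> S" for x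
    proof -
      have "length (us @ x # a # vs) = q \<and> set (us @ x # a # vs) \<subseteq> S"
        using S' q that by auto
      from A[OF this, rule_format, of "Suc (length us)" a b]
      show ?thesis using q S' by (simp add: list_update_append)
    qed
    show ?thesis
      using eq[OF c] lin1[OF c] lin2[OF S'(3)] lin2[OF S'(4)] eq[OF S'(3)] eq[OF S'(4)] by simp
  qed
qed

section \<open>Multivectors in coordinates and brackets of decompositions\<close>

context manifold begin

lemma cotangent_sum_differentials:
  assumes "(U, u) \<in> M" "y \<in> U" "w \<in> cotangent_space M y"
  shows "w = (\<lambda>v. \<Sum>i\<in>UNIV. w (coord_vector M U u i y) * differential M y (\<lambda>z. u z $ i) v)"
proof
  fix v
  show "w v = (\<Sum>i\<in>UNIV. w (coord_vector M U u i y) * differential M y (\<lambda>z. u z $ i) v)"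
  proof (cases "v \<in> tangent_space M y")
    case True
    have "w v = differential M y (\<lambda>z. \<Sum>i\<in>UNIV. w (coord_vector M U u i y) * u z $ i) v"
      by (rule fun_cong[OF cotangent_expansion[OF assms]])
    then show ?thesis by (simp add: differential_apply[OF True] tangent_coord_sum[OF True assms(1,2)])
  qed (simp add: cotangent_outside[OF assms(3)] differential_def)
qed

lemma multivector_zero:
  "F \<in> multivector_space M q x \<Longrightarrow> \<not> (length ws = q \<and> set ws \<subseteq> cotangent_space M x) \<Longrightarrow> F ws = 0"
  unfolding multivector_space_def by blast

lemma multivector_skew:
  assumes "F \<in> multivector_space M q x"
  shows "skew F"
proof (rule alternating_multilinear_skew)
  show "alternating_multilinear (cotangent_space M x) q F"
    using assms unfolding multivector_space_def by blast
qed (rule cotangent_space_add, assumption+, rule multivector_zero[OF assms])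

lemma multivector_sum_Cons:
  assumes F: "F \<in> multivector_space M q x" and "finite I" and e: "\<And>i. i \<in> I \<Longrightarrow> e i \<in> cotangent_space M x"
  shows "F ((\<lambda>v. \<Sum>i\<in>I. a i * e i v) # ws) = (\<Sum>i\<in>I. a i * F (e i # ws))"
proof -
  let ?S = "cotangent_space M x"
  have z: "(\<lambda>v. 0) \<in> ?S" unfolding cotangent_space_def by simp
  have sum_S: "(\<lambda>v. \<Sum>i\<in>J. a i * e i v) \<in> ?S" if "finite J" "J \<subseteq> I" for J
    using that by (induction J rule: finite_induct) (simp_all add: z cotangent_space_add cotangent_space_scale e)
  show ?thesis
  proof (cases "Suc (length ws) = q \<and> set ws \<subseteq> ?S")
    case False
    then have "F (w # ws) = 0" for w by (intro multivector_zero[OF F]) auto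
    then show ?thesis by simp
  next
    case True
    \<comment> \<open>The head of this list is overwritten in every use; the zero covector is a
      placeholder.\<close>
    have base: "length ((\<lambda>v. 0) # ws) = q \<and> set ((\<lambda>v. 0) # ws) \<subseteq> ?S" using True z by simp
    have am: "alternating_multilinear ?S q F" using F unfolding multivector_space_def by blast
    have "\<forall>i<q. \<forall>u\<in>?S. \<forall>v\<in>?S. F (((\<lambda>v. 0) # ws)[i := (\<lambda>t. u t + v t)]) = F (((\<lambda>v. 0) # ws)[i := u]) + F (((\<lambda>v. 0) # ws)[i := v])"
      and "\<forall>i<q. \<forall>c. \<forall>u\<in>?S. F (((\<lambda>v. 0) # ws)[i := (\<lambda>t. c * u t)]) = c * F (((\<lambda>v. 0) # ws)[i := u])"
      using am base unfolding alternating_multilinear_def by blast+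
    from this(1)[rule_format, of 0] this(2)[rule_format, of 0]
    have add: "F ((\<lambda>t. u t + v t) # ws) = F (u # ws) + F (v # ws)"
      and scale: "F ((\<lambda>t. c * u t) # ws) = c * F (u # ws)" if "u \<in> ?S" "v \<in> ?S" for u v c
      using True that by auto
    have "F ((\<lambda>v. \<Sum>i\<in>J. a i * e i v) # ws) = (\<Sum>i\<in>J. a i * F (e i # ws))" if "finite J" "J \<subseteq> I" for J
      using that
    proof (induction J rule: finite_induct)
      case empty
      then show ?case using scale[OF z z, of 0] by simp
    next
      case (insert i J)
      have "F ((\<lambda>v. a i * e i v + (\<Sum>i\<in>J. a i * e i v)) # ws) = F ((\<lambda>v. a i * e i v) # ws) + F ((\<lambda>v. \<Sum>i\<in>J. a i * e i v) # ws)"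
        by (rule add[OF cotangent_space_scale[OF e] sum_S]) (use insert in auto)
      then show ?case using insert scale[OF e z, of i "a i"] by simp
    qed
    then show ?thesis using assms(2) by blast
  qed
qed

lemma multivector_Cons:
  assumes c: "(U, u) \<in> M" "y \<in> U" and F: "F \<in> multivector_space M q y" and w: "w \<in> cotangent_space M y"
  shows "F (w # ws) = (\<Sum>i\<in>UNIV. w (coord_vector M U u i y) * F (differential M y (\<lambda>z. u z $ i) # ws))"
proof -
  have "F (w # ws) = F ((\<lambda>v. \<Sum>i\<in>UNIV. w (coord_vector M U u i y) * differential M y (\<lambda>z. u z $ i) v) # ws)"
    by (rule arg_cong[where f="\<lambda>w. F (w # ws)"]) (rule cotangent_sum_differentials[OF c w])
  also have "\<dots> = (\<Sum>i\<in>UNIV. w (coord_vector M U u i y) * F (differential M y (\<lambda>z. u z $ i) # ws))"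
    by (rule multivector_sum_Cons[OF F]) (simp_all add: differential_cotangent)
  finally show ?thesis .
qed

lemma multivector_expansion:
  assumes c: "(U, u) \<in> M" "y \<in> U" and F: "F \<in> multivector_space M q y"
    and ws: "length ws = q" "set ws \<subseteq> cotangent_space M y"
  shows "(\<Sum>is | length is = q. F (map (\<lambda>i. differential M y (\<lambda>z. u z $ i)) is) *
      det_list ws (map (\<lambda>i w. w (coord_vector M U u i y)) is)) = fact q * F ws"
  by (rule skew_expansion[OF multivector_skew[OF F] multivector_Cons[OF c F] ws])

lemma multivector_fieldD: "multivector_field M q V \<Longrightarrow> V x \<in> multivector_space M q x"
  unfolding multivector_field_def by blast

text \<open>A tangent vector is already a function of \<open>f\<close>, so on differentials the
  vectors themselves are the columns and the functions \<open>fs\<close> label the rows.\<close>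

lemma wedge_differentials:
  assumes "set vs \<subseteq> tangent_space M x"
  shows "wedge M x vs (map (differential M x) fs) = det_list fs vs"
proof -
  have "wedge M x vs (map (differential M x) fs) = det_list (map (differential M x) fs) (map (\<lambda>v w. w v) vs)"
    by (rule wedge_eq_det_list) (auto simp: differential_cotangent)
  also have "\<dots> = det_list fs (map (\<lambda>v f. differential M x f v) vs)"
    by (simp add: det_list_map o_def)
  also have "map (\<lambda>v f. differential M x f v) vs = vs"
    by (rule map_idI) (use assms in \<open>auto simp: differential_def fun_eq_iff\<close>)
  finally show ?thesis .
qed

lemma decomposition_fields:
  assumes "decomposition M U q V XX" "Xs \<in> set XX"
  shows "length Xs = q" "\<And>X. X \<in> set Xs \<Longrightarrow> vector_field M U X"
  using assms unfolding decomposition_def by blast+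

lemma decomposition_apply:
  assumes "decomposition M U q V XX" "y \<in> U"
  shows "V y (map (differential M y) fs) = (\<Sum>t<length XX. det_list fs (map (\<lambda>X. X y) (XX ! t)))"
proof -
  have "V y (map (differential M y) fs) = (\<Sum>Xs\<leftarrow>XX. wedge M y (map (\<lambda>X. X y) Xs) (map (differential M y) fs))"
    using assms unfolding decomposition_def by metis
  also have "\<dots> = (\<Sum>Xs\<leftarrow>XX. det_list fs (map (\<lambda>X. X y) Xs))"
  proof (rule arg_cong[where f=sum_list], rule map_cong[OF refl])
    fix Xs assume Xs: "Xs \<in> set XX"
    have "X y \<in> tangent_space M y" if "X \<in> set Xs" for X
      by (rule vector_field_tangent[OF decomposition_fields(2)[OF assms(1) Xs that] assms(2)])
    then show "wedge M y (map (\<lambda>X. X y) Xs) (map (differential M y) fs) = det_list fs (map (\<lambda>X. X y) Xs)"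
      by (intro wedge_differentials) auto
  qed
  finally show ?thesis by (simp add: sum_list_sum_nth atLeast0LessThan)
qed

text \<open>The left-hand side is the derivative along \<open>X\<close> of the constant function \<open>y \<mapsto> V y (df\<^sub>1, \<dots>, df\<^sub>q)\<close>
  when \<open>P\<close> is empty; a frozen prefix \<open>P\<close> of columns is removed by cofactor expansion.\<close>
lemma constant_coefficients_derivative:
  assumes U: "open U" "x \<in> U" and dec: "decomposition M U q V YY" and X: "X \<in> tangent_space M x"
    and fs: "\<And>f. f \<in> set fs \<Longrightarrow> smooth_fun M U f"
    and const: "\<And>gs. set gs \<subseteq> set fs \<Longrightarrow> \<exists>c. \<forall>y\<in>U. V y (map (differential M y) gs) = c"
  shows "(\<Sum>t<length YY. \<Sum>j<q. (- 1) ^ j *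
    det_list fs (P @ (\<lambda>f. X (\<lambda>y. (YY ! t ! j) y f)) # map (\<lambda>Y. Y x) (remove_nth j (YY ! t)))) = 0"
proof -
  have len: "length (YY ! t) = q" if "t < length YY" for t
    by (rule decomposition_fields(1)[OF dec]) (use that in simp)
  let ?Z = "\<lambda>(t, j). (\<lambda>f. X (\<lambda>y. (YY ! t ! j) y f)) # map (\<lambda>Y. Y x) (remove_nth j (YY ! t))"
  let ?T = "{..<length YY} \<times> {..<q}"
  have "(\<Sum>p\<in>?T. (- 1) ^ snd p * det_list fs (P @ ?Z p)) = 0"
  proof (rule det_list_prefix_sum_zero)
    fix gs assume gs: "set gs \<subseteq> set fs"
    have sm: "smooth_near M x (\<lambda>y. Y y f)" if "t < length YY" "Y \<in> set (YY ! t)" "f \<in> set gs" for t Y f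
      by (rule vector_field_smooth_near[OF decomposition_fields(2)[OF dec nth_mem[OF that(1)] that(2)] U])
        (use smooth_nearI[OF U fs] gs that(3) in blast)
    obtain c where c: "\<And>y. y \<in> U \<Longrightarrow> V y (map (differential M y) gs) = c" using const[OF gs] by blast
    have "(\<Sum>p\<in>?T. (- 1) ^ snd p * det_list gs (?Z p)) =
        (\<Sum>t<length YY. \<Sum>j<length (YY ! t). (- 1) ^ j * det_list gs (?Z (t, j)))"
      by (simp add: sum.cartesian_product' len)
    also have "\<dots> = (\<Sum>t<length YY. X (\<lambda>y. det_list gs (map (\<lambda>Y. Y y) (YY ! t))))"
      by (rule sum.cong[OF refl], unfold prod.case, rule tangent_det_list[OF X, symmetric], rule sm) auto
    also have "\<dots> = X (\<lambda>y. \<Sum>t<length YY. det_list gs (map (\<lambda>Y. Y y) (YY ! t)))"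
      by (rule tangent_sum[OF X, symmetric], rule smooth_near_det_list[OF X], rule sm) auto
    also have "\<dots> = X (\<lambda>y. c)"
      by (rule tangent_local[OF X U]) (simp add: decomposition_apply[OF dec, symmetric] c)
    finally show "(\<Sum>p\<in>?T. (- 1) ^ snd p * det_list gs (?Z p)) = 0"
      by (simp add: tangent_const[OF X])
  qed
  then show ?thesis by (simp add: sum.cartesian_product')
qed

text \<open>Splits each Lie bracket into its two second-order halves. Neither half is a derivation
  in general, but both are admissible columns of \<open>det_list\<close>.\<close>

lemma schouten_decomposable_det_list:
  assumes U: "open U" "x \<in> U"
    and Xs: "\<And>X. X \<in> set Xs \<Longrightarrow> vector_field M U X" and Ys: "\<And>Y. Y \<in> set Ys \<Longrightarrow> vector_field M U Y"
    and fs: "\<And>f. f \<in> set fs \<Longrightarrow> smooth_fun M U f"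
  shows "schouten_decomposable M Xs Ys x (map (differential M x) fs) =
    (\<Sum>i<length Xs. \<Sum>j<length Ys. (- 1) ^ (i + j) *
      (det_list fs ((\<lambda>f. (Xs ! i) x (\<lambda>y. (Ys ! j) y f)) # map (\<lambda>Z. Z x) (remove_nth i Xs @ remove_nth j Ys)) -
       det_list fs ((\<lambda>f. (Ys ! j) x (\<lambda>y. (Xs ! i) y f)) # map (\<lambda>Z. Z x) (remove_nth i Xs @ remove_nth j Ys))))"
  unfolding schouten_decomposable_def
proof (intro sum.cong[OF refl] arg_cong2[where f="(*)"] refl)
  fix i j assume ij: "i \<in> {..<length Xs}" "j \<in> {..<length Ys}"
  let ?R = "map (\<lambda>Z. Z x) (remove_nth i Xs @ remove_nth j Ys)"
  let ?L = "lie_bracket M (Xs ! i) (Ys ! j) x"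
  have "?L \<in> tangent_space M x"
    by (rule lie_bracket_tangent[OF U Xs Ys]) (use ij in auto)
  moreover have "set ?R \<subseteq> tangent_space M x"
    using set_remove_nth[of i Xs] set_remove_nth[of j Ys] vector_field_tangent[OF Xs U(2)] vector_field_tangent[OF Ys U(2)]
    by auto
  ultimately have "wedge M x (?L # ?R) (map (differential M x) fs) = det_list fs (?L # ?R)"
    by (intro wedge_differentials) simp
  also have "\<dots> = det_list fs ((\<lambda>f. (Xs ! i) x (\<lambda>y. (Ys ! j) y f) - (Ys ! j) x (\<lambda>y. (Xs ! i) y f)) # ?R)"
    by (rule det_list_cong) (simp add: lie_bracket_def smooth_nearI[OF U fs] list_all2_same)
  finally show "wedge M x (?L # ?R) (map (differential M x) fs) =
      det_list fs ((\<lambda>f. (Xs ! i) x (\<lambda>y. (Ys ! j) y f)) # ?R) - det_list fs ((\<lambda>f. (Ys ! j) x (\<lambda>y. (Xs ! i) y f)) # ?R)"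
    by (simp only: det_list_diff)
qed

text \<open>The two halves vanish separately. In one, a factor of \<open>A\<close> differentiates
  the decomposition of \<open>B\<close> while the remaining factors of \<open>A\<close> are frozen
  columns; in the other, the roles are exchanged.\<close>

lemma schouten_sum_zero:
  assumes U: "open U" "x \<in> U" and A: "decomposition M U q A XX" and B: "decomposition M U r B YY"
    and fs: "\<And>f. f \<in> set fs \<Longrightarrow> smooth_fun M U f"
    and cA: "\<And>gs. set gs \<subseteq> set fs \<Longrightarrow> \<exists>c. \<forall>y\<in>U. A y (map (differential M y) gs) = c"
    and cB: "\<And>gs. set gs \<subseteq> set fs \<Longrightarrow> \<exists>c. \<forall>y\<in>U. B y (map (differential M y) gs) = c"
  shows "(\<Sum>Xs\<leftarrow>XX. \<Sum>Ys\<leftarrow>YY. schouten_decomposable M Xs Ys x (map (differential M x) fs)) = 0"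
proof -
  note dA = decomposition_fields[OF A nth_mem] and dB = decomposition_fields[OF B nth_mem]
  let ?a = "length XX" and ?b = "length YY"
  let ?X = "\<lambda>s i. map (\<lambda>Z. Z x) (remove_nth i (XX ! s))" and ?Y = "\<lambda>t j. map (\<lambda>Z. Z x) (remove_nth j (YY ! t))"
  let ?Z = "\<lambda>s i t j f. (XX ! s ! i) x (\<lambda>y. (YY ! t ! j) y f)" and ?Z' = "\<lambda>s i t j f. (YY ! t ! j) x (\<lambda>y. (XX ! s ! i) y f)"
  have lX: "length (?X s i) = q - 1" if "s < ?a" "i < q" for s i
    using that dA(1)[OF that(1)] by (simp add: length_remove_nth)
  have lY: "length (?Y t j) = r - 1" if "t < ?b" "j < r" for t j
    using that dB(1)[OF that(1)] by (simp add: length_remove_nth)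
  have tX: "(XX ! s ! i) x \<in> tangent_space M x" if "s < ?a" "i < q" for s i
    by (rule vector_field_tangent[OF dA(2)[OF that(1) nth_mem] U(2)]) (use that dA(1)[OF that(1)] in simp)
  have tY: "(YY ! t ! j) x \<in> tangent_space M x" if "t < ?b" "j < r" for t j
    by (rule vector_field_tangent[OF dB(2)[OF that(1) nth_mem] U(2)]) (use that dB(1)[OF that(1)] in simp)
  have first: "(\<Sum>t<?b. \<Sum>j<r. (- 1) ^ (i + j) * det_list fs (?Z s i t j # ?X s i @ ?Y t j)) = 0"
    if si: "s < ?a" "i < q" for s i
  proof -
    have "det_list fs (?Z s i t j # ?X s i @ ?Y t j) = (- 1) ^ (q - 1) * det_list fs (?X s i @ ?Z s i t j # ?Y t j)" for t j
      using skew_move[OF skew_det_list, of fs "[]" "?Z s i t j" "?X s i" "?Y t j"] lX[OF si] by simp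
    then have "(\<Sum>t<?b. \<Sum>j<r. (- 1) ^ (i + j) * det_list fs (?Z s i t j # ?X s i @ ?Y t j)) =
        (- 1) ^ i * (- 1) ^ (q - 1) * (\<Sum>t<?b. \<Sum>j<r. (- 1) ^ j * det_list fs (?X s i @ ?Z s i t j # ?Y t j))"
      by (simp only: power_add sum_distrib_left mult_ac)
    also have "\<dots> = 0"
      by (simp only: constant_coefficients_derivative[OF U B tX[OF si] fs cB] mult_zero_right)
    finally show ?thesis .
  qed
  have second: "(\<Sum>s<?a. \<Sum>i<q. (- 1) ^ (i + j) * det_list fs (?Z' s i t j # ?X s i @ ?Y t j)) = 0"
    if tj: "t < ?b" "j < r" for t j
  proof -
    have "(\<Sum>s<?a. \<Sum>i<q. (- 1) ^ (i + j) * det_list fs (?Z' s i t j # ?X s i @ ?Y t j)) =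
        (\<Sum>s<?a. \<Sum>i<q. (- 1) ^ (i + j) * ((- 1) ^ (Suc (q - 1) * (r - 1)) * det_list fs (?Y t j @ ?Z' s i t j # ?X s i)))"
    proof (intro sum.cong[OF refl] arg_cong2[where f="(*)"] refl)
      fix s i assume "s \<in> {..<?a}" "i \<in> {..<q}"
      then show "det_list fs (?Z' s i t j # ?X s i @ ?Y t j) =
          (- 1) ^ (Suc (q - 1) * (r - 1)) * det_list fs (?Y t j @ ?Z' s i t j # ?X s i)"
        using skew_move_block[OF skew_det_list, of fs "[]" "?Z' s i t j # ?X s i" "?Y t j"] lX[of s i] lY[OF tj]
        by (simp only: length_Cons append_Cons append_Nil lessThan_iff)
    qed
    also have "\<dots> = (- 1) ^ j * (- 1) ^ (Suc (q - 1) * (r - 1)) *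
        (\<Sum>s<?a. \<Sum>i<q. (- 1) ^ i * det_list fs (?Y t j @ ?Z' s i t j # ?X s i))"
      by (simp only: power_add sum_distrib_left mult_ac)
    also have "\<dots> = 0"
      by (simp only: constant_coefficients_derivative[OF U A tY[OF tj] fs cA] mult_zero_right)
    finally show ?thesis .
  qed
  have "(\<Sum>Xs\<leftarrow>XX. \<Sum>Ys\<leftarrow>YY. schouten_decomposable M Xs Ys x (map (differential M x) fs)) =
      (\<Sum>s<?a. \<Sum>t<?b. schouten_decomposable M (XX ! s) (YY ! t) x (map (differential M x) fs))"
    by (simp add: sum_list_sum_nth atLeast0LessThan)
  also have "\<dots> = (\<Sum>s<?a. \<Sum>t<?b. \<Sum>i<q. \<Sum>j<r. (- 1) ^ (i + j) *
      (det_list fs (?Z s i t j # ?X s i @ ?Y t j) - det_list fs (?Z' s i t j # ?X s i @ ?Y t j)))"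
  proof (intro sum.cong[OF refl])
    fix s t assume "s \<in> {..<?a}" "t \<in> {..<?b}"
    then have st: "s < ?a" "t < ?b" by auto
    show "schouten_decomposable M (XX ! s) (YY ! t) x (map (differential M x) fs) = (\<Sum>i<q. \<Sum>j<r. (- 1) ^ (i + j) *
      (det_list fs (?Z s i t j # ?X s i @ ?Y t j) - det_list fs (?Z' s i t j # ?X s i @ ?Y t j)))"
      using schouten_decomposable_det_list[OF U dA(2)[OF st(1)] dB(2)[OF st(2)] fs] dA(1)[OF st(1)] dB(1)[OF st(2)]
      by simp
  qed
  also have "\<dots> = (\<Sum>s<?a. \<Sum>t<?b. \<Sum>i<q. \<Sum>j<r. (- 1) ^ (i + j) * det_list fs (?Z s i t j # ?X s i @ ?Y t j)) -
      (\<Sum>s<?a. \<Sum>t<?b. \<Sum>i<q. \<Sum>j<r. (- 1) ^ (i + j) * det_list fs (?Z' s i t j # ?X s i @ ?Y t j))"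
    by (simp only: right_diff_distrib sum_subtractf)
  also have "(\<Sum>s<?a. \<Sum>t<?b. \<Sum>i<q. \<Sum>j<r. (- 1) ^ (i + j) * det_list fs (?Z s i t j # ?X s i @ ?Y t j)) =
      (\<Sum>s<?a. \<Sum>i<q. \<Sum>t<?b. \<Sum>j<r. (- 1) ^ (i + j) * det_list fs (?Z s i t j # ?X s i @ ?Y t j))"
    by (rule sum.cong[OF refl], rule sum.swap)
  also have "\<dots> = 0" by (rule sum.neutral, rule ballI, rule sum.neutral, rule ballI, rule first) auto
  also have "(\<Sum>s<?a. \<Sum>t<?b. \<Sum>i<q. \<Sum>j<r. (- 1) ^ (i + j) * det_list fs (?Z' s i t j # ?X s i @ ?Y t j)) =
      (\<Sum>t<?b. \<Sum>s<?a. \<Sum>j<r. \<Sum>i<q. (- 1) ^ (i + j) * det_list fs (?Z' s i t j # ?X s i @ ?Y t j))"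
    by (subst sum.swap) (intro sum.cong[OF refl] sum.swap)
  also have "\<dots> = (\<Sum>t<?b. \<Sum>j<r. \<Sum>s<?a. \<Sum>i<q. (- 1) ^ (i + j) * det_list fs (?Z' s i t j # ?X s i @ ?Y t j))"
    by (rule sum.cong[OF refl], rule sum.swap)
  also have "\<dots> = 0" by (rule sum.neutral, rule ballI, rule sum.neutral, rule ballI, rule second) auto
  finally show ?thesis by simp
qed

end

lemma skew_map: "skew F \<Longrightarrow> skew (\<lambda>is. F (map f is))"
  unfolding skew_def map_append list.map by (intro allI) (elim allE)

section \<open>One-forms and their exterior derivatives\<close>

lemma sum_fun_apply: "(\<Sum>x\<in>A. f x) t = (\<Sum>x\<in>A. f x t)"
  by (induction A rule: infinite_finite_induct) simp_all

text \<open>A list matches the indexing by positions in \<open>section_basis\<close>. Orthonormality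
  gives the coefficients explicitly as inner products, which later makes their smoothness
  evident.\<close>

lemma orthonormal_list_subspace:
  fixes K :: "'e::euclidean_space set"
  assumes "subspace K"
  obtains bs where "set bs \<subseteq> K"
    "\<And>l m. l < length bs \<Longrightarrow> m < length bs \<Longrightarrow> bs ! l \<bullet> bs ! m = (if l = m then 1 else 0)"
    "\<And>a. a \<in> K \<Longrightarrow> (\<Sum>l<length bs. (a \<bullet> bs ! l) *\<^sub>R bs ! l) = a"
proof -
  obtain B where B: "B \<subseteq> K" "pairwise Linear_Algebra.orthogonal B" "\<And>x. x \<in> B \<Longrightarrow> norm x = 1" "independent B"
    "card B = dim K" "span B = K"
    by (rule orthonormal_basis_subspace[OF assms]) (rule that)
  have fin: "finite B" using B(4) by (rule independent_imp_finite)
  obtain bs where bs: "set bs = B" "distinct bs" using finite_distinct_list[OF fin] by blast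
  show thesis
  proof (rule that)
    show "set bs \<subseteq> K" using B(1) bs(1) by simp
    show "bs ! l \<bullet> bs ! m = (if l = m then 1 else 0)" if "l < length bs" "m < length bs" for l m
    proof (cases "l = m")
      case True
      then show ?thesis using B(3)[of "bs ! l"] bs(1) nth_mem[OF that(1)] by (simp add: dot_square_norm)
    next
      case False
      then have "bs ! l \<noteq> bs ! m" using bs(2) that by (simp add: nth_eq_iff_index_eq)
      then have "Linear_Algebra.orthogonal (bs ! l) (bs ! m)"
        using B(2) bs(1) nth_mem[OF that(1)] nth_mem[OF that(2)] by (simp add: pairwise_def)
      then show ?thesis using False by (simp add: Linear_Algebra.orthogonal_def)
    qed
    show "(\<Sum>l<length bs. (a \<bullet> bs ! l) *\<^sub>R bs ! l) = a" if "a \<in> K" for a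
    proof -
      have "(\<Sum>b\<in>B. (a \<bullet> b) *\<^sub>R b) = a"
        by (rule orthonormal_basis_expand[OF B(2,3) _ fin]) (simp_all add: B(6) that)
      also have "(\<Sum>b\<in>B. (a \<bullet> b) *\<^sub>R b) = (\<Sum>l<length bs. (a \<bullet> bs ! l) *\<^sub>R bs ! l)"
        using sum.reindex_bij_betw[OF bij_betw_nth[OF bs(2) refl bs(1)[symmetric]], of "\<lambda>b. (a \<bullet> b) *\<^sub>R b"] by simp
      finally show ?thesis .
    qed
  qed
qed

text \<open>Only sets \<open>I\<close> that select one position and leave one contribute. On two
  arguments these are \<open>{0}\<close> and \<open>{1}\<close>, the latter with a single
  inversion.\<close>

lemma form_wedge_one_forms:
  "form_wedge (form_of_one_form \<alpha>) (form_of_one_form \<beta>) y vs =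
    (case vs of [v, w] \<Rightarrow> \<alpha> y v * \<beta> y w - \<alpha> y w * \<beta> y v | _ \<Rightarrow> 0)"
proof (cases "length vs = 2")
  case True
  then obtain v w where vs: "vs = [v, w]" by (auto simp: numeral_2_eq_2 length_Suc_conv)
  define T where "T I = (- 1) ^ card {(i, j). i < j \<and> j < length vs \<and> i \<notin> I \<and> j \<in> I} *
      form_of_one_form \<alpha> y (nths vs I) * form_of_one_form \<beta> y (nths vs (- I))" for I
  have s0: "{(i, j). i < j \<and> j < length vs \<and> i \<notin> {0::nat} \<and> j \<in> {0}} = {}" by auto
  have s1: "{(i, j). i < j \<and> j < length vs \<and> i \<notin> {1::nat} \<and> j \<in> {1}} = {(0, 1)}" by (auto simp: vs)
  have P: "Pow {..<length vs} = {{}, {0}, {1}, {0, 1}}"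
    by (simp add: vs numeral_2_eq_2 lessThan_Suc Pow_insert) blast
  have "form_wedge (form_of_one_form \<alpha>) (form_of_one_form \<beta>) y vs = sum T (Pow {..<length vs})"
    by (simp add: form_wedge_def T_def)
  then have "form_wedge (form_of_one_form \<alpha>) (form_of_one_form \<beta>) y vs = T {} + T {0} + T {1} + T {0, 1}"
    unfolding P by simp
  moreover have "T {} = 0" "T {0, 1} = 0"
    by (simp_all add: T_def vs nths_Cons form_of_one_form_def)
  moreover have "T {0} = \<alpha> y v * \<beta> y w"
    unfolding T_def s0 by (simp add: vs nths_Cons form_of_one_form_def)
  moreover have "T {1} = - (\<alpha> y w * \<beta> y v)"
    unfolding T_def s1 by (simp add: vs nths_Cons form_of_one_form_def)
  ultimately show ?thesis by (simp add: vs)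
next
  case False
  \<comment> \<open>If both factors were nonzero, \<open>I\<close> and its complement would each
    select exactly one position, forcing \<open>vs\<close> to have length 2.\<close>
  have "form_of_one_form \<alpha> y (nths vs I) * form_of_one_form \<beta> y (nths vs (- I)) = 0" for I
  proof (rule ccontr)
    assume "\<not> ?thesis"
    then obtain v w where "nths vs I = [v]" "nths vs (- I) = [w]"
      by (auto simp: form_of_one_form_def split: list.splits)
    then have "card {i. i < length vs \<and> i \<in> I} = 1" "card {i. i < length vs \<and> i \<in> - I} = 1"
      using length_nths[of vs I] length_nths[of vs "- I"] by simp_all
    moreover have "{..<length vs} = {i. i < length vs \<and> i \<in> I} \<union> {i. i < length vs \<and> i \<in> - I}" by auto
    then have "card {..<length vs} = card {i. i < length vs \<and> i \<in> I} + card {i. i < length vs \<and> i \<in> - I}"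
      by (simp only:) (rule card_Un_disjoint, auto)
    ultimately show False using False by simp
  qed
  then have "form_wedge (form_of_one_form \<alpha>) (form_of_one_form \<beta>) y vs = 0"
    by (simp only: form_wedge_def mult.assoc mult_zero_right sum.neutral_const)
  moreover have "(case vs of [v, w] \<Rightarrow> \<alpha> y v * \<beta> y w - \<alpha> y w * \<beta> y v | _ \<Rightarrow> 0) = (0::real)"
    using False by (auto split: list.splits)
  ultimately show ?thesis by simp
qed

section \<open>Differentials as closed forms and the exterior derivative\<close>

context manifold begin

lemma smooth_fun_differential:
  assumes "smooth_fun M U g" "open W" "W \<subseteq> U" "vector_field M W X"
  shows "smooth_fun M W (\<lambda>y. differential M y g (X y))"
  by (rule smooth_fun_cong[OF assms(2) vector_field_smooth[OF assms(4,2) order_refl smooth_fun_subset[OF assms(1,3)]]])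
    (simp add: differential_apply vector_field_tangent[OF assms(4)])

lemma one_form_differential:
  assumes "smooth_fun M U g" shows "one_form M U (\<lambda>y. differential M y g)"
  unfolding one_form_def
  by (auto simp: differential_cotangent intro: smooth_fun_differential[OF assms])

lemma form_of_differential:
  assumes "smooth_fun M U g"
  shows "form_of_one_form (\<lambda>y. differential M y g) \<in> differential_forms M U"
  unfolding differential_forms_def
proof (intro CollectI conjI ballI allI impI; (elim conjE)?)
  fix y k
  show "alternating_multilinear (tangent_space M y) k (form_of_one_form (\<lambda>y. differential M y g) y)"
    unfolding alternating_multilinear_def
  proof (intro allI impI; elim conjE)
    fix ws assume ws: "length ws = k" "set ws \<subseteq> tangent_space M y"
    show "(\<forall>i<k. \<forall>u\<in>tangent_space M y. \<forall>v\<in>tangent_space M y.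
         form_of_one_form (\<lambda>y. differential M y g) y (ws[i := \<lambda>t. u t + v t]) =
         form_of_one_form (\<lambda>y. differential M y g) y (ws[i := u]) + form_of_one_form (\<lambda>y. differential M y g) y (ws[i := v])) \<and>
       (\<forall>i<k. \<forall>c. \<forall>u\<in>tangent_space M y.
         form_of_one_form (\<lambda>y. differential M y g) y (ws[i := \<lambda>t. c * u t]) =
         c * form_of_one_form (\<lambda>y. differential M y g) y (ws[i := u])) \<and>
       (\<forall>i<k. \<forall>j<k. i \<noteq> j \<and> ws ! i = ws ! j \<longrightarrow> form_of_one_form (\<lambda>y. differential M y g) y ws = 0)"
    proof (cases "k = 1")
      case True
      then obtain w where "ws = [w]" using ws(1) by (auto simp: length_Suc_conv)
      then show ?thesis using True
        by (auto simp: form_of_one_form_def differential_apply tangent_space_add tangent_space_scale)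
    next
      case False
      have "form_of_one_form (\<lambda>y. differential M y g) y xs = 0" if "length xs = k" for xs
        using that False by (auto simp: form_of_one_form_def split: list.splits)
      then show ?thesis using ws(1) by simp
    qed
  qed
next
  fix y vs assume "\<not> set vs \<subseteq> tangent_space M y"
  then show "form_of_one_form (\<lambda>y. differential M y g) y vs = 0"
    by (auto simp: form_of_one_form_def differential_def split: list.splits)
next
  fix W Xs assume W: "open W" "W \<subseteq> U" and Xs: "\<forall>X\<in>set Xs. vector_field M W X"
  show "smooth_fun M W (\<lambda>y. form_of_one_form (\<lambda>y. differential M y g) y (map (\<lambda>X. X y) Xs))"
  proof (cases "length Xs = 1")
    case True
    then obtain X where "Xs = [X]" by (auto simp: length_Suc_conv)
    then show ?thesis using smooth_fun_differential[OF assms W] Xs by (simp add: form_of_one_form_def)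
  next
    case False
    then have "form_of_one_form (\<lambda>y. differential M y g) y (map (\<lambda>X. X y) Xs) = 0" for y
      by (auto simp: form_of_one_form_def split: list.splits)
    then show ?thesis by (simp add: smooth_fun_const[OF W(1)])
  qed
qed

text \<open>The second-order terms \<open>f l x * X x (\<lambda>y. Y y (g l))\<close> and their
  mirror images cancel against the Lie bracket term. What remains involves \<open>X x\<close> and
  \<open>Y x\<close> only, so it does not depend on the extensions.\<close>

lemma exterior_derivative_sum:
  assumes W: "open W" "x \<in> W" and v: "v \<in> tangent_space M x" and w: "w \<in> tangent_space M x"
    and f: "\<And>l. l < N \<Longrightarrow> smooth_fun M W (f l)" and g: "\<And>l. l < N \<Longrightarrow> smooth_fun M W (g l)"
    and \<omega>: "\<And>y. y \<in> W \<Longrightarrow> \<omega> y = (\<lambda>v. \<Sum>l<N. f l y * differential M y (g l) v)"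
  shows "exterior_derivative M \<omega> x [v, w] = (\<Sum>l<N. v (f l) * w (g l) - w (f l) * v (g l))"
proof -
  let ?c = "\<Sum>l<N. v (f l) * w (g l) - w (f l) * v (g l)"
  have main: "?c = X x (\<lambda>y. \<omega> y (Y y)) - Y x (\<lambda>y. \<omega> y (X y)) - \<omega> x (lie_bracket M X Y x)"
    if U: "open U" "x \<in> U" and X: "vector_field M U X" "X x = v" and Y: "vector_field M U Y" "Y x = w" for U X Y
  proof -
    have UW: "open (U \<inter> W)" "x \<in> U \<inter> W" using U W by auto
    have half: "A x (\<lambda>y. \<omega> y (B y)) = (\<Sum>l<N. f l x * A x (\<lambda>y. B y (g l)) + B x (g l) * A x (f l))"
      if A: "vector_field M U A" and B: "vector_field M U B" for A B
    proof -
      have T: "A x \<in> tangent_space M x" by (rule vector_field_tangent[OF A U(2)])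
      have n: "smooth_near M x (f l)" "smooth_near M x (\<lambda>y. B y (g l))" if "l < N" for l
        using smooth_nearI[OF W f[OF that]] vector_field_smooth_near[OF B U smooth_nearI[OF W g[OF that]]] by blast+
      have "A x (\<lambda>y. \<omega> y (B y)) = A x (\<lambda>y. \<Sum>l<N. f l y * B y (g l))"
        by (rule tangent_local[OF T UW]) (simp add: \<omega> differential_apply vector_field_tangent[OF B])
      also have "\<dots> = (\<Sum>l<N. A x (\<lambda>y. f l y * B y (g l)))"
        by (rule tangent_sum[OF T]) (simp add: smooth_near_mult n)
      also have "\<dots> = (\<Sum>l<N. f l x * A x (\<lambda>y. B y (g l)) + B x (g l) * A x (f l))"
        by (rule sum.cong[OF refl], rule tangent_mult[OF T n]) auto
      finally show ?thesis .
    qed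
    have "\<omega> x (lie_bracket M X Y x) = (\<Sum>l<N. f l x * lie_bracket M X Y x (g l))"
      by (simp add: \<omega>[OF W(2)] differential_apply lie_bracket_tangent[OF U X(1) Y(1)])
    also have "\<dots> = (\<Sum>l<N. f l x * (X x (\<lambda>y. Y y (g l)) - Y x (\<lambda>y. X y (g l))))"
      by (rule sum.cong[OF refl]) (simp add: lie_bracket_def smooth_nearI[OF W g])
    finally show ?thesis
      unfolding half[OF X(1) Y(1)] half[OF Y(1) X(1)] X(2)[symmetric] Y(2)[symmetric]
      by (simp add: sum_subtractf[symmetric] sum.distrib[symmetric] algebra_simps)
  qed
  \<comment> \<open>The description determines its value only if some extension of \<open>v\<close>
    and \<open>w\<close> exists.\<close>
  obtain U u where c: "(U, u) \<in> M" "x \<in> U" by (rule chart_at)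
  obtain X where X: "vector_field M U X" "X x = v" by (rule tangent_extension[OF c v])
  obtain Y where Y: "vector_field M U Y" "Y x = w" by (rule tangent_extension[OF c w])
  have "(THE c. \<forall>U X Y. open U \<and> x \<in> U \<and> vector_field M U X \<and> vector_field M U Y \<and> X x = v \<and> Y x = w \<longrightarrow>
      c = X x (\<lambda>y. \<omega> y (Y y)) - Y x (\<lambda>y. \<omega> y (X y)) - \<omega> x (lie_bracket M X Y x)) = ?c"
  proof (rule the_equality)
    show "\<forall>U X Y. open U \<and> x \<in> U \<and> vector_field M U X \<and> vector_field M U Y \<and> X x = v \<and> Y x = w \<longrightarrow>
      ?c = X x (\<lambda>y. \<omega> y (Y y)) - Y x (\<lambda>y. \<omega> y (X y)) - \<omega> x (lie_bracket M X Y x)"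
      by (intro allI impI; elim conjE) (rule main)
  next
    fix c' assume "\<forall>U X Y. open U \<and> x \<in> U \<and> vector_field M U X \<and> vector_field M U Y \<and> X x = v \<and> Y x = w \<longrightarrow>
      c' = X x (\<lambda>y. \<omega> y (Y y)) - Y x (\<lambda>y. \<omega> y (X y)) - \<omega> x (lie_bracket M X Y x)"
    then have "c' = X x (\<lambda>y. \<omega> y (Y y)) - Y x (\<lambda>y. \<omega> y (X y)) - \<omega> x (lie_bracket M X Y x)"
      using chart_open[OF c(1)] c(2) X Y by blast
    then show "c' = ?c"
      using main[OF chart_open[OF c(1)] c(2) X Y] by simp
  qed
  then show ?thesis using v w by (simp add: exterior_derivative_def)
qed

lemma exterior_derivative_outside:
  "(\<And>v w. vs = [v, w] \<Longrightarrow> v \<notin> tangent_space M x \<or> w \<notin> tangent_space M x) \<Longrightarrow> exterior_derivative M \<omega> x vs = 0"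
  by (auto simp: exterior_derivative_def split: list.splits)

lemma closed_differential:
  assumes "open U" "smooth_fun M U g"
  shows "closed_one_form M U (\<lambda>y. differential M y g)"
  unfolding closed_one_form_def
proof (intro conjI ballI ext)
  show "one_form M U (\<lambda>y. differential M y g)" by (rule one_form_differential[OF assms(2)])
  fix y vs assume y: "y \<in> U"
  show "exterior_derivative M (\<lambda>y. differential M y g) y vs = 0"
  proof (cases "\<exists>v w. vs = [v, w] \<and> v \<in> tangent_space M y \<and> w \<in> tangent_space M y")
    case True
    then obtain v w where vw: "vs = [v, w]" "v \<in> tangent_space M y" "w \<in> tangent_space M y" by blast
    \<comment> \<open>The differential is taken as a single summand with coefficient function 1,
      which every derivation kills.\<close>
    have "exterior_derivative M (\<lambda>y. differential M y g) y [v, w] =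
        (\<Sum>l<(1::nat). v (\<lambda>z. 1) * w g - w (\<lambda>z. 1) * v g)"
      by (rule exterior_derivative_sum[OF assms(1) y vw(2,3)]) (simp_all add: assms smooth_fun_const)
    then show ?thesis by (simp add: vw(1) tangent_const[OF vw(2)] tangent_const[OF vw(3)])
  qed (rule exterior_derivative_outside, blast)
qed

end

text \<open>Sorting a list without repetitions costs a sign that is the same at all points; for
  repeated indices or a wrong length the value is 0 throughout.\<close>

lemma constant_on_index_lists:
  fixes M :: "('a::{t2_space,second_countable_topology}, 'n::{finite,linorder}) atlas"
  assumes M: "smooth_manifold M" and V: "multivector_field M q V"
    and sorted: "\<And>is :: 'n list. length is = q \<Longrightarrow> sorted_wrt (<) is \<Longrightarrow>
      \<exists>c. \<forall>y\<in>U. V y (map (\<lambda>i. differential M y (\<lambda>z. u z $ i)) is) = c"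
  shows "\<exists>c. \<forall>y\<in>U. V y (map (\<lambda>i. differential M y (\<lambda>z. u z $ i)) is) = c"
proof -
  interpret manifold M by unfold_locales (rule M)
  let ?du = "\<lambda>y i. differential M y (\<lambda>z. u z $ i)"
  note mem = multivector_fieldD[OF V]
  note skew = skew_map[OF multivector_skew[OF mem]]
  show ?thesis
  proof (cases "length is = q \<and> distinct is")
    case True
    have "mset is = mset (sort is)" by simp
    then obtain e :: real where e: "\<And>F. skew F \<Longrightarrow> F is = e * F (sort is)"
      by (rule skew_permutation) (rule that)
    have "sorted_wrt (<) (sort is)" using True by (simp add: strict_sorted_iff)
    then obtain c where c: "\<forall>y\<in>U. V y (map (?du y) (sort is)) = c"
      using sorted[of "sort is"] True by auto
    have "V y (map (?du y) is) = e * c" if "y \<in> U" for y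
      using e[OF skew[of y "?du y"]] c that by simp
    then show ?thesis by blast
  next
    case False
    have "V y (map (?du y) is) = 0" for y
    proof (cases "distinct is")
      case True
      then show ?thesis using False by (intro multivector_zero[OF mem]) simp
    next
      case False
      then show ?thesis by (rule skew_not_distinct[OF skew])
    qed
    then show ?thesis by blast
  qed
qed

section \<open>Charts with constant coefficients\<close>

text \<open>Constancy is phrased for all index lists, so that expansions over all lists apply
  directly; \<open>constant_on_index_lists\<close> supplies it from the increasing ones.\<close>

locale constant_chart = manifold M
  for M :: "('a::{t2_space,second_countable_topology}, 'm::finite) atlas" +
  fixes q :: nat and V :: "'a \<Rightarrow> 'a multivector" and U :: "'a set" and u :: "'a \<Rightarrow> real ^ 'm"
  assumes chart_mem: "(U, u) \<in> M" and field: "multivector_field M q V"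
    and const_indices: "\<And>is. \<exists>c. \<forall>y\<in>U. V y (map (\<lambda>i. differential M y (\<lambda>z. u z $ i)) is) = c"
begin

abbreviation du :: "'a \<Rightarrow> 'm \<Rightarrow> 'a covector" where
  "du y i \<equiv> differential M y (\<lambda>z. u z $ i)"

abbreviation cv :: "'m \<Rightarrow> 'a \<Rightarrow> 'a tangent" where
  "cv \<equiv> coord_vector M U u"

definition lin :: "('m \<Rightarrow> real) \<Rightarrow> 'a \<Rightarrow> real" where
  "lin a = (\<lambda>z. \<Sum>i\<in>UNIV. a i * u z $ i)"

lemma open_U: "open U" by (rule chart_open[OF chart_mem])

lemma V_mem: "V y \<in> multivector_space M q y" by (rule multivector_fieldD[OF field])

lemma V_skew: "skew (V y)" by (rule multivector_skew[OF V_mem])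

lemma smooth_lin: "smooth_fun M U (lin a)"
  unfolding lin_def by (rule smooth_fun_coord_sum[OF chart_mem])

lemma tangent_lin: "D \<in> tangent_space M y \<Longrightarrow> y \<in> U \<Longrightarrow> D (lin a) = (\<Sum>i\<in>UNIV. a i * D (\<lambda>z. u z $ i))"
  unfolding lin_def by (rule tangent_coord_sum[OF _ chart_mem])

lemma coord_vector_lin: "y \<in> U \<Longrightarrow> cv i y (lin a) = a i"
  by (simp add: tangent_lin[OF coord_vector_tangent[OF chart_mem]] coord_vector_coord[OF chart_mem]
      if_distrib cong: if_cong)

lemma differential_lin_coord: "y \<in> U \<Longrightarrow> differential M y (lin a) (cv i y) = a i"
  by (simp add: differential_apply[OF coord_vector_tangent[OF chart_mem]] coord_vector_lin)

lemma cotangent_lin: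
  assumes "y \<in> U" "w \<in> cotangent_space M y"
  shows "w = differential M y (lin (\<lambda>i. w (cv i y)))"
  unfolding lin_def by (rule cotangent_expansion[OF chart_mem assms])

definition coefficient :: "'m list \<Rightarrow> real" where
  "coefficient is = (SOME c. \<forall>y\<in>U. V y (map (du y) is) = c)"

lemma coefficient: "y \<in> U \<Longrightarrow> V y (map (du y) is) = coefficient is"
  using someI_ex[OF const_indices[of "is"]] unfolding coefficient_def by blast

text \<open>The expansion over index lists expresses the value through the coefficients of
  \<open>V\<close> and determinants of the numbers \<open>a i\<close>, none of which depends on
  \<open>y\<close>.\<close>

lemma const_lin: "\<exists>c. \<forall>y\<in>U. V y (map (differential M y) (map lin as)) = c"
proof (cases "length as = q")
  case True
  let ?c = "(\<Sum>is | length is = q. coefficient is * det_list as (map (\<lambda>i a. a i) is)) / fact q"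
  have "V y (map (differential M y) (map lin as)) = ?c" if y: "y \<in> U" for y
  proof -
    let ?ws = "map (differential M y) (map lin as)"
    have "det_list ?ws (map (\<lambda>i w. w (cv i y)) is) = det_list as (map (\<lambda>i a. a i) is)" for "is"
      by (simp add: det_list_map o_def differential_lin_coord[OF y])
    moreover have "(\<Sum>is | length is = q. V y (map (du y) is) * det_list ?ws (map (\<lambda>i w. w (cv i y)) is)) = fact q * V y ?ws"
      by (rule multivector_expansion[OF chart_mem y V_mem]) (auto simp: True differential_cotangent)
    ultimately show ?thesis
      by (simp add: coefficient[OF y])
  qed
  then show ?thesis by blast
next
  case False
  then have "V y (map (differential M y) (map lin as)) = 0" for y
    by (intro multivector_zero[OF V_mem]) simp
  then show ?thesis by blast
qed

lemma const_range_lin: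
  assumes "set gs \<subseteq> range lin"
  shows "\<exists>c. \<forall>y\<in>U. V y (map (differential M y) gs) = c"
proof -
  have "\<forall>g\<in>set gs. \<exists>a. g = lin a" using assms by blast
  then obtain as where "gs = map lin as" using ex_map_conv[of gs lin] by blast
  then show ?thesis using const_lin by simp
qed

lemma decomposition_exists:
  assumes "1 \<le> q"
  shows "\<exists>XX. decomposition M U q V XX"
proof -
  \<comment> \<open>Each index set of size \<open>q\<close> occurs in all its orderings, each time
    with the same contribution; \<open>fact q\<close> compensates.\<close>
  define r where "r is = coefficient is / fact q" for "is"
  \<comment> \<open>A decomposition has no scalar factors, so the coefficient goes into the first
    field, which exists because \<open>1 \<le> q\<close>.\<close>
  define Xs where "Xs is = (\<lambda>y f. r is * cv (hd is) y f) # map cv (tl is)" for "is"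
  have "finite {is :: 'm list. length is = q}"
    using finite_lists_length_eq[of "UNIV :: 'm set" q] by simp
  then obtain L where L: "set L = {is :: 'm list. length is = q}" "distinct L"
    using finite_distinct_list by blast
  have "decomposition M U q V (map Xs L)"
    unfolding decomposition_def
  proof (intro conjI ballI)
    fix Ys assume "Ys \<in> set (map Xs L)"
    then obtain "is" where "is": "length is = q" "Ys = Xs is" using L by auto
    then show "length Ys = q" using assms by (simp add: Xs_def)
    fix X assume "X \<in> set Ys"
    then show "vector_field M U X"
      using vector_field_scale[OF coord_vector_field[OF chart_mem]] coord_vector_field[OF chart_mem]
      by (auto simp: "is"(2) Xs_def)
  next
    fix y assume y: "y \<in> U"
    show "V y = (\<lambda>ws. \<Sum>Xs\<leftarrow>map Xs L. wedge M y (map (\<lambda>X. X y) Xs) ws)"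
    proof
      fix ws
      have len: "length (Xs is) = q" if "length is = q" for "is"
        using that assms by (simp add: Xs_def)
      have "(\<Sum>Xs\<leftarrow>map Xs L. wedge M y (map (\<lambda>X. X y) Xs) ws) =
          (\<Sum>is | length is = q. wedge M y (map (\<lambda>X. X y) (Xs is)) ws)"
        using L by (simp add: sum_list_distinct_conv_sum_set o_def)
      also have "\<dots> = V y ws"
      proof (cases "length ws = q \<and> set ws \<subseteq> cotangent_space M y")
        case False
        then have "wedge M y (map (\<lambda>X. X y) (Xs is)) ws = 0" if "length is = q" for "is"
          using len[OF that] by (auto simp: wedge_def)
        then show ?thesis using multivector_zero[OF V_mem False] by simp
      next
        case True
        have "wedge M y (map (\<lambda>X. X y) (Xs is)) ws =
            V y (map (du y) is) * det_list ws (map (\<lambda>i w. w (cv i y)) is) / fact q" if lis: "length is = q" for "is"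
        proof -
          obtain i js where ijs: "is = i # js" using lis assms by (cases "is") auto
          let ?a = "r is"
          have "wedge M y (map (\<lambda>X. X y) (Xs is)) ws =
              det_list ws ((\<lambda>w. w (\<lambda>f. ?a * cv i y f)) # map (\<lambda>i w. w (cv i y)) js)"
            using True by (simp add: wedge_eq_det_list Xs_def ijs o_def del: det_list.simps)
          also have "\<dots> = det_list ws ((\<lambda>w. ?a * w (cv i y)) # map (\<lambda>i w. w (cv i y)) js)"
            by (rule det_list_cong)
              (use True in \<open>auto simp: list_all2_same intro!: cotangent_scale[OF _ coord_vector_tangent[OF chart_mem y]]\<close>)
          also have "\<dots> = ?a * det_list ws (map (\<lambda>i w. w (cv i y)) is)"
            by (simp only: det_list_scale ijs list.map)
          finally show ?thesis by (simp add: coefficient[OF y] r_def)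
        qed
        then have "(\<Sum>is | length is = q. wedge M y (map (\<lambda>X. X y) (Xs is)) ws) =
            (\<Sum>is | length is = q. V y (map (du y) is) * det_list ws (map (\<lambda>i w. w (cv i y)) is)) / fact q"
          by (simp add: sum_divide_distrib)
        also have "\<dots> = V y ws"
          using multivector_expansion[OF chart_mem y V_mem] True by simp
        finally show ?thesis .
      qed
      finally show "V y ws = (\<Sum>Xs\<leftarrow>map Xs L. wedge M y (map (\<lambda>X. X y) Xs) ws)" by simp
    qed
  qed
  then show ?thesis by blast
qed

lemma decomposition_subset:
  assumes "decomposition M U' p A XX" "W \<subseteq> U'"
  shows "decomposition M W p A XX"
proof -
  have "vector_field M W X" if "vector_field M U' X" for X
    by (rule vector_field_subset[OF that assms(2)])
  then show ?thesis using assms unfolding decomposition_def by blast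
qed

lemma schouten_bracket_zero:
  assumes "1 \<le> q" and x: "x \<in> U"
  shows "schouten_bracket M q q V V x = (\<lambda>ws. 0)"
  unfolding schouten_bracket_def
proof (rule the_equality)
  have zero: "(\<lambda>ws. \<Sum>Xs\<leftarrow>XX. \<Sum>Ys\<leftarrow>YY. schouten_decomposable M Xs Ys x ws) = (\<lambda>ws. 0)"
    if W: "open W" "x \<in> W" and XX: "decomposition M W q V XX" and YY: "decomposition M W q V YY" for W XX YY
  proof
    fix ws
    show "(\<Sum>Xs\<leftarrow>XX. \<Sum>Ys\<leftarrow>YY. schouten_decomposable M Xs Ys x ws) = 0"
    proof (cases "set ws \<subseteq> cotangent_space M x")
      case False
      then have "schouten_decomposable M Xs Ys x ws = 0" for Xs Ys
        by (simp add: schouten_decomposable_def wedge_def)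
      then show ?thesis by simp
    next
      case True
      \<comment> \<open>The components are frozen at \<open>x\<close>: the differentials of these
        functions agree with \<open>ws\<close> at the point where the bracket is evaluated.\<close>
      let ?fs = "map (\<lambda>w. lin (\<lambda>i. w (cv i x))) ws"
      have "map (differential M x) ?fs = ws"
        unfolding map_map o_def
      proof (rule map_idI)
        fix w assume "w \<in> set ws"
        with True have "w \<in> cotangent_space M x" by (rule subsetD)
        then show "differential M x (lin (\<lambda>i. w (cv i x))) = w" by (rule cotangent_lin[OF x, symmetric])
      qed
      moreover have "(\<Sum>Xs\<leftarrow>XX. \<Sum>Ys\<leftarrow>YY. schouten_decomposable M Xs Ys x (map (differential M x) ?fs)) = 0"
      proof (rule schouten_sum_zero[of "W \<inter> U"])
        show "open (W \<inter> U)" "x \<in> W \<inter> U" using W x open_U by auto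
        show "decomposition M (W \<inter> U) q V XX" "decomposition M (W \<inter> U) q V YY"
          by (rule decomposition_subset[OF XX Int_lower1], rule decomposition_subset[OF YY Int_lower1])
        show "smooth_fun M (W \<inter> U) f" if "f \<in> set ?fs" for f
          using that smooth_fun_subset[OF smooth_lin Int_lower2] by auto
        show "\<exists>c. \<forall>y\<in>W \<inter> U. V y (map (differential M y) gs) = c" if "set gs \<subseteq> set ?fs" for gs
        proof -
          have "set gs \<subseteq> range lin" using that by auto
          then obtain c where "\<forall>y\<in>U. V y (map (differential M y) gs) = c" using const_range_lin by blast
          then have "\<forall>y\<in>W \<inter> U. V y (map (differential M y) gs) = c" by simp
          then show ?thesis by (rule exI)
        qed
        then show "\<exists>c. \<forall>y\<in>W \<inter> U. V y (map (differential M y) gs) = c" if "set gs \<subseteq> set ?fs" for gs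
          using that .
      qed
      ultimately show ?thesis by simp
    qed
  qed
  \<comment> \<open>The definite description also needs a witness; the decomposition into coordinate
    fields provides it.\<close>
  obtain XX where XX: "decomposition M U q V XX" using decomposition_exists[OF assms(1)] by blast
  show "\<exists>U XX YY. open U \<and> x \<in> U \<and> decomposition M U q V XX \<and> decomposition M U q V YY \<and>
      (\<lambda>ws. 0) = (\<lambda>ws. \<Sum>Xs\<leftarrow>XX. \<Sum>Ys\<leftarrow>YY. schouten_decomposable M Xs Ys x ws)"
    by (intro exI conjI) (rule open_U, rule x, rule XX, rule XX, rule zero[OF open_U x XX XX, symmetric])
  fix F assume "\<exists>U XX YY. open U \<and> x \<in> U \<and> decomposition M U q V XX \<and> decomposition M U q V YY \<and>
      F = (\<lambda>ws. \<Sum>Xs\<leftarrow>XX. \<Sum>Ys\<leftarrow>YY. schouten_decomposable M Xs Ys x ws)"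
  then obtain W XX YY where "open W" "x \<in> W" "decomposition M W q V XX" "decomposition M W q V YY"
    and F: "F = (\<lambda>ws. \<Sum>Xs\<leftarrow>XX. \<Sum>Ys\<leftarrow>YY. schouten_decomposable M Xs Ys x ws)" by (elim exE conjE)
  then show "F = (\<lambda>ws. 0)" unfolding F by (intro zero)
qed

end

context constant_chart begin

section \<open>The Pfaffian system\<close>

text \<open>The fibre of the Pfaffian system in coordinates, one and the same subspace for all
  points of \<open>U\<close>.\<close>

definition coefficient_kernel :: "(real ^ 'm) set" where
  "coefficient_kernel = {a. \<forall>is. (\<Sum>i\<in>UNIV. a $ i * coefficient (i # is)) = 0}"

lemma subspace_coefficient_kernel: "subspace coefficient_kernel"
  unfolding subspace_def coefficient_kernel_def
  by (simp add: distrib_right sum.distrib mult.assoc sum_distrib_left[symmetric])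

lemma contraction_index:
  assumes "y \<in> U" "w \<in> cotangent_space M y"
  shows "V y (w # map (du y) is) = (\<Sum>i\<in>UNIV. w (cv i y) * coefficient (i # is))"
proof -
  have "V y (w # map (du y) is) = (\<Sum>i\<in>UNIV. w (cv i y) * V y (map (du y) (i # is)))"
    unfolding list.map by (rule multivector_Cons[OF chart_mem assms(1) V_mem assms(2)])
  then show ?thesis by (simp only: coefficient[OF assms(1)])
qed

text \<open>The contracted form is again skew, hence determined by its values on the differentials
  \<open>du y i\<close>; these values are the left-hand sides of the equations of
  \<open>coefficient_kernel\<close>.\<close>

lemma pfaffian_iff:
  assumes y: "y \<in> U" and w: "w \<in> cotangent_space M y"
  shows "w \<in> pfaffian_of M V y \<longleftrightarrow> (\<chi> i. w (cv i y)) \<in> coefficient_kernel"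
proof
  assume "w \<in> pfaffian_of M V y"
  then have "contraction w (V y) = (\<lambda>ws. 0)" by (simp add: pfaffian_of_def)
  then have "V y (w # ws) = 0" for ws by (simp add: contraction_def fun_eq_iff)
  then show "(\<chi> i. w (cv i y)) \<in> coefficient_kernel"
    by (simp add: coefficient_kernel_def contraction_index[OF y w, symmetric])
next
  assume "(\<chi> i. w (cv i y)) \<in> coefficient_kernel"
  then have zero: "V y (w # map (du y) is) = 0" for "is"
    by (simp add: coefficient_kernel_def contraction_index[OF y w])
  have "V y (w # ws) = 0" for ws
  proof (cases "Suc (length ws) = q \<and> set ws \<subseteq> cotangent_space M y")
    case False
    then show ?thesis by (intro multivector_zero[OF V_mem]) auto
  next
    case True
    have "(\<Sum>is | length is = length ws. V y (w # map (du y) is) * det_list ws (map (\<lambda>i w. w (cv i y)) is)) =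
        fact (length ws) * V y (w # ws)"
    proof (rule skew_expansion[OF skew_Cons[OF V_skew]])
      fix k and ks :: "'a covector list" assume k: "k \<in> cotangent_space M y"
      have sw: "V y (w # k # ks) = - V y (k # w # ks)" for k
        using skew_swap[OF V_skew, of y "[]" w k ks] by simp
      show "V y (w # k # ks) = (\<Sum>i\<in>UNIV. k (cv i y) * V y (w # du y i # ks))"
        unfolding sw multivector_Cons[OF chart_mem y V_mem k] by (simp add: sum_negf)
    qed (use True in auto)
    then show ?thesis by (simp add: zero)
  qed
  then show "w \<in> pfaffian_of M V y"
    using w by (simp add: pfaffian_of_def contraction_def)
qed

definition kernel_basis :: "(real ^ 'm) list \<Rightarrow> bool" where
  "kernel_basis bs \<longleftrightarrow> set bs \<subseteq> coefficient_kernel \<and>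
    (\<forall>l<length bs. \<forall>m<length bs. bs ! l \<bullet> bs ! m = (if l = m then 1 else 0)) \<and>
    (\<forall>a\<in>coefficient_kernel. (\<Sum>l<length bs. (a \<bullet> bs ! l) *\<^sub>R bs ! l) = a)"

lemma kernel_basis_exists: "\<exists>bs. kernel_basis bs"
proof -
  obtain bs where bs: "set bs \<subseteq> coefficient_kernel"
    "\<And>l m. l < length bs \<Longrightarrow> m < length bs \<Longrightarrow> bs ! l \<bullet> bs ! m = (if l = m then 1 else 0)"
    "\<And>a. a \<in> coefficient_kernel \<Longrightarrow> (\<Sum>l<length bs. (a \<bullet> bs ! l) *\<^sub>R bs ! l) = a"
    by (rule orthonormal_list_subspace[OF subspace_coefficient_kernel]) (rule that)
  have "kernel_basis bs" unfolding kernel_basis_def using bs by simp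
  then show ?thesis by blast
qed

definition basis_form :: "real ^ 'm \<Rightarrow> 'a \<Rightarrow> 'a covector" where
  "basis_form b y = differential M y (lin (\<lambda>i. b $ i))"

lemma basis_form_cotangent: "basis_form b y \<in> cotangent_space M y"
  unfolding basis_form_def by (rule differential_cotangent)

lemma basis_form_coord: "y \<in> U \<Longrightarrow> basis_form b y (cv i y) = b $ i"
  unfolding basis_form_def by (rule differential_lin_coord)

lemma basis_form_pfaffian: "y \<in> U \<Longrightarrow> b \<in> coefficient_kernel \<Longrightarrow> basis_form b y \<in> pfaffian_of M V y"
  by (simp add: pfaffian_iff[OF _ basis_form_cotangent] basis_form_coord)

context
  fixes bs assumes kb: "kernel_basis bs"
begin

lemma kernel_basis_mem: "l < length bs \<Longrightarrow> bs ! l \<in> coefficient_kernel"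
  using kb nth_mem unfolding kernel_basis_def by blast

text \<open>The \<open>l\<close>-th coefficient is the inner product of the coordinate vector of
  \<open>w\<close> with \<open>bs ! l\<close>, so for a section it is a constant combination of its
  values on coordinate fields.\<close>

lemma basis_form_expansion:
  assumes y: "y \<in> U" and w: "w \<in> pfaffian_of M V y"
  shows "w = (\<lambda>v. \<Sum>l<length bs. (\<Sum>i\<in>UNIV. bs ! l $ i * w (cv i y)) * basis_form (bs ! l) y v)"
proof
  fix v
  have wc: "w \<in> cotangent_space M y" using w by (simp add: pfaffian_of_def)
  let ?a = "\<chi> i. w (cv i y)"
  have a: "?a \<in> coefficient_kernel" using w pfaffian_iff[OF y wc] by simp
  have dot: "?a \<bullet> b = (\<Sum>i\<in>UNIV. b $ i * w (cv i y))" for b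
    by (simp add: inner_vec_def mult.commute)
  have "(\<Sum>l<length bs. (?a \<bullet> bs ! l) *\<^sub>R bs ! l) = ?a"
    using kb a unfolding kernel_basis_def by blast
  then have comp: "w (cv i y) = (\<Sum>l<length bs. (?a \<bullet> bs ! l) * bs ! l $ i)" for i
    by (simp add: Finite_Cartesian_Product.vec_eq_iff)
  show "w v = (\<Sum>l<length bs. (\<Sum>i\<in>UNIV. bs ! l $ i * w (cv i y)) * basis_form (bs ! l) y v)"
  proof (cases "v \<in> tangent_space M y")
    case True
    have "w v = (\<Sum>i\<in>UNIV. w (cv i y) * v (\<lambda>z. u z $ i))"
    proof -
      have "w v = differential M y (lin (\<lambda>i. w (cv i y))) v"
        by (rule fun_cong[OF cotangent_lin[OF y wc]])
      then show ?thesis by (simp add: differential_apply[OF True] tangent_lin[OF True y])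
    qed
    also have "\<dots> = (\<Sum>i\<in>UNIV. \<Sum>l<length bs. (?a \<bullet> bs ! l) * (bs ! l $ i * v (\<lambda>z. u z $ i)))"
      by (subst comp) (simp only: sum_distrib_right mult.assoc)
    also have "\<dots> = (\<Sum>l<length bs. (?a \<bullet> bs ! l) * (\<Sum>i\<in>UNIV. bs ! l $ i * v (\<lambda>z. u z $ i)))"
      by (subst sum.swap) (simp only: sum_distrib_left)
    also have "\<dots> = (\<Sum>l<length bs. (?a \<bullet> bs ! l) * basis_form (bs ! l) y v)"
      by (simp only: basis_form_def differential_apply[OF True] tangent_lin[OF True y])
    finally show ?thesis by (simp only: dot)
  next
    case False
    then show ?thesis by (simp add: cotangent_outside[OF wc] basis_form_def differential_def)
  qed
qed

text \<open>Evaluation on the coordinate vectors turns the relation into one between the vectors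
  \<open>bs\<close>, and the inner product with \<open>bs ! m\<close> isolates one
  coefficient.\<close>

lemma basis_form_independent:
  assumes y: "y \<in> U" and zero: "(\<lambda>v. \<Sum>l<length bs. f l * basis_form (bs ! l) y v) = (\<lambda>v. 0)" and m: "m < length bs"
  shows "f m = 0"
proof -
  have comp: "(\<Sum>l<length bs. f l * bs ! l $ i) = 0" for i
    using fun_cong[OF zero, of "cv i y"] by (simp add: basis_form_coord[OF y])
  have "(\<Sum>l<length bs. f l *\<^sub>R bs ! l) = 0"
    by (simp add: Finite_Cartesian_Product.vec_eq_iff comp)
  then have "0 = (\<Sum>l<length bs. f l *\<^sub>R bs ! l) \<bullet> bs ! m" by simp
  also have "\<dots> = (\<Sum>l<length bs. f l * (bs ! l \<bullet> bs ! m))"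
    by (simp add: inner_sum_left)
  also have "\<dots> = (\<Sum>l<length bs. if l = m then f l else 0)"
    by (rule sum.cong[OF refl]) (use kb m in \<open>simp add: kernel_basis_def\<close>)
  also have "\<dots> = f m" using m by simp
  finally show ?thesis by simp
qed

lemma pfaffian_rank:
  assumes y: "y \<in> U"
  shows "real_fun.dim (pfaffian_of M V y) = length bs"
proof (rule real_fun.dim_unique)
  let ?\<theta> = "\<lambda>l. basis_form (bs ! l) y"
  \<comment> \<open>Dimension is computed from a set of covectors, so different positions of the
    list must give different covectors.\<close>
  have inj: "inj_on ?\<theta> {..<length bs}"
  proof (rule inj_onI)
    fix l m assume lm: "l \<in> {..<length bs}" "m \<in> {..<length bs}" "?\<theta> l = ?\<theta> m"
    have "bs ! l $ i = bs ! m $ i" for i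
      using fun_cong[OF lm(3), of "cv i y"] by (simp add: basis_form_coord[OF y])
    then have "bs ! l = bs ! m" by (simp add: Finite_Cartesian_Product.vec_eq_iff)
    then have "bs ! l \<bullet> bs ! m = bs ! m \<bullet> bs ! m" by (rule arg_cong)
    then show "l = m" using kb lm(1,2) by (simp add: kernel_basis_def split: if_splits)
  qed
  show "?\<theta> ` {..<length bs} \<subseteq> pfaffian_of M V y"
    using basis_form_pfaffian[OF y kernel_basis_mem] by blast
  show "card (?\<theta> ` {..<length bs}) = length bs" by (simp add: card_image[OF inj])
  show "pfaffian_of M V y \<subseteq> real_fun.span (?\<theta> ` {..<length bs})"
  proof
    fix w assume w: "w \<in> pfaffian_of M V y"
    let ?c = "\<lambda>l. \<Sum>i\<in>UNIV. bs ! l $ i * w (cv i y)"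
    have "(\<Sum>l<length bs. (\<lambda>v. ?c l * ?\<theta> l v)) \<in> real_fun.span (?\<theta> ` {..<length bs})"
      by (intro real_fun.span_sum real_fun.span_scale real_fun.span_base imageI)
    also have "(\<Sum>l<length bs. (\<lambda>v. ?c l * ?\<theta> l v)) = (\<lambda>v. \<Sum>l<length bs. ?c l * ?\<theta> l v)"
      by (rule ext) (rule sum_fun_apply)
    also have "\<dots> = w" by (rule basis_form_expansion[OF y w, symmetric])
    finally show "w \<in> real_fun.span (?\<theta> ` {..<length bs})" .
  qed
  show "real_fun.independent (?\<theta> ` {..<length bs})"
  proof
    assume "real_fun.dependent (?\<theta> ` {..<length bs})"
    then obtain f w where w: "w \<in> ?\<theta> ` {..<length bs}" "f w \<noteq> 0"
      and zero: "(\<Sum>x\<in>?\<theta> ` {..<length bs}. (\<lambda>t. f x * x t)) = 0"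
      unfolding real_fun.dependent_finite[OF finite_imageI[OF finite_lessThan]] by (elim exE conjE bexE) (rule that)
    from w(1) obtain m where m: "m < length bs" "w = ?\<theta> m" by auto
    have "(\<Sum>l<length bs. (\<lambda>t. f (?\<theta> l) * ?\<theta> l t)) = 0"
      using zero by (simp add: sum.reindex[OF inj])
    then have "(\<lambda>v. \<Sum>l<length bs. f (?\<theta> l) * ?\<theta> l v) = (\<lambda>v. 0)"
      by (simp add: fun_eq_iff sum_fun_apply)
    from basis_form_independent[OF y this m(1)] w(2) show False by (simp add: m(2))
  qed
qed

section \<open>Sections over open subsets of the chart\<close>

context
  fixes W assumes W: "open W" "W \<subseteq> U"
begin

lemma smooth_lin_on: "smooth_fun M W (lin a)"
  by (rule smooth_fun_subset[OF smooth_lin W(2)])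

lemma basis_form_section:
  assumes "l < length bs"
  shows "basis_form (bs ! l) \<in> pfaffian_sections M W (pfaffian_of M V)"
  unfolding pfaffian_sections_def
proof (intro CollectI conjI ballI)
  show "one_form M W (basis_form (bs ! l))"
    using one_form_differential[OF smooth_lin_on] by (simp add: basis_form_def[abs_def])
qed (use W(2) basis_form_pfaffian[OF _ kernel_basis_mem[OF assms]] in blast)

text \<open>A smooth one-form has smooth values on the coordinate fields, and the coefficients are
  constant combinations of these values.\<close>

lemma section_coefficients:
  assumes \<omega>: "\<omega> \<in> pfaffian_sections M W (pfaffian_of M V)"
  obtains f where "\<And>l. smooth_fun M W (f l)"
    "\<And>y. y \<in> W \<Longrightarrow> \<omega> y = (\<lambda>v. \<Sum>l<length bs. f l y * basis_form (bs ! l) y v)"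
proof
  have o: "one_form M W \<omega>" and P: "\<And>y. y \<in> W \<Longrightarrow> \<omega> y \<in> pfaffian_of M V y"
    using \<omega> unfolding pfaffian_sections_def by blast+
  have "smooth_fun M W (\<lambda>y. \<omega> y (cv i y))" for i
    using o W vector_field_subset[OF coord_vector_field[OF chart_mem, of i] W(2)] unfolding one_form_def by blast
  then show "smooth_fun M W (\<lambda>y. \<Sum>i\<in>UNIV. bs ! l $ i * \<omega> y (cv i y))" for l
    by (simp add: smooth_fun_sum[OF W(1)] smooth_fun_mult[OF W(1) smooth_fun_const[OF W(1)]])
  show "\<omega> y = (\<lambda>v. \<Sum>l<length bs. (\<Sum>i\<in>UNIV. bs ! l $ i * \<omega> y (cv i y)) * basis_form (bs ! l) y v)" if "y \<in> W" for y
    by (rule basis_form_expansion) (use that W(2) P in auto)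
qed

lemma basis_form_section_basis:
  "section_basis M W (pfaffian_of M V) (map basis_form bs)"
  unfolding section_basis_def
proof (intro conjI ballI allI impI)
  show "set (map basis_form bs) \<subseteq> pfaffian_sections M W (pfaffian_of M V)"
    using basis_form_section by (auto simp: in_set_conv_nth)
next
  fix \<omega> assume "\<omega> \<in> pfaffian_sections M W (pfaffian_of M V)"
  then obtain f where f: "\<And>l. smooth_fun M W (f l)"
    "\<And>y. y \<in> W \<Longrightarrow> \<omega> y = (\<lambda>v. \<Sum>l<length bs. f l y * basis_form (bs ! l) y v)"
    by (rule section_coefficients) (rule that)
  show "\<exists>f. (\<forall>i<length (map basis_form bs). smooth_fun M W (f i)) \<and>
      (\<forall>y\<in>W. \<omega> y = (\<lambda>v. \<Sum>i<length (map basis_form bs). f i y * (map basis_form bs ! i) y v))"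
    by (rule exI[of _ f]) (simp add: f)
next
  fix f i y assume f: "(\<forall>i<length (map basis_form bs). smooth_fun M W (f i)) \<and>
      (\<forall>y\<in>W. (\<lambda>v. \<Sum>i<length (map basis_form bs). f i y * (map basis_form bs ! i) y v) = (\<lambda>v. 0))"
    and i: "i < length (map basis_form bs)" and y: "y \<in> W"
  have "(\<lambda>v. \<Sum>l<length bs. f l y * basis_form (bs ! l) y v) = (\<lambda>v. 0)"
    using f y by (simp add: fun_eq_iff)
  then show "f i y = 0"
    using basis_form_independent[of y "\<lambda>l. f l y" i] i y W(2) by auto
qed

lemma basis_form_closed: "closed_one_form M W (basis_form b)"
  using closed_differential[OF W(1) smooth_lin_on] by (simp add: basis_form_def[abs_def])

lemma exterior_derivative_in_ideal:
  assumes \<omega>: "\<omega> \<in> pfaffian_sections M W (pfaffian_of M V)"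
  shows "\<exists>\<beta>\<in>form_ideal M W (form_of_one_form ` pfaffian_sections M W (pfaffian_of M V)).
    \<forall>y\<in>W. exterior_derivative M \<omega> y = \<beta> y"
proof -
  obtain f where f: "\<And>l. smooth_fun M W (f l)"
    "\<And>y. y \<in> W \<Longrightarrow> \<omega> y = (\<lambda>v. \<Sum>l<length bs. f l y * basis_form (bs ! l) y v)"
    by (rule section_coefficients[OF \<omega>]) (rule that)
  let ?\<gamma> = "\<lambda>l. form_wedge (form_of_one_form (\<lambda>y. differential M y (f l))) (form_of_one_form (basis_form (bs ! l)))"
  let ?I = "form_ideal M W (form_of_one_form ` pfaffian_sections M W (pfaffian_of M V))"
  have "(\<lambda>y vs. \<Sum>l<n. ?\<gamma> l y vs) \<in> ?I" if "n \<le> length bs" for n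
    using that
  proof (induction n)
    case 0
    show ?case using form_ideal.zero by simp
  next
    case (Suc n)
    have "?\<gamma> n \<in> ?I"
      \<comment> \<open>The differential of \<open>f n\<close> is a form on \<open>W\<close> and the
        basis form comes from a section, so their product is a left multiple of a generator.\<close>
      by (rule form_ideal.mult_left[OF form_of_differential[OF f(1)] form_ideal.generator[OF imageI[OF basis_form_section]]])
        (use Suc.prems in simp)
    moreover have "(\<lambda>y vs. \<Sum>l<n. ?\<gamma> l y vs) \<in> ?I" using Suc by simp
    ultimately show ?case using form_ideal.add by fastforce
  qed
  then have mem: "(\<lambda>y vs. \<Sum>l<length bs. ?\<gamma> l y vs) \<in> ?I" by simp
  have "exterior_derivative M \<omega> y vs = (\<Sum>l<length bs. ?\<gamma> l y vs)" if y: "y \<in> W" for y vs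
  proof (cases "\<exists>v w. vs = [v, w] \<and> v \<in> tangent_space M y \<and> w \<in> tangent_space M y")
    case True
    then obtain v w where vw: "vs = [v, w]" "v \<in> tangent_space M y" "w \<in> tangent_space M y" by blast
    have "exterior_derivative M \<omega> y [v, w] =
        (\<Sum>l<length bs. v (f l) * w (lin (\<lambda>i. bs ! l $ i)) - w (f l) * v (lin (\<lambda>i. bs ! l $ i)))"
      by (rule exterior_derivative_sum[OF W(1) y vw(2,3) f(1) smooth_lin_on])
        (simp add: f(2) basis_form_def)
    then show ?thesis
      by (simp add: vw(1) form_wedge_one_forms basis_form_def differential_apply[OF vw(2)] differential_apply[OF vw(3)])
  next
    case False
    \<comment> \<open>The forms must agree as total functions, so the default values on other
      argument lists are compared too.\<close>
    have "?\<gamma> l y vs = 0" for l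
      unfolding form_wedge_one_forms using False
      by (auto simp: basis_form_def differential_def split: list.splits)
    moreover have "exterior_derivative M \<omega> y vs = 0"
      by (rule exterior_derivative_outside) (use False in blast)
    ultimately show ?thesis by simp
  qed
  then show ?thesis using mem by (intro bexI[OF _ mem]) (simp add: fun_eq_iff)
qed

end

end

end

section \<open>From charts with constant coefficients to the whole manifold\<close>

lemma constant_coefficients_chart:
  fixes M :: "('a::{t2_space,second_countable_topology}, 'n::{finite,linorder}) atlas"
  assumes M: "smooth_manifold M" and V: "multivector_field M q V" and c: "constant_coefficients M q V"
  obtains U u where "constant_chart M q V U u" "x \<in> U"
proof -
  have "constant_coefficients_near M q V x" using c unfolding constant_coefficients_def by blast
  then obtain U u where Uu: "(U, u) \<in> M" "x \<in> U"
    and sorted: "\<And>is :: 'n list. length is = q \<and> sorted_wrt (<) is \<Longrightarrow>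
      \<exists>c. \<forall>y\<in>U. V y (map (\<lambda>i. differential M y (\<lambda>z. u z $ i)) is) = c"
    unfolding constant_coefficients_near_def by blast
  have "constant_chart M q V U u"
  proof (intro constant_chart.intro constant_chart_axioms.intro manifold.intro)
    show "\<exists>c. \<forall>y\<in>U. V y (map (\<lambda>i. differential M y (\<lambda>z. u z $ i)) is) = c" for "is"
      by (rule constant_on_index_lists[OF M V]) (rule sorted, simp)
  qed (rule M Uu V)+
  then show thesis using that Uu(2) by blast
qed

theorem proposition1p14:
  fixes M :: "('a::{t2_space,second_countable_topology}, 'n::{finite,linorder}) atlas"
    and q :: nat
    and V :: "'a \<Rightarrow> 'a multivector"
  assumes "smooth_manifold M"
    and "1 \<le> q" and "q \<le> CARD('n)"
    and "multivector_field M q V"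
    and "constant_coefficients M q V"
  shows "schouten_bracket M q q V V = (\<lambda>x ws. 0) \<and>
    locally_constant_rank (pfaffian_of M V) \<and>
    (\<forall>x. \<exists>U. open U \<and> x \<in> U \<and>
      (\<exists>\<theta>s. section_basis M U (pfaffian_of M V) \<theta>s \<and> (\<forall>\<theta>\<in>set \<theta>s. closed_one_form M U \<theta>))) \<and>
    integrable_pfaffian M (pfaffian_of M V)"
proof (intro conjI)
  note chart = constant_coefficients_chart[OF assms(1,4,5)]
  show "schouten_bracket M q q V V = (\<lambda>x ws. 0)"
  proof
    fix x
    obtain U u where "constant_chart M q V U u" "x \<in> U" by (rule chart)
    then show "schouten_bracket M q q V V x = (\<lambda>ws. 0)"
      by (rule constant_chart.schouten_bracket_zero[OF _ assms(2)])
  qed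
  show "locally_constant_rank (pfaffian_of M V)"
    unfolding locally_constant_rank_def
  proof
    fix x
    obtain U u where c: "constant_chart M q V U u" and x: "x \<in> U" by (rule chart)
    obtain bs where bs: "constant_chart.kernel_basis M V U u bs"
      using constant_chart.kernel_basis_exists[OF c] by blast
    note rank = constant_chart.pfaffian_rank[OF c bs]
    show "\<exists>U. open U \<and> x \<in> U \<and> (\<forall>y\<in>U. real_fun.dim (pfaffian_of M V y) = real_fun.dim (pfaffian_of M V x))"
      by (rule exI[of _ U]) (simp add: constant_chart.open_U[OF c] x rank)
  qed
  show "\<forall>x. \<exists>U. open U \<and> x \<in> U \<and>
      (\<exists>\<theta>s. section_basis M U (pfaffian_of M V) \<theta>s \<and> (\<forall>\<theta>\<in>set \<theta>s. closed_one_form M U \<theta>))"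
  proof
    fix x
    obtain U u where c: "constant_chart M q V U u" and x: "x \<in> U" by (rule chart)
    obtain bs where bs: "constant_chart.kernel_basis M V U u bs"
      using constant_chart.kernel_basis_exists[OF c] by blast
    note U = constant_chart.open_U[OF c]
    note basis = constant_chart.basis_form_section_basis[OF c bs U order_refl]
    have "\<forall>\<theta>\<in>set (map (constant_chart.basis_form M u) bs). closed_one_form M U \<theta>"
      using constant_chart.basis_form_closed[OF c bs U order_refl] by auto
    then show "\<exists>U. open U \<and> x \<in> U \<and>
      (\<exists>\<theta>s. section_basis M U (pfaffian_of M V) \<theta>s \<and> (\<forall>\<theta>\<in>set \<theta>s. closed_one_form M U \<theta>))"
      using U x basis by blast
  qed
  show "integrable_pfaffian M (pfaffian_of M V)"
    unfolding integrable_pfaffian_def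
  proof (intro allI impI ballI; elim conjE)
    fix U' \<omega> x
    assume x': "x \<in> U'" and U': "open U'" and \<omega>: "\<omega> \<in> pfaffian_sections M U' (pfaffian_of M V)"
    obtain U u where c: "constant_chart M q V U u" and x: "x \<in> U" by (rule chart)
    obtain bs where bs: "constant_chart.kernel_basis M V U u bs"
      using constant_chart.kernel_basis_exists[OF c] by blast
    \<comment> \<open>The chart around \<open>x\<close> may extend beyond the domain of the section,
      so both are restricted to the intersection.\<close>
    let ?W = "U \<inter> U'"
    have W: "open ?W" "?W \<subseteq> U" using constant_chart.open_U[OF c] U' by auto
    have "\<omega> \<in> pfaffian_sections M ?W (pfaffian_of M V)"
      using \<omega> by (auto simp: pfaffian_sections_def one_form_def)
    from constant_chart.exterior_derivative_in_ideal[OF c bs W this]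
    show "\<exists>W. open W \<and> x \<in> W \<and> W \<subseteq> U' \<and>
        (\<exists>\<beta>\<in>form_ideal M W (form_of_one_form ` pfaffian_sections M W (pfaffian_of M V)).
          \<forall>y\<in>W. exterior_derivative M \<omega> y = \<beta> y)"
      by (intro exI[of _ ?W] conjI) (use W x x' in auto)
  qed
qed

end
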